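(* Let $Z=(Z_1,\dots,Z_p)\sim N(0,\Sigma)$ be a centered Gaussian vector in $\mathbb{R}^p$, let $M = \max_{1 \le i \le p} Z_i$ with density $f$ on $(0,\infty)$, let $\sigma_{\max}^2=\max_{1\le i\le p}\mathbb{E}[Z_i^2]$ with $\sigma_{\max}\ge 0$, and let $m$ be a median of $M$. Whenever $m > 0$, the density $f$ is non-increasing on $[m,\infty)$, and for all $h \ge 0$, $$f(m + h\sigma_{\max}) \;\le\; \sqrt{2\pi}\, f(m)\, \varphi(h) \;=\; f(m)\, e^{-h^2/2},$$ where $\varphi$ is the standard Gaussian density. Consequently, if $p\ge 3$, then $$f(m + h\sigma_{\max}) \;\le\; \frac{4\log p}{m}\, e^{-h^2/2}\qquad\text{for all } h\ge 0.$$
   Context: $\varphi(x)=(2\pi)^{-1/2}e^{-x^2/2}$, and $\log$ is the natural logarithm. The law of $M$ restricted to $(0,\infty)$ is absolutely continuous; its density is taken to be the version $f(t)=\lim_{\delta\downarrow 0}\delta^{-1}\mathbb{P}\{t\le M<t+\delta\}$ for $t>0$. *)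

theory Defs
  imports "HOL-Probability.Probability"
begin

text \<open>The parameter \<open>\<sigma>\<close> is the standard deviation. The case \<open>\<sigma> = 0\<close> is the point mass at \<open>\<mu>\<close>;
  the library's \<^const>\<open>normal_density\<close> only describes a probability law for \<open>\<sigma> > 0\<close>.\<close>

definition normal_law :: "real \<Rightarrow> real \<Rightarrow> real measure" where
  "normal_law \<mu> \<sigma> =
     (if \<sigma> = 0 then return borel \<mu> else density lborel (normal_density \<mu> \<sigma>))"

text \<open>\<open>Z \<sim> N(0, \<Sigma>)\<close>: every linear combination \<open>t \<bullet> Z\<close> has the law \<open>N(0, t\<^sup>T \<Sigma> t)\<close>.
  The covariance matrix \<open>\<Sigma>\<close> may be singular.\<close>

definition centered_gaussian_vector ::
    "'a measure \<Rightarrow> ('a \<Rightarrow> real ^ 'p::finite) \<Rightarrow> real ^ 'p ^ 'p \<Rightarrow> bool" where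
  "centered_gaussian_vector P Z \<Sigma> \<longleftrightarrow>
     Z \<in> borel_measurable P \<and>
     transpose \<Sigma> = \<Sigma> \<and> (\<forall>t. 0 \<le> t \<bullet> (\<Sigma> *v t)) \<and>
     (\<forall>t. distr P borel (\<lambda>\<omega>. t \<bullet> Z \<omega>) = normal_law 0 (sqrt (t \<bullet> (\<Sigma> *v t))))"

definition is_median :: "'a measure \<Rightarrow> ('a \<Rightarrow> real) \<Rightarrow> real \<Rightarrow> bool" where
  "is_median P X m \<longleftrightarrow>
     measure P {\<omega> \<in> space P. X \<omega> \<le> m} \<ge> 1 / 2 \<and> measure P {\<omega> \<in> space P. X \<omega> \<ge> m} \<ge> 1 / 2"

text \<open>The pointwise version of the density of \<open>X\<close> given by the limit of
  \<open>\<delta>\<inverse> P{t \<le> X < t + \<delta>}\<close> as \<open>\<delta>\<close> decreases to 0. As always with \<^const>\<open>Lim\<close>,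
  the value is unspecified where the limit does not exist.\<close>

definition right_density :: "'a measure \<Rightarrow> ('a \<Rightarrow> real) \<Rightarrow> real \<Rightarrow> real" where
  "right_density P X t =
     Lim (at_right 0) (\<lambda>\<delta>. measure P {\<omega> \<in> space P. t \<le> X \<omega> \<and> X \<omega> < t + \<delta>} / \<delta>)"

end

theory Submission imports Defs begin

text \<open>By Ehrhard's inequality \<open>\<psi>(t) = \<Phi>\<inverse>(P(M \<le> t))\<close> is concave, so \<open>f = \<phi>(\<psi>) \<psi>'\<close> with \<open>\<psi>'\<close>
  the right derivative. To the right of the median \<open>\<psi> \<ge> 0\<close>, and both factors are non-increasing. The
  Gaussian tail of \<open>M\<close> forces \<open>\<psi>' \<ge> 1/\<sigma>\<close>, hence \<open>\<psi>(m + h\<sigma>) \<ge> h\<close>, which gives the decay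
  \<open>f(m + h\<sigma>) \<le> f(m) e\<^bsup>-h\<^sup>2/2\<^esup>\<close>.

  Ehrhard's inequality is proved one Gaussian coordinate at a time: along the heat flow \<open>u\<close> of
  \<open>\<Phi> \<circ> V\<close>, the function \<open>\<Phi>\<inverse> u\<close> satisfies a parabolic equation whose maximum principle
  preserves concavity inequalities.

  For the bound on \<open>f(m)\<close>, dominate \<open>f(m)\<close> by a sum over the facets of the polyhedron
  \<open>{x. \<forall>i. a\<^sub>i \<bullet> x \<le> m}\<close>. Facets at distance \<open>d\<close> with \<open>d\<^sup>2 \<le> 4 log p\<close> are compared, through Mills' ratio,
  with the disjoint prisms erected over them, whose total probability is at most 1/2; each
  remaining facet contributes at most \<open>1/p\<close> to \<open>m f(m)\<close>.\<close>

section \<open>Gaussian distribution function and quantile\<close>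

text \<open>Ehrhard's inequality is proved for functions because the induction over coordinates then
  reproduces its own hypotheses: averaging \<Phi> (W) over one normal coordinate and applying the
  quantile function turns a concave Lipschitz W into another one with the same constant. The
  Lipschitz bound also makes a maximum principle possible on an unbounded domain, since a quadratic
  barrier dominates linear growth. The level t enters by translation: subtracting t from every
  coordinate lowers the maximum by t, so concavity in space becomes concavity in t.

  The matrix \<Sigma> may be singular. Hence M can have an atom at 0, the analysis takes place on
  [a, \<infinity>) with 0 < a < m, and Gaussian laws are represented as images of independent
  standard normals and identified by their characteristic functions instead of densities.

  The threshold 4 log p is the point beyond which d \<phi>(d) \<le> exp (- d^2 / 4) falls below 1 /
  p, so that p far facets contribute at most 1 in total. Below it, Mills' ratio costs a factor 1 +
  d^2 \<le> 1 + 4 log p.\<close>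

abbreviation \<phi> :: "real \<Rightarrow> real" where "\<phi> \<equiv> std_normal_density"

definition std_normal_cdf :: "real \<Rightarrow> real" (\<open>\<Phi>\<close>) where
  "\<Phi> x = measure std_normal_distribution {..x}"

definition probit :: "real \<Rightarrow> real" where
  "probit = inv \<Phi>"

interpretation std_normal: real_distribution std_normal_distribution
  by (rule real_dist_normal_dist)

lemma phi_pos: "0 < \<phi> x"
  by (simp add: normal_density_pos)

lemma phi_minus [simp]: "\<phi> (- x) = \<phi> x"
  by (simp add: std_normal_density_def)

lemma phi_abs_mono: "\<bar>x\<bar> \<le> \<bar>y\<bar> \<Longrightarrow> \<phi> y \<le> \<phi> x"
  by (auto simp: std_normal_density_def abs_le_square_iff intro!: divide_right_mono)

lemma phi_deriv: "(\<phi> has_real_derivative - x * \<phi> x) (at x)"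
  unfolding std_normal_density_def by (auto intro!: derivative_eq_intros simp: field_simps)

lemma continuous_on_phi [continuous_intros]:
  "continuous_on S f \<Longrightarrow> continuous_on S (\<lambda>x. \<phi> (f x))"
  unfolding std_normal_density_def by (intro continuous_intros) auto

lemma Phi_diff_eq:
  assumes "a \<le> b" shows "\<Phi> b - \<Phi> a = integral {a..b} \<phi>"
proof -
  have "\<Phi> b - \<Phi> a = measure std_normal_distribution ({..b} - {..a})"
    unfolding std_normal_cdf_def using assms
    by (subst std_normal.finite_measure_Diff) auto
  also have "{..b} - {..a} = {a<..b}" by auto
  also have "measure std_normal_distribution {a<..b} = (LINT x:{a<..b}|lborel. \<phi> x)"
  proof -
    have "measure std_normal_distribution {a<..b} = (LINT x|std_normal_distribution. indicator {a<..b} x)"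
      by simp
    also have "\<dots> = (LINT x|lborel. \<phi> x *\<^sub>R indicator {a<..b} x)"
      by (rule integral_density) auto
    finally show ?thesis by (simp add: set_lebesgue_integral_def mult.commute)
  qed
  also have "\<dots> = (LINT x:{a..b}|lborel. \<phi> x)"
    unfolding set_lebesgue_integral_def
  proof (rule integral_cong_AE)
    show "AE x in lborel. indicator {a<..b} x *\<^sub>R \<phi> x = indicator {a..b} x *\<^sub>R \<phi> x"
      using AE_lborel_singleton[of a] by eventually_elim (auto split: split_indicator)
  qed measurable
  also have "\<dots> = integral {a..b} \<phi>"
    by (intro set_borel_integral_eq_integral borel_integrable_atLeastAtMost')
      (auto intro!: continuous_intros)
  finally show ?thesis .
qed

lemma Phi_deriv: "(\<Phi> has_real_derivative \<phi> x) (at x)"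
proof -
  have "((\<lambda>u. integral {x-1..u} \<phi>) has_real_derivative \<phi> x) (at x within {x-1..x+1})"
    by (rule integral_has_real_derivative) (auto intro!: continuous_intros)
  then have "((\<lambda>u. integral {x-1..u} \<phi>) has_real_derivative \<phi> x) (at x)"
    by (subst (asm) at_within_interior) (auto simp: interior_cbox)
  then have "((\<lambda>u. integral {x-1..u} \<phi> + \<Phi> (x-1)) has_real_derivative \<phi> x) (at x)"
    by (auto intro!: derivative_eq_intros)
  moreover have "\<forall>\<^sub>F u in nhds x. integral {x-1..u} \<phi> + \<Phi> (x-1) = \<Phi> u"
  proof -
    have "\<forall>\<^sub>F u in nhds x. u \<in> {x-1<..}"
      by (rule eventually_nhds_in_open) auto
    then show ?thesis
    proof (rule eventually_mono)
      fix u assume "u \<in> {x-1<..}"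
      then show "integral {x-1..u} \<phi> + \<Phi> (x-1) = \<Phi> u"
        using Phi_diff_eq[of "x-1" u] by simp
    qed
  qed
  ultimately show ?thesis
    by (subst (asm) DERIV_cong_ev[OF refl _ refl]) auto
qed

lemma Phi_strict_mono: "strict_mono \<Phi>"
  by (rule strict_monoI, rule DERIV_pos_imp_increasing) (use Phi_deriv phi_pos in blast)+

lemma Phi_less_iff [simp]: "\<Phi> x < \<Phi> y \<longleftrightarrow> x < y"
  by (rule strict_mono_less[OF Phi_strict_mono])

lemma Phi_le_iff [simp]: "\<Phi> x \<le> \<Phi> y \<longleftrightarrow> x \<le> y"
  by (rule strict_mono_less_eq[OF Phi_strict_mono])

lemma Phi_eq_iff [simp]: "\<Phi> x = \<Phi> y \<longleftrightarrow> x = y"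
  by (rule strict_mono_eq[OF Phi_strict_mono])

lemma isCont_Phi: "isCont \<Phi> x"
  using Phi_deriv DERIV_isCont by blast

lemma continuous_on_Phi: "continuous_on S \<Phi>"
  using isCont_Phi continuous_at_imp_continuous_on by blast

lemma borel_measurable_Phi [measurable]: "\<Phi> \<in> borel_measurable borel"
  using continuous_on_Phi by (rule borel_measurable_continuous_onI)

lemma Phi_at_top: "(\<Phi> \<longlongrightarrow> 1) at_top"
  using std_normal.cdf_lim_at_top_prob unfolding cdf_def2 std_normal_cdf_def .

lemma Phi_at_bot: "(\<Phi> \<longlongrightarrow> 0) at_bot"
  using std_normal.cdf_lim_at_bot unfolding cdf_def2 std_normal_cdf_def .

lemma Phi_gt_0 [simp]: "0 < \<Phi> x"
proof -
  have "0 \<le> \<Phi> (x - 1)" by (simp add: std_normal_cdf_def)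
  also have "\<dots> < \<Phi> x" by simp
  finally show ?thesis .
qed

lemma Phi_lt_1 [simp]: "\<Phi> x < 1"
proof -
  have "\<Phi> x < \<Phi> (x + 1)" by simp
  also have "\<dots> \<le> 1" by (simp add: std_normal_cdf_def)
  finally show ?thesis .
qed

lemma Phi_minus: "\<Phi> (- x) = 1 - \<Phi> x"
proof -
  have "((\<lambda>x. \<Phi> x + \<Phi> (- x)) has_real_derivative 0) (at x)" for x
    using DERIV_add[OF Phi_deriv[of x] DERIV_chain2[OF Phi_deriv[of "- x"] DERIV_minus[OF DERIV_ident]]]
    by simp
  then have c: "\<Phi> y + \<Phi> (- y) = \<Phi> x + \<Phi> (- x)" for y
    using DERIV_isconst_all by blast
  have "((\<lambda>y. \<Phi> y + \<Phi> (- y)) \<longlongrightarrow> 1 + 0) at_top"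
    by (intro tendsto_add Phi_at_top filterlim_compose[OF Phi_at_bot] filterlim_uminus_at_bot_at_top)
  then have "((\<lambda>y. \<Phi> x + \<Phi> (- x)) \<longlongrightarrow> 1) (at_top::real filter)"
    by (subst (asm) c) simp
  then have "\<Phi> x + \<Phi> (- x) = 1"
    by (simp add: tendsto_const_iff)
  then show ?thesis by simp
qed

lemma Phi_0 [simp]: "\<Phi> 0 = 1 / 2"
  using Phi_minus[of 0] by simp

lemma probit_Phi [simp]: "probit (\<Phi> x) = x"
  unfolding probit_def by (rule inv_f_f) (simp add: inj_def)

lemma Phi_probit: assumes "0 < p" "p < 1" shows "\<Phi> (probit p) = p"
proof -
  obtain a where a: "\<Phi> a < p"
    using eventually_happens'[OF _ order_tendstoD(2)[OF Phi_at_bot \<open>0 < p\<close>]] by auto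
  obtain b where b: "p < \<Phi> b"
    using eventually_happens'[OF _ order_tendstoD(1)[OF Phi_at_top \<open>p < 1\<close>]] by auto
  have "a \<le> b" using a b by (meson Phi_less_iff less_trans less_imp_le)
  then obtain x where "\<Phi> x = p"
    using IVT'[of \<Phi> a p b] a b continuous_on_Phi by force
  then show ?thesis by auto
qed

lemma probit_eqI: "\<Phi> x = p \<Longrightarrow> probit p = x"
  by auto

lemma isCont_probit: assumes "0 < p" "p < 1" shows "isCont probit p"
proof -
  have "isCont probit (\<Phi> (probit p))"
    by (rule isCont_inverse_function[where d=1]) (auto simp: isCont_Phi)
  then show ?thesis using assms by (simp add: Phi_probit)
qed

lemma probit_deriv:
  assumes "0 < p" "p < 1"
  shows "(probit has_real_derivative 1 / \<phi> (probit p)) (at p)"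
proof -
  have "(probit has_real_derivative inverse (\<phi> (probit p))) (at p)"
    by (rule DERIV_inverse_function[where f=\<Phi> and a=0 and b=1])
      (use assms Phi_probit Phi_deriv isCont_probit phi_pos in \<open>auto simp: less_imp_neq[symmetric]\<close>)
  then show ?thesis by (simp add: inverse_eq_divide)
qed

section \<open>Gaussian tail estimates\<close>

lemma antimono_limit_ge:
  fixes h :: "real \<Rightarrow> real"
  assumes "\<And>x. a \<le> x \<Longrightarrow> \<exists>d. (h has_real_derivative d) (at x) \<and> d \<le> 0" and "(h \<longlongrightarrow> l) at_top"
  shows "l \<le> h a"
proof (rule tendsto_upperbound[OF assms(2)])
  show "\<forall>\<^sub>F x in at_top. h x \<le> h a"
    using eventually_ge_at_top[of a]
    by eventually_elim (rule DERIV_nonpos_imp_nonincreasing, use assms(1) in auto)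
qed simp

lemma phi_at_top: "(\<phi> \<longlongrightarrow> 0) at_top"
  unfolding std_normal_density_def by real_asymp

text \<open>From 1 on, right side minus left side has derivative \<open>(1 - y) * \<phi> y\<close>
  and so decreases; it vanishes at infinity.\<close>

lemma Phi_upper_tail_le:
  assumes "1 \<le> x" shows "1 - \<Phi> x \<le> \<phi> x"
proof -
  have "0 \<le> \<phi> x - (1 - \<Phi> x)"
  proof (rule antimono_limit_ge[where h="\<lambda>x. \<phi> x - (1 - \<Phi> x)"])
    fix y assume "x \<le> y"
    have "((\<lambda>x. \<phi> x - (1 - \<Phi> x)) has_real_derivative (- y * \<phi> y + \<phi> y)) (at y)"
      by (rule derivative_eq_intros phi_deriv Phi_deriv refl)+ simp
    moreover have "- y * \<phi> y + \<phi> y = (1 - y) * \<phi> y" by (simp add: algebra_simps)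
    moreover have "(1 - y) * \<phi> y \<le> 0"
      using assms \<open>x \<le> y\<close> phi_pos[of y] by (intro mult_nonpos_nonneg) auto
    ultimately show "\<exists>d. ((\<lambda>x. \<phi> x - (1 - \<Phi> x)) has_real_derivative d) (at y) \<and> d \<le> 0"
      by metis
  next
    have "((\<lambda>x. \<phi> x - (1 - \<Phi> x)) \<longlongrightarrow> 0 - (1 - 1)) at_top"
      by (intro tendsto_intros phi_at_top Phi_at_top)
    then show "((\<lambda>x. \<phi> x - (1 - \<Phi> x)) \<longlongrightarrow> 0) at_top" by simp
  qed
  then show ?thesis by simp
qed

text \<open>After division by 1 + x^2 the difference \<open>h\<close> has the clean derivative
  \<open>- 2 * \<phi> y / (1 + y^2)^2\<close>. It therefore decreases to its limit 0 and is
  nonnegative on the whole line.\<close>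

lemma Mills_ratio_lower:
  "x * \<phi> x \<le> (1 + x\<^sup>2) * (1 - \<Phi> x)"
proof -
  define h where "h = (\<lambda>x. (1 - \<Phi> x) - x * \<phi> x / (1 + x\<^sup>2))"
  have pos: "1 + y\<^sup>2 > 0" for y :: real by (simp add: add_pos_nonneg)
  have "0 \<le> h x"
  proof (rule antimono_limit_ge[where h=h])
    fix y
    let ?d = "- \<phi> y - ((\<phi> y + y * (- y * \<phi> y)) * (1 + y\<^sup>2) - (y * \<phi> y) * (2 * y)) / ((1 + y\<^sup>2) * (1 + y\<^sup>2))"
    have "(h has_real_derivative ?d) (at y)"
      unfolding h_def using pos[of y]
      by (auto intro!: derivative_eq_intros phi_deriv Phi_deriv simp: less_imp_neq[symmetric])
    moreover have "?d = - 2 * \<phi> y / ((1 + y\<^sup>2) * (1 + y\<^sup>2))"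
      using pos[of y] by (simp add: divide_simps) algebra
    moreover have "\<dots> \<le> 0"
      using phi_pos[of y] pos[of y] by (simp add: divide_nonneg_pos)
    ultimately show "\<exists>d. (h has_real_derivative d) (at y) \<and> d \<le> 0" by metis
  next
    have "((\<lambda>x. x * \<phi> x / (1 + x\<^sup>2)) \<longlongrightarrow> 0) at_top"
      unfolding std_normal_density_def by real_asymp
    then have "(h \<longlongrightarrow> (1 - 1) - 0) at_top"
      unfolding h_def by (intro tendsto_intros Phi_at_top)
    then show "(h \<longlongrightarrow> 0) at_top" by simp
  qed
  then show ?thesis using pos[of x] by (simp add: h_def field_simps)
qed

text \<open>The map \<open>p \<mapsto> \<Phi> (\<Phi>\<inverse> p + c)\<close> is concave for \<open>c \<ge> 0\<close>; this is its tangent-line form.\<close>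

lemma Phi_shift_tangent:
  assumes "0 \<le> c"
  shows "\<Phi> (x + c) \<le> \<Phi> (y + c) + \<phi> (y + c) / \<phi> y * (\<Phi> x - \<Phi> y)"
proof -
  define k where "k = (\<lambda>x. \<phi> (y + c) / \<phi> y * \<Phi> x - \<Phi> (x + c))"
  \<comment> \<open>The likelihood ratio of the shifted density is non-increasing in
    \<open>u\<close>; hence \<open>k\<close> decreases up to \<open>y\<close>, increases after it,
    and is minimal at \<open>y\<close>.\<close>
  have ratio: "\<phi> (u + c) = \<phi> u * exp (- c * u - c\<^sup>2 / 2)" for u
    by (simp add: std_normal_density_def exp_add[symmetric] power2_eq_square field_simps)
  have d: "(k has_real_derivative \<phi> u * (exp (- c * y - c\<^sup>2 / 2) - exp (- c * u - c\<^sup>2 / 2))) (at u)" for u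
  proof -
    have "((\<lambda>u. \<Phi> (u + c)) has_real_derivative \<phi> (u + c)) (at u)"
      using DERIV_shift Phi_deriv by blast
    then have "(k has_real_derivative \<phi> (y + c) / \<phi> y * \<phi> u - \<phi> (u + c)) (at u)"
      unfolding k_def by (intro DERIV_diff DERIV_cmult Phi_deriv)
    then show ?thesis
      using phi_pos[of y] by (simp add: ratio right_diff_distrib mult.commute)
  qed
  have "k y \<le> k x"
  proof (cases "y \<le> x")
    case True
    show ?thesis
    proof (rule DERIV_nonneg_imp_nondecreasing[OF True])
      fix u assume "y \<le> u" "u \<le> x"
      then have "c * y \<le> c * u" using assms by (simp add: mult_left_mono)
      then show "\<exists>d. (k has_real_derivative d) (at u) \<and> 0 \<le> d"
        using d[of u] phi_pos[of u] by (intro exI[of _ "\<phi> u * (exp (- c * y - c\<^sup>2 / 2) - exp (- c * u - c\<^sup>2 / 2))"]) simp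
    qed
  next
    case False
    then have "x \<le> y" by simp
    then show ?thesis
    proof (rule DERIV_nonpos_imp_nonincreasing)
      fix u assume "x \<le> u" "u \<le> y"
      then have "c * u \<le> c * y" using assms by (simp add: mult_left_mono)
      then show "\<exists>d. (k has_real_derivative d) (at u) \<and> d \<le> 0"
        using d[of u] phi_pos[of u]
        by (intro exI[of _ "\<phi> u * (exp (- c * y - c\<^sup>2 / 2) - exp (- c * u - c\<^sup>2 / 2))"])
          (simp add: mult_nonneg_nonpos)
    qed
  qed
  then show ?thesis
    by (simp add: k_def right_diff_distrib)
qed

section \<open>Averages of \<Phi> under a probability measure\<close>

lemma (in prob_space) integrable_Phi:
  "X \<in> borel_measurable M \<Longrightarrow> integrable M (\<lambda>x. \<Phi> (X x))"
  by (rule integrable_const_bound[where B=1]) (auto simp: less_imp_le)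

text \<open>An everywhere positive integrand cannot have integral 0 under a probability measure.
  Strictness matters because \<open>probit\<close> is an inverse only on the open unit
  interval.\<close>

lemma (in prob_space) expectation_Phi_bounds:
  assumes [measurable]: "X \<in> borel_measurable M"
  shows "0 < expectation (\<lambda>x. \<Phi> (X x))" "expectation (\<lambda>x. \<Phi> (X x)) < 1"
proof -
  have i: "integrable M (\<lambda>x. \<Phi> (X x))"
    by (rule integrable_Phi) measurable
  have "measure M (space M) \<noteq> 0" by (simp add: prob_space)
  then have ne: "\<not> (AE x in M. False)" by (simp add: AE_False)
  show "0 < expectation (\<lambda>x. \<Phi> (X x))"
  proof (rule ccontr)
    assume "\<not> 0 < expectation (\<lambda>x. \<Phi> (X x))"
    then have "expectation (\<lambda>x. \<Phi> (X x)) = 0"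
      by (simp add: order_antisym not_less less_imp_le)
    then have "AE x in M. \<Phi> (X x) = 0"
      using i by (subst (asm) integral_nonneg_eq_0_iff_AE) (auto simp: less_imp_le)
    then show False using ne by (simp add: less_imp_neq[symmetric])
  qed
  show "expectation (\<lambda>x. \<Phi> (X x)) < 1"
  proof (rule ccontr)
    assume "\<not> expectation (\<lambda>x. \<Phi> (X x)) < 1"
    moreover have "0 \<le> expectation (\<lambda>x. 1 - \<Phi> (X x))"
      by (rule integral_nonneg_AE) (simp add: less_imp_le)
    ultimately have "expectation (\<lambda>x. 1 - \<Phi> (X x)) = 0"
      using i by (simp add: prob_space)
    then have "AE x in M. 1 - \<Phi> (X x) = 0"
      using i by (subst (asm) integral_nonneg_eq_0_iff_AE) (auto simp: less_imp_le)
    then show False using ne by (simp add: less_imp_neq[symmetric])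
  qed
qed

text \<open>Jensen's inequality for the concave map of \<open>Phi_shift_tangent\<close>: taking the
  tangent at the quantile of the mean makes the linear correction integrate to zero. This is why
  averaging followed by \<open>probit\<close> preserves Lipschitz constants.\<close>

lemma (in prob_space) expectation_Phi_shift_le:
  assumes [measurable]: "X \<in> borel_measurable M" "Y \<in> borel_measurable M"
    and "0 \<le> c" and le: "\<And>\<omega>. \<omega> \<in> space M \<Longrightarrow> Y \<omega> \<le> X \<omega> + c"
  shows "probit (expectation (\<lambda>x. \<Phi> (Y x))) \<le> probit (expectation (\<lambda>x. \<Phi> (X x))) + c"
proof -
  define p where "p = expectation (\<lambda>x. \<Phi> (X x))"
  define y where "y = probit p"
  have p: "0 < p" "p < 1" using expectation_Phi_bounds[of X] by (auto simp: p_def)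
  then have y: "\<Phi> y = p" by (simp add: y_def Phi_probit)
  let ?k = "\<phi> (y + c) / \<phi> y"
  have iX: "integrable M (\<lambda>x. \<Phi> (X x))" by (rule integrable_Phi) measurable
  have "expectation (\<lambda>x. \<Phi> (Y x)) \<le> expectation (\<lambda>x. \<Phi> (y + c) + ?k * (\<Phi> (X x) - \<Phi> y))"
  proof (rule integral_mono)
    fix \<omega> assume "\<omega> \<in> space M"
    then have "\<Phi> (Y \<omega>) \<le> \<Phi> (X \<omega> + c)" using le by simp
    also have "\<dots> \<le> \<Phi> (y + c) + ?k * (\<Phi> (X \<omega>) - \<Phi> y)"
      using Phi_shift_tangent \<open>0 \<le> c\<close> by blast
    finally show "\<Phi> (Y \<omega>) \<le> \<Phi> (y + c) + ?k * (\<Phi> (X \<omega>) - \<Phi> y)" .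
  qed (use iX in \<open>auto intro!: integrable_Phi\<close>)
  also have "\<dots> = \<Phi> (y + c) + ?k * (p - \<Phi> y)"
    using iX by (simp add: p_def prob_space)
  also have "\<dots> = \<Phi> (y + c)" by (simp add: y)
  finally have "\<Phi> (probit (expectation (\<lambda>x. \<Phi> (Y x)))) \<le> \<Phi> (y + c)"
    using expectation_Phi_bounds[of Y] by (simp add: Phi_probit)
  then show ?thesis by (simp add: y_def p_def)
qed

section \<open>Heat semigroup on the line\<close>

lemma has_real_derivative_integral_dominated:
  fixes f f' :: "real \<Rightarrow> 'b \<Rightarrow> real"
  assumes "0 < d"
    and f: "\<And>t. \<bar>t - t0\<bar> < d \<Longrightarrow> integrable M (f t)"
    and f': "\<And>t y. \<bar>t - t0\<bar> < d \<Longrightarrow> y \<in> space M \<Longrightarrow> ((\<lambda>t. f t y) has_real_derivative f' t y) (at t)"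
    and bound: "\<And>t y. \<bar>t - t0\<bar> < d \<Longrightarrow> y \<in> space M \<Longrightarrow> \<bar>f' t y\<bar> \<le> G y"
    and G: "integrable M G" and meas: "f' t0 \<in> borel_measurable M"
  shows "((\<lambda>t. \<integral>y. f t y \<partial>M) has_real_derivative (\<integral>y. f' t0 y \<partial>M)) (at t0)"
  unfolding DERIV_def tendsto_at_iff_sequentially comp_def
proof (intro allI impI)
  fix X :: "nat \<Rightarrow> real" assume "\<forall>i. X i \<in> UNIV - {0}" and X: "X \<longlonglongrightarrow> 0"
  then have nz: "X i \<noteq> 0" for i by auto
  \<comment> \<open>The difference quotient is cut off to 0 for large increments, so that the
    domination by \<open>G\<close> holds for every index and not only eventually.\<close>
  define q where "q = (\<lambda>i y. if \<bar>X i\<bar> < d then (f (t0 + X i) y - f t0 y) / X i else 0)"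
  have ev: "\<forall>\<^sub>F i in sequentially. \<bar>X i\<bar> < d"
    using tendstoD[OF X \<open>0 < d\<close>] by (simp add: dist_real_def)
  have f0: "integrable M (f t0)" using f[of t0] \<open>0 < d\<close> by simp
  have "(\<lambda>i. \<integral>y. q i y \<partial>M) \<longlonglongrightarrow> (\<integral>y. f' t0 y \<partial>M)"
  proof (rule integral_dominated_convergence)
    show "integrable M G" by (rule G)
    show "f' t0 \<in> borel_measurable M" by (rule meas)
    show "q i \<in> borel_measurable M" for i
      using borel_measurable_integrable[OF f[of "t0 + X i"]] borel_measurable_integrable[OF f0]
      by (cases "\<bar>X i\<bar> < d") (simp_all add: q_def)
    show "AE y in M. (\<lambda>i. q i y) \<longlonglongrightarrow> f' t0 y"
    proof (rule AE_I2)
      fix y assume y: "y \<in> space M"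
      have "((\<lambda>h. (f (t0 + h) y - f t0 y) / h) \<longlongrightarrow> f' t0 y) (at 0)"
        using f'[of t0 y] y \<open>0 < d\<close> by (simp add: DERIV_def)
      then have "(\<lambda>i. (f (t0 + X i) y - f t0 y) / X i) \<longlonglongrightarrow> f' t0 y"
        unfolding tendsto_at_iff_sequentially comp_def using X nz by auto
      moreover have "\<forall>\<^sub>F i in sequentially. (f (t0 + X i) y - f t0 y) / X i = q i y"
        using ev by eventually_elim (simp add: q_def)
      ultimately show "(\<lambda>i. q i y) \<longlonglongrightarrow> f' t0 y"
        by (rule Lim_transform_eventually)
    qed
    show "AE y in M. norm (q i y) \<le> G y" for i
    proof (rule AE_I2)
      fix y assume y: "y \<in> space M"
      have G0: "0 \<le> G y" using bound[of t0 y] y \<open>0 < d\<close> by (simp add: order_trans[OF abs_ge_zero])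
      have "\<bar>f (t0 + X i) y - f t0 y\<bar> \<le> G y * \<bar>X i\<bar>" if "\<bar>X i\<bar> < d"
      proof -
        have "norm (f (t0 + X i) y - f t0 y) \<le> G y * norm (t0 + X i - t0)"
        proof (rule field_differentiable_bound[where S="{t. \<bar>t - t0\<bar> < d}" and f="\<lambda>t. f t y" and f'="\<lambda>t. f' t y"])
          have "{t. \<bar>t - t0\<bar> < d} = ball t0 d"
            by (auto simp: dist_real_def abs_minus_commute)
          then show "convex {t. \<bar>t - t0\<bar> < d}" by simp
                  show "((\<lambda>t. f t y) has_real_derivative f' t y) (at t within {t. \<bar>t - t0\<bar> < d})"
            if "t \<in> {t. \<bar>t - t0\<bar> < d}" for t
            using that y f' has_field_derivative_at_within by blast
        qed (use that \<open>0 < d\<close> y bound in auto)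
        then show ?thesis by simp
      qed
      then show "norm (q i y) \<le> G y"
        using nz[of i] G0 by (auto simp: q_def field_simps)
    qed
  qed
  moreover have "\<forall>\<^sub>F i in sequentially. (\<integral>y. q i y \<partial>M) = ((\<integral>y. f (t0 + X i) y \<partial>M) - (\<integral>y. f t0 y \<partial>M)) / X i"
    using ev
  proof eventually_elim
    case (elim i)
    have "integrable M (f (t0 + X i))" using f elim by simp
    then show ?case using f0 elim nz[of i] by (simp add: q_def)
  qed
  ultimately show "(\<lambda>i. ((\<integral>y. f (t0 + X i) y \<partial>M) - (\<integral>y. f t0 y \<partial>M)) / X i) \<longlonglongrightarrow> (\<integral>y. f' t0 y \<partial>M)"
    by (rule Lim_transform_eventually)
qed

text \<open>Averaging over a fixed standard normal keeps s = 0 inside the definition and gives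
  continuity up to time 0. The kernel form of \<open>heat_eq_integral_kernel\<close>, which carries
  the derivatives, is restricted to s > 0.\<close>

definition heat :: "(real \<Rightarrow> real) \<Rightarrow> real \<Rightarrow> real \<Rightarrow> real" where
  "heat g s x = (\<integral>z. g (x + sqrt s * z) \<partial>std_normal_distribution)"

abbreviation heat_kernel :: "real \<Rightarrow> real \<Rightarrow> real \<Rightarrow> real" where
  "heat_kernel s x \<equiv> normal_density x (sqrt s)"

lemma heat_eq_integral_kernel:
  assumes [measurable]: "g \<in> borel_measurable borel" and "0 < s"
  shows "heat g s x = (\<integral>y. g y * heat_kernel s x y \<partial>lborel)"
proof -
  have "(\<integral>y. g y * heat_kernel s x y \<partial>lborel)
      = \<bar>sqrt s\<bar> *\<^sub>R (\<integral>z. g (x + sqrt s * z) * heat_kernel s x (x + sqrt s * z) \<partial>lborel)"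
    by (rule lborel_integral_real_affine) (use \<open>0 < s\<close> in simp)
  also have "\<dots> = (\<integral>z. \<bar>sqrt s\<bar> * (g (x + sqrt s * z) * heat_kernel s x (x + sqrt s * z)) \<partial>lborel)"
    by simp
  also have "\<dots> = (\<integral>z. \<phi> z *\<^sub>R g (x + sqrt s * z) \<partial>lborel)"
    using \<open>0 < s\<close>
    by (intro Bochner_Integration.integral_cong refl)
      (simp add: normal_density_def real_sqrt_mult power_mult_distrib field_simps)
  also have "\<dots> = heat g s x"
    unfolding heat_def by (subst integral_density) auto
  finally show ?thesis by simp
qed

lemma heat_0 [simp]: "heat g 0 x = g x"
  using std_normal.prob_space by (simp add: heat_def)

section \<open>Heat kernel: derivatives and a common majorant\<close>

lemma heat_kernel_deriv_x:
  assumes "0 < s"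
  shows "((\<lambda>x. heat_kernel s x y) has_real_derivative heat_kernel s x y * ((y - x) / s)) (at x)"
proof -
  have "((\<lambda>x. exp (- (y - x)\<^sup>2 / (2 * s))) has_real_derivative exp (- (y - x)\<^sup>2 / (2 * s)) * ((y - x) / s)) (at x)"
    using assms by (auto intro!: derivative_eq_intros simp: field_simps)
  from DERIV_cmult[OF this, of "1 / sqrt (2 * pi * s)"] show ?thesis
    using assms by (simp add: normal_density_def mult.assoc)
qed

lemma heat_kernel_deriv_xx:
  assumes "0 < s"
  shows "((\<lambda>x. heat_kernel s x y * ((y - x) / s)) has_real_derivative
    heat_kernel s x y * ((y - x)\<^sup>2 / s\<^sup>2 - 1 / s)) (at x)"
proof -
  have "((\<lambda>x. (y - x) / s) has_real_derivative - 1 / s) (at x)"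
    using assms by (auto intro!: derivative_eq_intros)
  from DERIV_mult[OF heat_kernel_deriv_x[OF assms, of y] this] show ?thesis
    using assms by (simp add: field_simps power2_eq_square)
qed

text \<open>The factor is half of the one in \<open>heat_kernel_deriv_xx\<close>: this is the heat
  equation for the kernel, which integration against \<open>g\<close> passes on to
  \<open>heat g\<close>.\<close>

lemma heat_kernel_deriv_s:
  assumes "0 < s"
  shows "((\<lambda>s. heat_kernel s x y) has_real_derivative
    heat_kernel s x y * ((y - x)\<^sup>2 / s\<^sup>2 - 1 / s) / 2) (at s)"
proof -
  have "((\<lambda>s. 1 / sqrt (2 * pi * s) * exp (- (y - x)\<^sup>2 / (2 * s))) has_real_derivative
    1 / sqrt (2 * pi * s) * exp (- (y - x)\<^sup>2 / (2 * s)) * ((y - x)\<^sup>2 / s\<^sup>2 - 1 / s) / 2) (at s)"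
  proof -
    have 1: "((\<lambda>s. 1 / sqrt (2 * pi * s)) has_real_derivative - (1 / sqrt (2 * pi * s)) / (2 * s)) (at s)"
      using assms
      by (auto intro!: derivative_eq_intros simp: field_simps real_sqrt_mult power2_eq_square)
    have 2: "((\<lambda>s. exp (- (y - x)\<^sup>2 / (2 * s))) has_real_derivative
        exp (- (y - x)\<^sup>2 / (2 * s)) * ((y - x)\<^sup>2 / (2 * s\<^sup>2))) (at s)"
      using assms by (auto intro!: derivative_eq_intros simp: field_simps power2_eq_square)
    show ?thesis
    proof (rule DERIV_cong[OF DERIV_mult[OF 1 2]])
      have "- A / (2 * s) * E + E * (q / (2 * s\<^sup>2)) * A = A * E * (q / s\<^sup>2 - 1 / s) / 2" for A E q :: real
        using assms by (simp add: field_simps power2_eq_square)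
      then show "- (1 / sqrt (2 * pi * s)) / (2 * s) * exp (- (y - x)\<^sup>2 / (2 * s)) +
          exp (- (y - x)\<^sup>2 / (2 * s)) * ((y - x)\<^sup>2 / (2 * s\<^sup>2)) * (1 / sqrt (2 * pi * s)) =
          1 / sqrt (2 * pi * s) * exp (- (y - x)\<^sup>2 / (2 * s)) * ((y - x)\<^sup>2 / s\<^sup>2 - 1 / s) / 2" .
    qed
  qed
  moreover have "\<forall>\<^sub>F t in nhds s. 1 / sqrt (2 * pi * t) * exp (- (y - x)\<^sup>2 / (2 * t)) = heat_kernel t x y"
    using eventually_nhds_in_open[of "{0<..}" s] assms
    by (auto simp: normal_density_def elim!: eventually_mono)
  ultimately show ?thesis
    using assms by (subst (asm) DERIV_cong_ev[OF refl _ refl]) (auto simp: normal_density_def)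
qed

text \<open>Supplies one integrable majorant for all (s, x) near (s0, x0), as differentiation under
  the integral requires. By (y - x)^2 \<ge> (y - x0)^2 / 2 - 1 and s \<le> 2 s0, the exponent (y -
  x)^2 / (2 s) is at least (y - x0)^2 / (8 s0) up to an additive constant, which belongs to a
  Gaussian of standard deviation 2 sqrt s0. The factor 3 rounds up sqrt 8, the largest ratio of the
  normalizations.\<close>

lemma heat_kernel_bound:
  assumes "0 < s0" "s0 / 2 \<le> s" "s \<le> 2 * s0" "\<bar>x - x0\<bar> \<le> 1"
  shows "heat_kernel s x y \<le> 3 * exp (1 / s0) * normal_density x0 (2 * sqrt s0) y"
proof -
  have "0 < s" using assms by linarith
  have "(y - x0)\<^sup>2 \<le> 2 * (y - x)\<^sup>2 + 2 * (x - x0)\<^sup>2"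
    using zero_le_power2[of "(y - x) - (x - x0)"] by (simp add: power2_eq_square algebra_simps)
  moreover have "(x - x0)\<^sup>2 \<le> 1" using assms(4) by (simp add: abs_square_le_1)
  ultimately have 1: "(y - x0)\<^sup>2 / 2 - 1 \<le> (y - x)\<^sup>2" by simp
  have "(y - x0)\<^sup>2 / (8 * s0) - 1 / s0 \<le> ((y - x0)\<^sup>2 / 2 - 1) / (4 * s0)"
    using assms(1) by (simp add: field_simps)
  also have "\<dots> \<le> (y - x)\<^sup>2 / (4 * s0)"
    using 1 assms(1) by (intro divide_right_mono) auto
  also have "\<dots> \<le> (y - x)\<^sup>2 / (2 * s)"
    using assms \<open>0 < s\<close> by (intro divide_left_mono) auto
  finally have e: "exp (- ((y - x)\<^sup>2 / (2 * s))) \<le> exp (1 / s0) * exp (- ((y - x0)\<^sup>2 / (8 * s0)))"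
    by (simp add: exp_add[symmetric])
  have "sqrt (2 * pi * (2 * sqrt s0)\<^sup>2) = sqrt (8 * (pi * s0))"
    using assms by (simp add: power_mult_distrib)
  also have "\<dots> \<le> sqrt (9 * (2 * pi * s))"
    using assms by (intro real_sqrt_le_mono) (simp add: mult_left_mono)
  also have "\<dots> = 3 * sqrt (2 * pi * s)"
    using real_sqrt_unique[of 3 9] by (simp only: real_sqrt_mult[of 9]) simp
  finally have c: "1 / sqrt (2 * pi * s) \<le> 3 * (1 / sqrt (2 * pi * (2 * sqrt s0)\<^sup>2))"
    using assms \<open>0 < s\<close> by (simp add: divide_simps)
  have "1 / sqrt (2 * pi * s) * exp (- ((y - x)\<^sup>2 / (2 * s)))
      \<le> 3 * (1 / sqrt (2 * pi * (2 * sqrt s0)\<^sup>2)) * (exp (1 / s0) * exp (- ((y - x0)\<^sup>2 / (8 * s0))))"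
    by (rule mult_mono[OF c e]) auto
  then show ?thesis
    using assms \<open>0 < s\<close> by (simp add: normal_density_def power_mult_distrib mult_ac)
qed

lemma integrable_kernel_dominator:
  assumes "0 < \<sigma>"
  shows "integrable lborel (\<lambda>y. C * ((1 + (y - x)\<^sup>2) * normal_density x \<sigma> y))"
proof -
  have "integrable lborel (\<lambda>y. normal_density x \<sigma> y + normal_density x \<sigma> y * (y - x)^2)"
    using assms integrable_normal_moment[of \<sigma> x 2]
    by (intro Bochner_Integration.integrable_add integrable_normal_density) auto
  then have "integrable lborel (\<lambda>y. (1 + (y - x)\<^sup>2) * normal_density x \<sigma> y)"
    by (rule Bochner_Integration.integrable_cong[THEN iffD1, rotated -1]) (auto simp: algebra_simps)
  then show ?thesis by simp
qed

section \<open>Heat flow of a bounded function\<close>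

context
  fixes g :: "real \<Rightarrow> real"
  assumes g_measurable [measurable]: "g \<in> borel_measurable borel"
    and g_bound: "\<And>y. \<bar>g y\<bar> \<le> 1"
begin

lemma kernel_weight_bound:
  assumes "0 < s0" "s0 / 2 \<le> s" "s \<le> 2 * s0" "\<bar>x - x0\<bar> \<le> 1" "\<bar>p\<bar> \<le> C * (1 + (y - x0)\<^sup>2)"
  shows "\<bar>g y * (heat_kernel s x y * p)\<bar> \<le>
    C * (3 * exp (1 / s0)) * ((1 + (y - x0)\<^sup>2) * normal_density x0 (2 * sqrt s0) y)"
proof -
  have "\<bar>g y * (heat_kernel s x y * p)\<bar> = \<bar>g y\<bar> * (heat_kernel s x y * \<bar>p\<bar>)"
    by (simp add: abs_mult)
  also have "\<dots> \<le> 1 * (heat_kernel s x y * \<bar>p\<bar>)"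
    by (intro mult_right_mono g_bound) simp
  also have "\<dots> \<le> 1 * ((3 * exp (1 / s0) * normal_density x0 (2 * sqrt s0) y) * (C * (1 + (y - x0)\<^sup>2)))"
    by (intro mult_left_mono mult_mono heat_kernel_bound assms) auto
  finally show ?thesis by (simp add: mult_ac)
qed

lemma integrable_kernel_weight:
  assumes "0 < s" and [measurable]: "p \<in> borel_measurable borel"
    and p: "\<And>y. \<bar>p y\<bar> \<le> C * (1 + (y - x)\<^sup>2)"
  shows "integrable lborel (\<lambda>y. g y * (heat_kernel s x y * p y))"
proof (rule Bochner_Integration.integrable_bound)
  show "integrable lborel (\<lambda>y. C * (3 * exp (1 / s)) * ((1 + (y - x)\<^sup>2) * normal_density x (2 * sqrt s) y))"
    using assms by (intro integrable_kernel_dominator) simp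
  show "AE y in lborel. norm (g y * (heat_kernel s x y * p y))
      \<le> norm (C * (3 * exp (1 / s)) * ((1 + (y - x)\<^sup>2) * normal_density x (2 * sqrt s) y))"
  proof (rule AE_I2)
    fix y
    have "\<bar>g y * (heat_kernel s x y * p y)\<bar>
       \<le> C * (3 * exp (1 / s)) * ((1 + (y - x)\<^sup>2) * normal_density x (2 * sqrt s) y)"
      by (rule kernel_weight_bound) (use assms in auto)
    then show "norm (g y * (heat_kernel s x y * p y))
      \<le> norm (C * (3 * exp (1 / s)) * ((1 + (y - x)\<^sup>2) * normal_density x (2 * sqrt s) y))"
      unfolding real_norm_def by linarith
  qed
qed measurable

text \<open>Differentiating the kernel multiplies it by polynomials of degree at most two in y - x;
  recentred at x0, all of them fit under the single weight 1 + (y - x0)^2.\<close>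

lemma abs_weight_bounds:
  fixes s s0 x x0 y :: real
  assumes "0 < s0" "s0 / 2 \<le> s" "\<bar>x - x0\<bar> \<le> 1"
  shows "\<bar>(y - x) / s\<bar> \<le> (4 / s0) * (1 + (y - x0)\<^sup>2)"
    and "\<bar>(y - x)\<^sup>2 / s\<^sup>2 - 1 / s\<bar> \<le> (8 / s0\<^sup>2 + 2 / s0) * (1 + (y - x0)\<^sup>2)"
proof -
  have "0 < s" using assms by linarith
  have inv: "1 / s \<le> 2 / s0" using assms \<open>0 < s\<close> by (simp add: field_simps)
  have 1: "\<bar>y - x\<bar> \<le> 2 * (1 + (y - x0)\<^sup>2)"
  proof -
    have "a \<le> 2 * (1 + q)" if "a \<le> 1 + b" "2 * b \<le> 1 + q" "0 \<le> q" for a b q :: real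
      using that by (simp add: algebra_simps)
    moreover have "\<bar>y - x\<bar> \<le> 1 + \<bar>y - x0\<bar>" using assms(3) by linarith
    moreover have "2 * \<bar>y - x0\<bar> \<le> 1 + (y - x0)\<^sup>2"
      using zero_le_power2[of "\<bar>y - x0\<bar> - 1"] by (simp add: power2_eq_square algebra_simps)
    ultimately show ?thesis using zero_le_power2 by blast
  qed
  have "\<bar>(y - x) / s\<bar> = \<bar>y - x\<bar> * (1 / s)" using \<open>0 < s\<close> by simp
  also have "\<dots> \<le> (2 * (1 + (y - x0)\<^sup>2)) * (2 / s0)"
    using \<open>0 < s\<close> by (intro mult_mono 1 inv) auto
  finally show "\<bar>(y - x) / s\<bar> \<le> (4 / s0) * (1 + (y - x0)\<^sup>2)" by (simp add: mult_ac)
  have "(x - x0)\<^sup>2 \<le> 1" using assms(3) by (simp add: abs_square_le_1)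
  moreover have "(y - x)\<^sup>2 \<le> 2 * (y - x0)\<^sup>2 + 2 * (x - x0)\<^sup>2"
    using zero_le_power2[of "(y - x0) + (x - x0)"] by (simp add: power2_eq_square algebra_simps)
  ultimately have 2: "(y - x)\<^sup>2 \<le> 2 * (1 + (y - x0)\<^sup>2)" by simp
  have "\<bar>(y - x)\<^sup>2 / s\<^sup>2 - 1 / s\<bar> \<le> (y - x)\<^sup>2 * (1 / s)\<^sup>2 + 1 / s"
    using \<open>0 < s\<close> by (intro order_trans[OF abs_triangle_ineq4]) (simp add: power_divide)
  also have "\<dots> \<le> (2 * (1 + (y - x0)\<^sup>2)) * (2 / s0)\<^sup>2 + 2 / s0 * 1"
    using \<open>0 < s\<close> inv by (intro add_mono mult_mono 2 power_mono) auto
  also have "\<dots> \<le> (2 * (1 + (y - x0)\<^sup>2)) * (2 / s0)\<^sup>2 + 2 / s0 * (1 + (y - x0)\<^sup>2)"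
    using assms(1) by (intro add_left_mono mult_left_mono) auto
  also have "\<dots> = (8 / s0\<^sup>2 + 2 / s0) * (1 + (y - x0)\<^sup>2)"
    by (simp add: power_divide algebra_simps add_divide_distrib)
  finally show "\<bar>(y - x)\<^sup>2 / s\<^sup>2 - 1 / s\<bar> \<le> (8 / s0\<^sup>2 + 2 / s0) * (1 + (y - x0)\<^sup>2)" .
qed

lemma heat_deriv_x:
  assumes "0 < s"
  shows "(heat g s has_real_derivative (\<integral>y. g y * (heat_kernel s x y * ((y - x) / s)) \<partial>lborel)) (at x)"
proof -
  have "((\<lambda>x. \<integral>y. g y * heat_kernel s x y \<partial>lborel) has_real_derivative
      (\<integral>y. g y * (heat_kernel s x y * ((y - x) / s)) \<partial>lborel)) (at x)"
  proof (rule has_real_derivative_integral_dominated[OF zero_less_one])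
    show "integrable lborel (\<lambda>y. g y * heat_kernel s t y)" for t
      using integrable_kernel_weight[of s "\<lambda>_. 1" 1 t] assms by simp
    show "((\<lambda>t. g y * heat_kernel s t y) has_real_derivative g y * (heat_kernel s t y * ((y - t) / s))) (at t)" for t y
      by (intro DERIV_cmult heat_kernel_deriv_x assms)
    show "\<bar>g y * (heat_kernel s t y * ((y - t) / s))\<bar> \<le>
        (4 / s) * (3 * exp (1 / s)) * ((1 + (y - x)\<^sup>2) * normal_density x (2 * sqrt s) y)"
      if "\<bar>t - x\<bar> < 1" for t y
      by (rule kernel_weight_bound) (use assms that abs_weight_bounds(1)[of s s t x y] in auto)
    show "integrable lborel (\<lambda>y. (4 / s) * (3 * exp (1 / s)) * ((1 + (y - x)\<^sup>2) * normal_density x (2 * sqrt s) y))"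
      by (rule integrable_kernel_dominator) (use assms in simp)
  qed measurable
  then show ?thesis using assms by (subst (asm) heat_eq_integral_kernel[symmetric]) auto
qed

lemma heat_deriv_xx:
  assumes "0 < s"
  shows "((\<lambda>x. \<integral>y. g y * (heat_kernel s x y * ((y - x) / s)) \<partial>lborel) has_real_derivative
      (\<integral>y. g y * (heat_kernel s x y * ((y - x)\<^sup>2 / s\<^sup>2 - 1 / s)) \<partial>lborel)) (at x)"
proof (rule has_real_derivative_integral_dominated[OF zero_less_one])
  show "integrable lborel (\<lambda>y. g y * (heat_kernel s t y * ((y - t) / s)))" for t
    by (rule integrable_kernel_weight[where C="4 / s"])
      (use assms abs_weight_bounds(1)[of s s t t] in auto)
  show "((\<lambda>t. g y * (heat_kernel s t y * ((y - t) / s))) has_real_derivative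
     g y * (heat_kernel s t y * ((y - t)\<^sup>2 / s\<^sup>2 - 1 / s))) (at t)" for t y
    by (intro DERIV_cmult heat_kernel_deriv_xx assms)
  show "\<bar>g y * (heat_kernel s t y * ((y - t)\<^sup>2 / s\<^sup>2 - 1 / s))\<bar> \<le>
      (8 / s\<^sup>2 + 2 / s) * (3 * exp (1 / s)) * ((1 + (y - x)\<^sup>2) * normal_density x (2 * sqrt s) y)"
    if "\<bar>t - x\<bar> < 1" for t y
    by (rule kernel_weight_bound) (use assms that abs_weight_bounds(2)[of s s t x y] in auto)
  show "integrable lborel (\<lambda>y. (8 / s\<^sup>2 + 2 / s) * (3 * exp (1 / s)) * ((1 + (y - x)\<^sup>2) * normal_density x (2 * sqrt s) y))"
    by (rule integrable_kernel_dominator) (use assms in simp)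
qed measurable

lemma heat_deriv_s:
  assumes "0 < s"
  shows "((\<lambda>s. heat g s x) has_real_derivative
    (\<integral>y. g y * (heat_kernel s x y * ((y - x)\<^sup>2 / s\<^sup>2 - 1 / s)) \<partial>lborel) / 2) (at s)"
proof -
  have "((\<lambda>s. \<integral>y. g y * heat_kernel s x y \<partial>lborel) has_real_derivative
      (\<integral>y. g y * (heat_kernel s x y * (((y - x)\<^sup>2 / s\<^sup>2 - 1 / s) / 2)) \<partial>lborel)) (at s)"
  proof (rule has_real_derivative_integral_dominated)
    show "0 < s / 2" using assms by simp
    show "integrable lborel (\<lambda>y. g y * heat_kernel t x y)" if "\<bar>t - s\<bar> < s / 2" for t
    proof -
      have "0 < t" using that assms by linarith
      then show ?thesis using integrable_kernel_weight[of t "\<lambda>_. 1" 1 x] by simp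
    qed
    show "((\<lambda>t. g y * heat_kernel t x y) has_real_derivative
       g y * (heat_kernel t x y * (((y - x)\<^sup>2 / t\<^sup>2 - 1 / t) / 2))) (at t)" if "\<bar>t - s\<bar> < s / 2" for t y
    proof -
      have "0 < t" using that assms by linarith
      from DERIV_cmult[OF heat_kernel_deriv_s[OF this]] show ?thesis by simp
    qed
    show "\<bar>g y * (heat_kernel t x y * (((y - x)\<^sup>2 / t\<^sup>2 - 1 / t) / 2))\<bar> \<le>
        (8 / s\<^sup>2 + 2 / s) * (3 * exp (1 / s)) * ((1 + (y - x)\<^sup>2) * normal_density x (2 * sqrt s) y)"
      if "\<bar>t - s\<bar> < s / 2" for t y
    proof (rule kernel_weight_bound)
      have "s / 2 \<le> t" using that by linarith
      then show "\<bar>((y - x)\<^sup>2 / t\<^sup>2 - 1 / t) / 2\<bar> \<le> (8 / s\<^sup>2 + 2 / s) * (1 + (y - x)\<^sup>2)"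
        using abs_weight_bounds(2)[of s t x x y] assms by simp
      show "s / 2 \<le> t" "t \<le> 2 * s" using that by linarith+
    qed (use assms in auto)
    show "integrable lborel (\<lambda>y. (8 / s\<^sup>2 + 2 / s) * (3 * exp (1 / s)) * ((1 + (y - x)\<^sup>2) * normal_density x (2 * sqrt s) y))"
      by (rule integrable_kernel_dominator) (use assms in simp)
  qed measurable
  moreover have "\<forall>\<^sub>F t in nhds s. (\<integral>y. g y * heat_kernel t x y \<partial>lborel) = heat g t x"
    using eventually_nhds_in_open[of "{0<..}" s] assms
    by (auto simp: heat_eq_integral_kernel elim!: eventually_mono)
  ultimately show ?thesis
    by (subst (asm) DERIV_cong_ev[OF refl _ refl]) (auto simp flip: integral_divide_zero)
qed

text \<open>Dominated convergence in the probabilistic form includes s = 0, where the comparison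
  argument takes its initial data. The real \<open>sqrt\<close> is continuous at negative arguments
  too, which is why \<open>S\<close> can be arbitrary.\<close>

lemma continuous_on_heat:
  assumes "continuous_on UNIV g"
  shows "continuous_on S (\<lambda>(s, x). heat g s x)"
proof -
  have "isCont (\<lambda>p. heat g (fst p) (snd p)) p" for p
    unfolding continuous_at_sequentially comp_def
  proof (intro allI impI)
    fix X :: "nat \<Rightarrow> real \<times> real" assume X: "X \<longlonglongrightarrow> p"
    show "(\<lambda>n. heat g (fst (X n)) (snd (X n))) \<longlonglongrightarrow> heat g (fst p) (snd p)"
      unfolding heat_def
    proof (rule integral_dominated_convergence[where w="\<lambda>_. 1"])
      show "AE z in std_normal_distribution. (\<lambda>n. g (snd (X n) + sqrt (fst (X n)) * z)) \<longlonglongrightarrow> g (snd p + sqrt (fst p) * z)"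
      proof (rule AE_I2)
        fix z
        have "(\<lambda>n. snd (X n) + sqrt (fst (X n)) * z) \<longlonglongrightarrow> snd p + sqrt (fst p) * z"
          by (intro tendsto_intros X)
        then show "(\<lambda>n. g (snd (X n) + sqrt (fst (X n)) * z)) \<longlonglongrightarrow> g (snd p + sqrt (fst p) * z)"
          by (rule continuous_on_tendsto_compose[OF assms]) auto
      qed
    qed (use g_bound in auto)
  qed
  then show ?thesis
    by (simp add: continuous_at_imp_continuous_on case_prod_beta')
qed

end

section \<open>Ehrhard's inequality on the line\<close>

text \<open>With \<open>u\<close> a solution of the heat equation \<open>u\<^sub>s = u\<^sub>x\<^sub>x / 2\<close>, the function
  \<open>v = \<Phi>\<inverse> u\<close> solves \<open>v\<^sub>s = (v\<^sub>x\<^sub>x - v v\<^sub>x\<^sup>2) / 2\<close>.\<close>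

definition probit_heat_flow :: "real \<Rightarrow> (real \<Rightarrow> real \<Rightarrow> real) \<Rightarrow> bool" where
  "probit_heat_flow L v \<longleftrightarrow>
     continuous_on ({0..1} \<times> UNIV) (\<lambda>(s, x). v s x) \<and>
     (\<forall>s x y. \<bar>v s x - v s y\<bar> \<le> L * \<bar>x - y\<bar>) \<and>
     (\<forall>s>0. \<exists>v1 v2. \<forall>x.
        (v s has_real_derivative v1 x) (at x) \<and> (v1 has_real_derivative v2 x) (at x) \<and>
        ((\<lambda>s. v s x) has_real_derivative (v2 x - v s x * (v1 x)\<^sup>2) / 2) (at s))"

lemma probit_expectation_Phi_lipschitz:
  assumes "prob_space M" "X \<in> borel_measurable M" "Y \<in> borel_measurable M"
    and le: "\<And>\<omega>. \<omega> \<in> space M \<Longrightarrow> \<bar>X \<omega> - Y \<omega>\<bar> \<le> c"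
  shows "\<bar>probit (\<integral>\<omega>. \<Phi> (X \<omega>) \<partial>M) - probit (\<integral>\<omega>. \<Phi> (Y \<omega>) \<partial>M)\<bar> \<le> c"
proof -
  interpret prob_space M by fact
  obtain \<omega> where "\<omega> \<in> space M" using not_empty by auto
  then have "0 \<le> c" using le[of \<omega>] by linarith
  have "Y \<omega> \<le> X \<omega> + c" "X \<omega> \<le> Y \<omega> + c" if "\<omega> \<in> space M" for \<omega>
    using le[OF that] by linarith+
  with expectation_Phi_shift_le[of X Y c] expectation_Phi_shift_le[of Y X c] \<open>0 \<le> c\<close> assms(2,3)
  show ?thesis by (simp add: abs_le_iff)
qed

lemma lipschitz_abs_imp_continuous:
  fixes V :: "'a::real_normed_vector \<Rightarrow> real"
  assumes "\<And>x y. \<bar>V x - V y\<bar> \<le> L * norm (x - y)"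
  shows "continuous_on UNIV V"
proof -
  have "\<bar>V x - V y\<bar> \<le> \<bar>L\<bar> * norm (x - y)" for x y
    using assms[of x y] by (meson abs_ge_self mult_right_mono norm_ge_zero order_trans)
  then have "\<bar>L\<bar>-lipschitz_on UNIV V"
    by (intro lipschitz_onI) (auto simp: dist_norm)
  then show ?thesis by (rule lipschitz_on_continuous_on)
qed

lemma probit_heat_flow_heat:
  assumes lip: "\<And>x y. \<bar>V x - V y\<bar> \<le> L * \<bar>x - y\<bar>"
  shows "probit_heat_flow L (\<lambda>s x. probit (heat (\<lambda>y. \<Phi> (V y)) s x))"
proof -
  define g where "g = (\<lambda>y. \<Phi> (V y))"
  have Vc: "continuous_on UNIV V"
    by (rule lipschitz_abs_imp_continuous[of V L]) (use lip in simp)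
  then have [measurable]: "V \<in> borel_measurable borel"
    by (rule borel_measurable_continuous_onI)
  have gm [measurable]: "g \<in> borel_measurable borel" unfolding g_def by measurable
  have gb: "\<bar>g y\<bar> \<le> 1" for y by (simp add: g_def less_imp_le)
  have gc: "continuous_on UNIV g"
    unfolding g_def by (rule continuous_on_compose2[OF continuous_on_Phi[of UNIV] Vc]) auto
  have h: "0 < heat g s x" "heat g s x < 1" for s x
    unfolding heat_def g_def by (rule std_normal.expectation_Phi_bounds; measurable)+
  define v where "v = (\<lambda>s x. probit (heat g s x))"
  have "continuous_on ({0..1} \<times> UNIV) (\<lambda>p. probit ((\<lambda>(s, x). heat g s x) p))"
  proof (rule continuous_on_compose2[of "{0<..<1}" probit _ "\<lambda>(s, x). heat g s x"])
    show "continuous_on {0<..<1} probit"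
      by (intro continuous_at_imp_continuous_on ballI isCont_probit) auto
    show "continuous_on ({0..1} \<times> UNIV) (\<lambda>(s, x). heat g s x)"
      by (rule continuous_on_heat[OF gm gb gc])
  qed (auto simp: h)
  then have 1: "continuous_on ({0..1} \<times> UNIV) (\<lambda>(s, x). v s x)"
    by (simp add: v_def case_prod_beta')
  have 2: "\<bar>v s x - v s y\<bar> \<le> L * \<bar>x - y\<bar>" for s x y
    unfolding v_def heat_def g_def
  proof (rule probit_expectation_Phi_lipschitz)
    show "prob_space std_normal_distribution" by (rule std_normal.prob_space_axioms)
    show "\<bar>V (x + sqrt s * z) - V (y + sqrt s * z)\<bar> \<le> L * \<bar>x - y\<bar>" for z
      using lip[of "x + sqrt s * z" "y + sqrt s * z"] by simp
  qed measurable
  have 3: "\<exists>v1 v2. \<forall>x.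
        (v s has_real_derivative v1 x) (at x) \<and> (v1 has_real_derivative v2 x) (at x) \<and>
        ((\<lambda>s. v s x) has_real_derivative (v2 x - v s x * (v1 x)\<^sup>2) / 2) (at s)" if "0 < s" for s
  proof -
    define u1 where "u1 = (\<lambda>x. \<integral>y. g y * (heat_kernel s x y * ((y - x) / s)) \<partial>lborel)"
    define u2 where "u2 = (\<lambda>x. \<integral>y. g y * (heat_kernel s x y * ((y - x)\<^sup>2 / s\<^sup>2 - 1 / s)) \<partial>lborel)"
    have u1: "(heat g s has_real_derivative u1 x) (at x)" for x
      unfolding u1_def by (rule heat_deriv_x[OF gm gb that])
    have u2: "(u1 has_real_derivative u2 x) (at x)" for x
      unfolding u1_def u2_def by (rule heat_deriv_xx[OF gm gb that])
    have us: "((\<lambda>s. heat g s x) has_real_derivative u2 x / 2) (at s)" for x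
      unfolding u2_def by (rule heat_deriv_s[OF gm gb that])
    define v1 where "v1 = (\<lambda>x. u1 x / \<phi> (v s x))"
    \<comment> \<open>Differentiating \<Phi> v = u twice in x gives \<phi> v * (v_xx - v * v_x^2) =
      u_xx, and \<open>v2\<close> is this solved for v_xx. Together with u_s = u_xx / 2 it yields
      the equation for v_s.\<close>
    define v2 where "v2 = (\<lambda>x. u2 x / \<phi> (v s x) + v s x * (v1 x)\<^sup>2)"
    have nz: "\<phi> y \<noteq> 0" for y using phi_pos[of y] by simp
    have d1: "(v s has_real_derivative v1 x) (at x)" for x
      using DERIV_chain2[OF probit_deriv[OF h] u1[of x]]
      by (simp add: v_def v1_def)
    have dphi: "((\<lambda>x. \<phi> (v s x)) has_real_derivative - v s x * \<phi> (v s x) * v1 x) (at x)" for x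
      by (rule DERIV_chain2[OF phi_deriv d1])
    have "((\<lambda>x. u1 x / \<phi> (v s x)) has_real_derivative v2 x) (at x)" for x
      by (rule DERIV_cong[OF DERIV_divide[OF u2 dphi nz]])
        (use nz[of "v s x"] in \<open>simp add: v2_def v1_def field_simps power2_eq_square\<close>)
    then have d2: "(v1 has_real_derivative v2 x) (at x)" for x
      by (simp add: v1_def)
    have "((\<lambda>s. v s x) has_real_derivative (v2 x - v s x * (v1 x)\<^sup>2) / 2) (at s)" for x
      using DERIV_chain2[OF probit_deriv[OF h] us[of x]]
      by (simp add: v_def v2_def)
    with d1 d2 show ?thesis by blast
  qed
  show ?thesis
    using 1 2 3 unfolding probit_heat_flow_def v_def g_def by blast
qed

section \<open>Parabolic maximum principle\<close>

lemma DERIV_lipschitz_bound: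
  assumes "\<And>x y. \<bar>f x - f y\<bar> \<le> L * \<bar>x - y\<bar>" and "(f has_real_derivative d) (at x)"
  shows "\<bar>d\<bar> \<le> L"
proof -
  have "((\<lambda>h. \<bar>(f (x + h) - f x) / h\<bar>) \<longlongrightarrow> \<bar>d\<bar>) (at 0)"
    using assms(2) unfolding DERIV_def by (rule tendsto_rabs)
  then show ?thesis
  proof (rule tendsto_upperbound)
    show "\<forall>\<^sub>F h in at 0. \<bar>(f (x + h) - f x) / h\<bar> \<le> L"
      using eventually_at_ball'[OF zero_less_one, of 0 UNIV]
      by eventually_elim (use assms(1)[of "x + _" x] in \<open>auto simp: field_simps\<close>)
  qed simp
qed

lemma second_derivative_nonneg_at_min:
  fixes h h' :: "real \<Rightarrow> real"
  assumes h: "\<And>r. (h has_real_derivative h' r) (at r)" and h': "(h' has_real_derivative d) (at 0)"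
    and min: "\<And>r. h 0 \<le> h r"
  shows "h' 0 = 0" "0 \<le> d"
proof -
  show z: "h' 0 = 0"
    by (rule DERIV_local_min[OF h zero_less_one]) (use min in auto)
  show "0 \<le> d"
  proof (rule ccontr)
    assume "\<not> 0 \<le> d"
    then obtain \<delta> where \<delta>: "0 < \<delta>" "\<And>r. 0 < r \<Longrightarrow> r < \<delta> \<Longrightarrow> h' (0 + r) < h' 0"
      using DERIV_neg_dec_right[OF h'] by auto
    have "h (\<delta> / 2) < h 0"
    proof (rule DERIV_neg_imp_decreasing_open[where f=h and a=0 and b="\<delta> / 2"])
      show "0 < \<delta> / 2" using \<delta> by simp
      show "\<exists>y. (h has_real_derivative y) (at x) \<and> y < 0" if "0 < x" "x < \<delta> / 2" for x
        using h[of x] \<delta>(2)[of x] that z by auto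
      show "continuous_on {0..\<delta> / 2} h"
        using h DERIV_isCont continuous_at_imp_continuous_on by blast
    qed
    with min[of "\<delta> / 2"] show False by simp
  qed
qed

text \<open>The algebra at a touching point: \<open>a\<close>, \<open>a1\<close>, \<open>a2\<close>
  are a flow and its space derivatives, and \<open>W\<close> is the barrier factor. If the three
  slopes agreed, \<open>zero\<close> would reduce the nonlinear terms to one of favourable sign. By
  \<open>first\<close> the weighted slopes differ only by 2 W x and 2 W y, so the error is W times a
  quantity of quadratic growth, as \<open>a\<close> and \<open>b\<close> grow linearly. In
  \<open>K\<close>, the term 4 L (C + L) pays for this error, 2 out of 3 pays for the 4 W in
  \<open>second\<close>, and the remaining 1 makes the contradiction strict.\<close>

lemma barrier_contradiction:
  fixes a b c a1 b1 c1 a2 b2 c2 x y L C K W \<alpha> \<beta> :: real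
  assumes "0 < W" "0 \<le> L" "0 \<le> C" and K: "K = 3 + 4 * L * (C + L)"
    and bounds: "\<bar>a\<bar> \<le> C + L * \<bar>x\<bar>" "\<bar>b\<bar> \<le> C + L * \<bar>y\<bar>" "\<bar>a1\<bar> \<le> L" "\<bar>b1\<bar> \<le> L" "\<bar>c1\<bar> \<le> L"
    and zero: "c - \<alpha> * a - \<beta> * b + W * (1 + x\<^sup>2 + y\<^sup>2) = 0"
    and first: "\<alpha> * c1 - \<alpha> * a1 + 2 * W * x = 0" "\<beta> * c1 - \<beta> * b1 + 2 * W * y = 0"
    and second: "0 \<le> c2 - \<alpha> * a2 - \<beta> * b2 + 4 * W"
    and time: "(c2 - c * c1\<^sup>2) / 2 - \<alpha> * ((a2 - a * a1\<^sup>2) / 2) - \<beta> * ((b2 - b * b1\<^sup>2) / 2)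
      + K * W * (1 + x\<^sup>2 + y\<^sup>2) \<le> 0"
  shows False
proof -
  define N where "N = 1 + x\<^sup>2 + y\<^sup>2"
  have N: "1 \<le> N" by (simp add: N_def)
  have growth: "\<bar>t\<bar> * (C + L * \<bar>t\<bar>) \<le> (C + L) * (1 + t\<^sup>2)" for t
  proof -
    have "0 \<le> (\<bar>t\<bar> - 1)\<^sup>2" by simp
    then have "2 * \<bar>t\<bar> \<le> 1 + t\<^sup>2" by (simp add: power2_eq_square algebra_simps)
    then have "\<bar>t\<bar> \<le> 1 + t\<^sup>2" by (smt (verit) zero_le_power2)
    then have "C * \<bar>t\<bar> \<le> C * (1 + t\<^sup>2)" using \<open>0 \<le> C\<close> by (rule mult_left_mono)
    moreover have "L * t\<^sup>2 \<le> L * (1 + t\<^sup>2)" using \<open>0 \<le> L\<close> by (intro mult_left_mono) auto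
    ultimately have "C * \<bar>t\<bar> + L * t\<^sup>2 \<le> C * (1 + t\<^sup>2) + L * (1 + t\<^sup>2)" by linarith
    moreover have "\<bar>t\<bar> * (C + L * \<bar>t\<bar>) = C * \<bar>t\<bar> + L * t\<^sup>2"
      by (simp add: algebra_simps power2_eq_square)
    moreover have "C * (1 + t\<^sup>2) + L * (1 + t\<^sup>2) = (C + L) * (1 + t\<^sup>2)"
      by (simp add: algebra_simps)
    ultimately show ?thesis by linarith
  qed
  have cross: "\<bar>t * u * (d + c1)\<bar> \<le> 2 * L * ((C + L) * (1 + t\<^sup>2))"
    if "\<bar>u\<bar> \<le> C + L * \<bar>t\<bar>" "\<bar>d\<bar> \<le> L" for t u d
  proof -
    have "\<bar>t * u * (d + c1)\<bar> = (\<bar>t\<bar> * \<bar>u\<bar>) * \<bar>d + c1\<bar>" by (simp add: abs_mult)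
    also have "\<dots> \<le> ((C + L) * (1 + t\<^sup>2)) * (2 * L)"
    proof (rule mult_mono)
      have "\<bar>t\<bar> * \<bar>u\<bar> \<le> \<bar>t\<bar> * (C + L * \<bar>t\<bar>)" using that by (intro mult_left_mono) auto
      then show "\<bar>t\<bar> * \<bar>u\<bar> \<le> (C + L) * (1 + t\<^sup>2)" using growth[of t] by linarith
      show "\<bar>d + c1\<bar> \<le> 2 * L" using that bounds(5) by linarith
    qed (use \<open>0 \<le> L\<close> \<open>0 \<le> C\<close> in auto)
    finally show ?thesis by (simp add: mult_ac)
  qed
  have x: "- (x * a * (a1 + c1)) \<le> 2 * L * ((C + L) * (1 + x\<^sup>2))"
    using cross[OF bounds(1,3)] by linarith
  have y: "- (y * b * (b1 + c1)) \<le> 2 * L * ((C + L) * (1 + y\<^sup>2))"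
    using cross[OF bounds(2,4)] by linarith
  have "2 * L * ((C + L) * (1 + x\<^sup>2)) + 2 * L * ((C + L) * (1 + y\<^sup>2)) = 2 * L * (C + L) * (N + 1)"
    by (simp add: N_def algebra_simps)
  also have "\<dots> \<le> 2 * L * (C + L) * (2 * N)"
    using N \<open>0 \<le> L\<close> \<open>0 \<le> C\<close> by (intro mult_left_mono) auto
  finally have xy: "- (x * a * (a1 + c1)) - y * b * (b1 + c1) \<le> 4 * L * (C + L) * N"
    using x y by (simp add: mult_ac)
  have c: "c = \<alpha> * a + \<beta> * b - W * N" using zero by (simp add: N_def)
  have la: "\<alpha> * a1 = \<alpha> * c1 + 2 * W * x" and mb: "\<beta> * b1 = \<beta> * c1 + 2 * W * y"
    using first by linarith+
  have "\<alpha> * a * a1\<^sup>2 - \<alpha> * a * c1\<^sup>2 = a * (\<alpha> * a1 - \<alpha> * c1) * (a1 + c1)"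
    by (simp add: algebra_simps power2_eq_square)
  also have "\<dots> = 2 * W * (x * a * (a1 + c1))" by (simp add: la)
  finally have 1: "\<alpha> * a * a1\<^sup>2 - \<alpha> * a * c1\<^sup>2 = 2 * W * (x * a * (a1 + c1))" .
  have "\<beta> * b * b1\<^sup>2 - \<beta> * b * c1\<^sup>2 = b * (\<beta> * b1 - \<beta> * c1) * (b1 + c1)"
    by (simp add: algebra_simps power2_eq_square)
  also have "\<dots> = 2 * W * (y * b * (b1 + c1))" by (simp add: mb)
  finally have 2: "\<beta> * b * b1\<^sup>2 - \<beta> * b * c1\<^sup>2 = 2 * W * (y * b * (b1 + c1))" .
  have "c * c1\<^sup>2 = \<alpha> * a * c1\<^sup>2 + \<beta> * b * c1\<^sup>2 - W * N * c1\<^sup>2"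
    by (simp add: c algebra_simps)
  with 1 2 have "c * c1\<^sup>2 - \<alpha> * a * a1\<^sup>2 - \<beta> * b * b1\<^sup>2
      = 2 * W * (- (x * a * (a1 + c1)) - y * b * (b1 + c1)) - W * N * c1\<^sup>2"
    by (simp add: algebra_simps)
  also have "\<dots> \<le> 2 * W * (4 * L * (C + L) * N) - 0"
    using xy \<open>0 < W\<close> N by (intro diff_mono mult_left_mono) auto
  finally have 3: "c * c1\<^sup>2 - \<alpha> * a * a1\<^sup>2 - \<beta> * b * b1\<^sup>2 \<le> 8 * W * L * (C + L) * N"
    by (simp add: mult_ac)
  have "(c2 - \<alpha> * a2 - \<beta> * b2) - (c * c1\<^sup>2 - \<alpha> * a * a1\<^sup>2 - \<beta> * b * b1\<^sup>2) + 2 * (K * W * N) \<le> 0"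
  proof -
    have eq: "(c2 - \<alpha> * a2 - \<beta> * b2) - (c * c1\<^sup>2 - \<alpha> * a * a1\<^sup>2 - \<beta> * b * b1\<^sup>2) + 2 * (K * W * N)
      = 2 * ((c2 - c * c1\<^sup>2) / 2 - \<alpha> * ((a2 - a * a1\<^sup>2) / 2) - \<beta> * ((b2 - b * b1\<^sup>2) / 2)
        + K * W * (1 + x\<^sup>2 + y\<^sup>2))"
      by (simp add: N_def field_simps)
    show ?thesis unfolding eq by (rule mult_nonneg_nonpos[OF _ time]) simp
  qed
  then have "2 * (K * W * N) \<le> 8 * W * L * (C + L) * N + 4 * W"
    using 3 second by linarith
  also have "\<dots> \<le> 8 * W * L * (C + L) * N + 4 * W * N"
    using N \<open>0 < W\<close> by simp
  also have "2 * (K * W * N) = 8 * W * L * (C + L) * N + 4 * W * N + 2 * (W * N)"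
    by (simp add: K algebra_simps)
  finally have "W * N \<le> 0" by (simp add: mult.commute)
  moreover have "0 < W * N" using N \<open>0 < W\<close> by simp
  ultimately show False by linarith
qed

text \<open>Continuity bounds the flow on the compact segment x = 0, and the Lipschitz bound extends
  this to all x. Linear growth uniform in time is what the quadratic barrier has to beat.\<close>

lemma probit_heat_flow_growth:
  assumes "probit_heat_flow L v"
  shows "\<exists>C\<ge>0. \<forall>s\<in>{0..1}. \<forall>x. \<bar>v s x\<bar> \<le> C + L * \<bar>x\<bar>"
proof -
  have vc: "continuous_on ({0..1} \<times> UNIV) (\<lambda>(s, x). v s x)"
    using assms unfolding probit_heat_flow_def by blast
  have "continuous_on {0..1} (\<lambda>s::real. (s, 0::real))"
    by (intro continuous_intros)
  from continuous_on_compose2[OF vc this] have "continuous_on {0..1} (\<lambda>s. v s 0)"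
    by (simp add: image_subset_iff)
  then have "compact ((\<lambda>s. v s 0) ` {0..1})"
    by (intro compact_continuous_image) auto
  then obtain C where C: "\<And>s. s \<in> {0..1} \<Longrightarrow> \<bar>v s 0\<bar> \<le> C"
    using compact_imp_bounded by (fastforce simp: bounded_iff)
  have "\<bar>v s x\<bar> \<le> C + L * \<bar>x\<bar>" if "s \<in> {0..1}" for s x
  proof -
    have "\<bar>v s x - v s 0\<bar> \<le> L * \<bar>x\<bar>"
      using assms unfolding probit_heat_flow_def by (metis diff_zero)
    then show ?thesis using C[OF that] by linarith
  qed
  moreover have "0 \<le> C" using C[of 0] by auto
  ultimately show ?thesis by blast
qed

text \<open>Maximum principle. At a point where the barrier-perturbed defect first vanishes, the first-order
  conditions equate the three slopes up to the barrier, so that the equation forces the defect to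
  increase in time there.\<close>

lemma probit_heat_flow_comparison:
  fixes a b c :: "real \<Rightarrow> real \<Rightarrow> real"
  assumes a: "probit_heat_flow L a" and b: "probit_heat_flow L b" and c: "probit_heat_flow L c"
    and pos: "0 < \<alpha>" "0 < \<beta>" "\<alpha> + \<beta> = 1"
    and init: "\<And>x y. \<alpha> * a 0 x + \<beta> * b 0 y \<le> c 0 (\<alpha> * x + \<beta> * y)"
  shows "\<alpha> * a 1 x + \<beta> * b 1 y \<le> c 1 (\<alpha> * x + \<beta> * y)"
proof -
  have La: "\<bar>a s x - a s y\<bar> \<le> L * \<bar>x - y\<bar>" and Lb: "\<bar>b s x - b s y\<bar> \<le> L * \<bar>x - y\<bar>"
    and Lc: "\<bar>c s x - c s y\<bar> \<le> L * \<bar>x - y\<bar>" for s x y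
    using a b c unfolding probit_heat_flow_def by blast+
  have "0 \<le> L" using La[of 0 1 0] by simp
  obtain Ca where Ca: "0 \<le> Ca" "\<And>s x. s \<in> {0..1} \<Longrightarrow> \<bar>a s x\<bar> \<le> Ca + L * \<bar>x\<bar>"
    using probit_heat_flow_growth[OF a] by blast
  obtain Cb where Cb: "0 \<le> Cb" "\<And>s x. s \<in> {0..1} \<Longrightarrow> \<bar>b s x\<bar> \<le> Cb + L * \<bar>x\<bar>"
    using probit_heat_flow_growth[OF b] by blast
  obtain Cc where Cc: "0 \<le> Cc" "\<And>s x. s \<in> {0..1} \<Longrightarrow> \<bar>c s x\<bar> \<le> Cc + L * \<bar>x\<bar>"
    using probit_heat_flow_growth[OF c] by blast
  define C where "C = Ca + Cb + Cc"
  have C: "0 \<le> C" using Ca Cb Cc by (simp add: C_def)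
  have Ba: "\<bar>a s x\<bar> \<le> C + L * \<bar>x\<bar>" and Bb: "\<bar>b s x\<bar> \<le> C + L * \<bar>x\<bar>" and Bc: "\<bar>c s x\<bar> \<le> C + L * \<bar>x\<bar>"
    if "s \<in> {0..1}" for s x
    using Ca(2)[OF that, of x] Cb(2)[OF that, of x] Cc(2)[OF that, of x] Ca(1) Cb(1) Cc(1)
    by (auto simp: C_def)
  define K where "K = 3 + 4 * L * (C + L)"
  have "0 \<le> K" using \<open>0 \<le> L\<close> C by (simp add: K_def)
  \<comment> \<open>The defect plus a barrier: its quadratic factor confines nonpositive values to a
    bounded set, and its exponential factor produces the favourable term with \<open>K\<close> in
    the time derivative.\<close>
  define G where "G = (\<lambda>\<epsilon> s x y. c s (\<alpha> * x + \<beta> * y) - \<alpha> * a s x - \<beta> * b s y + \<epsilon> * exp (K * s) * (1 + x\<^sup>2 + y\<^sup>2))"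
  have main: "0 < G \<epsilon> s x y" if "0 < \<epsilon>" "s \<in> {0..1}" for \<epsilon> s x y
  proof (rule ccontr)
    assume neg: "\<not> 0 < G \<epsilon> s x y"
    \<comment> \<open>With r = |x| + |y|, a nonpositive value of \<open>G\<close> forces \<epsilon>
      r^2 \<le> 6 C + 4 L r, hence r \<le> (6 C + 4 L) / \<epsilon> as soon as r > 1.\<close>
    define R where "R = 1 + (6 * C + 4 * L) / \<epsilon>"
    define box where "box = {0..1::real} \<times> ({-R..R} \<times> {-R..R::real})"
    have in_box: "(s, x, y) \<in> box" if s: "s \<in> {0..1}" and G: "G \<epsilon> s x y \<le> 0" for s x y
    proof -
      let ?r = "\<bar>x\<bar> + \<bar>y\<bar>"
      have "\<epsilon> * (x\<^sup>2 + y\<^sup>2) \<le> \<epsilon> * exp (K * s) * (1 + x\<^sup>2 + y\<^sup>2)"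
        using \<open>0 < \<epsilon>\<close> \<open>0 \<le> K\<close> s by (intro mult_mono) auto
      also have "\<dots> \<le> \<alpha> * a s x + \<beta> * b s y - c s (\<alpha> * x + \<beta> * y)"
        using G by (simp add: G_def)
      also have "\<dots> \<le> 1 * (C + L * \<bar>x\<bar>) + 1 * (C + L * \<bar>y\<bar>) + (C + L * ?r)"
      proof -
        have "\<alpha> * a s x \<le> 1 * (C + L * \<bar>x\<bar>)"
          using Ba[OF s, of x] pos C \<open>0 \<le> L\<close> by (intro order_trans[OF mult_left_mono mult_right_mono]) auto
        moreover have "\<beta> * b s y \<le> 1 * (C + L * \<bar>y\<bar>)"
          using Bb[OF s, of y] pos C \<open>0 \<le> L\<close> by (intro order_trans[OF mult_left_mono mult_right_mono]) auto
        moreover have "L * \<bar>\<alpha> * x + \<beta> * y\<bar> \<le> L * ?r"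
        proof (rule mult_left_mono[OF _ \<open>0 \<le> L\<close>])
          have "\<bar>\<alpha> * x\<bar> \<le> 1 * \<bar>x\<bar>" "\<bar>\<beta> * y\<bar> \<le> 1 * \<bar>y\<bar>"
            unfolding abs_mult using pos by (intro mult_right_mono; simp)+
          then show "\<bar>\<alpha> * x + \<beta> * y\<bar> \<le> ?r" by linarith
        qed
        ultimately show ?thesis using Bc[OF s, of "\<alpha> * x + \<beta> * y"] by linarith
      qed
      finally have 1: "\<epsilon> * (x\<^sup>2 + y\<^sup>2) \<le> 3 * C + 2 * L * ?r" by (simp add: algebra_simps)
      have "?r\<^sup>2 \<le> 2 * (x\<^sup>2 + y\<^sup>2)"
        using zero_le_power2[of "\<bar>x\<bar> - \<bar>y\<bar>"] by (simp add: power2_eq_square algebra_simps)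
      then have "\<epsilon> * ?r\<^sup>2 \<le> 2 * (3 * C + 2 * L * ?r)"
      proof -
        have "\<epsilon> * ?r\<^sup>2 \<le> \<epsilon> * (2 * (x\<^sup>2 + y\<^sup>2))"
          using \<open>?r\<^sup>2 \<le> 2 * (x\<^sup>2 + y\<^sup>2)\<close> \<open>0 < \<epsilon>\<close> by (intro mult_left_mono) auto
        also have "\<dots> = 2 * (\<epsilon> * (x\<^sup>2 + y\<^sup>2))" by simp
        also have "\<dots> \<le> 2 * (3 * C + 2 * L * ?r)" using 1 by (intro mult_left_mono) auto
        finally show ?thesis .
      qed
      then have 2: "?r * ?r \<le> (6 * C + 4 * L * ?r) / \<epsilon>"
        using \<open>0 < \<epsilon>\<close> by (simp add: field_simps power2_eq_square)
      have "?r \<le> R"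
      proof (cases "?r \<le> 1")
        case True
        moreover have "1 \<le> R" using \<open>0 < \<epsilon>\<close> C \<open>0 \<le> L\<close> by (simp add: R_def)
        ultimately show ?thesis by linarith
      next
        case False
        then have r: "1 < ?r" by simp
        have "6 * C * 1 + 4 * L * ?r \<le> 6 * C * ?r + 4 * L * ?r"
          using r C \<open>0 \<le> L\<close> by (intro add_mono mult_left_mono) auto
        then have "(6 * C + 4 * L * ?r) / \<epsilon> \<le> ((6 * C + 4 * L) / \<epsilon>) * ?r"
          using divide_right_mono[of _ _ \<epsilon>] \<open>0 < \<epsilon>\<close> by (simp add: distrib_right)
        with 2 have "?r * ?r \<le> ((6 * C + 4 * L) / \<epsilon>) * ?r" by linarith
        then have "?r \<le> (6 * C + 4 * L) / \<epsilon>" using r by (simp only: mult_le_cancel_right)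
        then show ?thesis by (simp add: R_def)
      qed
      then have "x \<in> {-R..R}" "y \<in> {-R..R}" by auto
      then show ?thesis using s by (simp add: box_def)
    qed
    have v_cont: "continuous_on box (\<lambda>p. v (fst p) (k p))"
      if "probit_heat_flow L v" "continuous_on box k" for v and k :: "real \<times> real \<times> real \<Rightarrow> real"
    proof -
      have vc: "continuous_on ({0..1} \<times> UNIV) (\<lambda>(s, x). v s x)"
        using that(1) unfolding probit_heat_flow_def by blast
      have "continuous_on box (\<lambda>p. (fst p, k p))"
        using that(2) by (intro continuous_intros)
      from continuous_on_compose2[OF vc this] show ?thesis
        by (simp add: box_def image_subset_iff)
    qed
    have G_cont: "continuous_on box (\<lambda>p. G \<epsilon> (fst p) (fst (snd p)) (snd (snd p)))"
      unfolding G_def by (intro continuous_intros v_cont[OF a] v_cont[OF b] v_cont[OF c])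
    define S where "S = box \<inter> (\<lambda>p. G \<epsilon> (fst p) (fst (snd p)) (snd (snd p))) -` {..0}"
    have "compact box" unfolding box_def by (intro compact_Times) auto
    then have "closed S"
      unfolding S_def by (intro continuous_closed_preimage[OF G_cont]) (auto intro: compact_imp_closed)
    then have "compact S"
      using \<open>compact box\<close> unfolding S_def by (metis Int_absorb1 Int_lower1 compact_Int_closed)
    moreover have "S \<noteq> {}"
      using in_box[of s x y] neg that by (auto simp: S_def not_less)
    \<comment> \<open>Compactness provides an earliest time at which the perturbed defect is
      nonpositive somewhere.\<close>
    ultimately obtain p where p: "p \<in> S" "\<And>q. q \<in> S \<Longrightarrow> fst p \<le> fst q"
      using continuous_attains_inf[of S fst] continuous_on_fst[OF continuous_on_id] by blast
    obtain s0 x0 y0 where p_eq: "p = (s0, x0, y0)" by (cases p) auto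
    have s0: "s0 \<in> {0..1}" and G0: "G \<epsilon> s0 x0 y0 \<le> 0"
      using p(1) by (auto simp: S_def box_def p_eq)
    have before: "0 < G \<epsilon> s x y" if "0 \<le> s" "s < s0" for s x y
    proof (rule ccontr)
      assume "\<not> 0 < G \<epsilon> s x y"
      moreover have "s \<in> {0..1}" using that s0 by simp
      ultimately have "(s, x, y) \<in> S" using in_box[of s x y] by (auto simp: S_def)
      from p(2)[OF this] that show False by (simp add: p_eq)
    qed
    have "0 < G \<epsilon> 0 x0 y0"
      using init[of x0 y0] \<open>0 < \<epsilon>\<close> by (simp add: G_def add_nonneg_pos add_pos_nonneg)
    with G0 have "s0 \<noteq> 0" by auto
    with s0 have "0 < s0" by simp
    obtain a1 a2 where A: "(a s0 has_real_derivative a1 x) (at x)" "(a1 has_real_derivative a2 x) (at x)"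
      "((\<lambda>s. a s x) has_real_derivative (a2 x - a s0 x * (a1 x)\<^sup>2) / 2) (at s0)" for x
      using a \<open>0 < s0\<close> unfolding probit_heat_flow_def by blast
    obtain b1 b2 where B: "(b s0 has_real_derivative b1 x) (at x)" "(b1 has_real_derivative b2 x) (at x)"
      "((\<lambda>s. b s x) has_real_derivative (b2 x - b s0 x * (b1 x)\<^sup>2) / 2) (at s0)" for x
      using b \<open>0 < s0\<close> unfolding probit_heat_flow_def by blast
    obtain c1 c2 where D: "(c s0 has_real_derivative c1 x) (at x)" "(c1 has_real_derivative c2 x) (at x)"
      "((\<lambda>s. c s x) has_real_derivative (c2 x - c s0 x * (c1 x)\<^sup>2) / 2) (at s0)" for x
      using c \<open>0 < s0\<close> unfolding probit_heat_flow_def by blast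
    let ?z = "\<alpha> * x0 + \<beta> * y0"
    let ?W = "\<epsilon> * exp (K * s0)"
    let ?dt = "\<lambda>x y. (c2 (\<alpha> * x + \<beta> * y) - c s0 (\<alpha> * x + \<beta> * y) * (c1 (\<alpha> * x + \<beta> * y))\<^sup>2) / 2
      - \<alpha> * ((a2 x - a s0 x * (a1 x)\<^sup>2) / 2) - \<beta> * ((b2 y - b s0 y * (b1 y)\<^sup>2) / 2)
      + K * ?W * (1 + x\<^sup>2 + y\<^sup>2)"
    have Gt: "((\<lambda>s. G \<epsilon> s x y) has_real_derivative ?dt x y) (at s0)" for x y
      unfolding G_def
      by (rule derivative_eq_intros A(3) B(3) D(3) refl)+ (simp add: algebra_simps)
    \<comment> \<open>Passing to the limit from earlier times shows that (x0, y0) is a global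
      minimum of \<open>G\<close> at time \<open>s0\<close>, which gives access to the first- and
      second-order conditions.\<close>
    have nonneg: "0 \<le> G \<epsilon> s0 x y" for x y
    proof (rule tendsto_lowerbound)
      show "((\<lambda>s. G \<epsilon> s x y) \<longlongrightarrow> G \<epsilon> s0 x y) (at_left s0)"
        using DERIV_isCont[OF Gt] by (simp add: isCont_def filterlim_at_split)
      show "\<forall>\<^sub>F s in at_left s0. 0 \<le> G \<epsilon> s x y"
        using eventually_at_left_real[OF \<open>0 < s0\<close>]
        by eventually_elim (use before in \<open>auto intro: less_imp_le\<close>)
    qed simp
    have G_zero: "G \<epsilon> s0 x0 y0 = 0" using nonneg[of x0 y0] G0 by simp
    have time: "?dt x0 y0 \<le> 0"
    proof (rule ccontr)
      assume "\<not> ?dt x0 y0 \<le> 0"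
      then have "0 < ?dt x0 y0" by simp
      from DERIV_pos_inc_left[OF Gt this]
      obtain d where d: "0 < d" "\<And>h. 0 < h \<Longrightarrow> h < d \<Longrightarrow> G \<epsilon> (s0 - h) x0 y0 < G \<epsilon> s0 x0 y0" by auto
      define h where "h = min (d / 2) s0"
      have "0 < h" "h < d" "h \<le> s0" using d(1) \<open>0 < s0\<close> by (auto simp: h_def min_def)
      then show False using d(2)[of h] before[of "s0 - h" x0 y0] G_zero by simp
    qed
    have c_chain: "((\<lambda>r. c s0 (k r)) has_real_derivative c1 (k r) * k') (at r)"
      if "(k has_real_derivative k') (at r)" for k k' r
      by (rule DERIV_chain2[OF D(1) that])
    have first_x: "\<alpha> * c1 ?z - \<alpha> * a1 x0 + 2 * ?W * x0 = 0"
    proof (rule DERIV_local_min[OF _ zero_less_one])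
      show "((\<lambda>x. G \<epsilon> s0 x y0) has_real_derivative \<alpha> * c1 ?z - \<alpha> * a1 x0 + 2 * ?W * x0) (at x0)"
        unfolding G_def
        by (rule derivative_eq_intros c_chain A(1) refl)+ (simp add: algebra_simps)
    qed (use nonneg G_zero in auto)
    have first_y: "\<beta> * c1 ?z - \<beta> * b1 y0 + 2 * ?W * y0 = 0"
    proof (rule DERIV_local_min[OF _ zero_less_one])
      show "((\<lambda>y. G \<epsilon> s0 x0 y) has_real_derivative \<beta> * c1 ?z - \<beta> * b1 y0 + 2 * ?W * y0) (at y0)"
        unfolding G_def
        by (rule derivative_eq_intros c_chain B(1) refl)+ (simp add: algebra_simps)
    qed (use nonneg G_zero in auto)
    have diag: "\<alpha> * (x0 + r) + \<beta> * (y0 + r) = ?z + r" for r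
    proof -
      have "\<alpha> * (x0 + r) + \<beta> * (y0 + r) = ?z + (\<alpha> + \<beta>) * r" by (simp add: algebra_simps)
      then show ?thesis using pos by simp
    qed
    have shift: "((\<lambda>r. k (u + r)) has_real_derivative k') (at r)"
      if "(k has_real_derivative k') (at (u + r))" for k k' u r
      using that by (simp add: DERIV_shift add.commute)
    \<comment> \<open>The direction is (1, 1): since \<alpha> + \<beta> = 1, the argument of
      \<open>c\<close> moves at unit speed as well, so the second derivatives appear with exactly
      the weights they have in the equation. Each square in the barrier contributes twice its
      factor.\<close>
    have second: "0 \<le> c2 ?z - \<alpha> * a2 x0 - \<beta> * b2 y0 + 4 * ?W"
    proof (rule second_derivative_nonneg_at_min(2))
      show "((\<lambda>r. G \<epsilon> s0 (x0 + r) (y0 + r)) has_real_derivative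
          c1 (?z + r) - \<alpha> * a1 (x0 + r) - \<beta> * b1 (y0 + r) + ?W * (2 * (x0 + r) + 2 * (y0 + r))) (at r)" for r
        unfolding G_def diag
        by (rule derivative_eq_intros shift A(1) B(1) D(1) refl)+ (simp add: algebra_simps)
      show "((\<lambda>r. c1 (?z + r) - \<alpha> * a1 (x0 + r) - \<beta> * b1 (y0 + r) + ?W * (2 * (x0 + r) + 2 * (y0 + r)))
          has_real_derivative c2 ?z - \<alpha> * a2 x0 - \<beta> * b2 y0 + 4 * ?W) (at 0)"
        by (rule derivative_eq_intros shift A(2) B(2) D(2) refl)+ (simp add: algebra_simps)
      show "G \<epsilon> s0 (x0 + 0) (y0 + 0) \<le> G \<epsilon> s0 (x0 + r) (y0 + r)" for r
        using nonneg G_zero by simp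
    qed
    show False
    proof (rule barrier_contradiction[OF _ \<open>0 \<le> L\<close> C K_def _ _ _ _ _ _ first_x first_y second time])
      show "0 < ?W" using \<open>0 < \<epsilon>\<close> by simp
      show "\<bar>a s0 x0\<bar> \<le> C + L * \<bar>x0\<bar>" by (rule Ba[OF s0])
      show "\<bar>b s0 y0\<bar> \<le> C + L * \<bar>y0\<bar>" by (rule Bb[OF s0])
      show "\<bar>a1 x0\<bar> \<le> L" "\<bar>b1 y0\<bar> \<le> L" "\<bar>c1 ?z\<bar> \<le> L"
        by (rule DERIV_lipschitz_bound[OF La A(1)] DERIV_lipschitz_bound[OF Lb B(1)] DERIV_lipschitz_bound[OF Lc D(1)])+
      show "c s0 ?z - \<alpha> * a s0 x0 - \<beta> * b s0 y0 + ?W * (1 + x0\<^sup>2 + y0\<^sup>2) = 0"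
        using G_zero by (simp add: G_def)
    qed
  qed
  show ?thesis
  proof (rule ccontr)
    assume neg: "\<not> ?thesis"
    define d where "d = \<alpha> * a 1 x + \<beta> * b 1 y - c 1 (\<alpha> * x + \<beta> * y)"
    \<comment> \<open>At time 1 this barrier equals the deficit \<open>d\<close> at (x, y), so the
      perturbed defect there is 0, not positive.\<close>
    define \<epsilon> where "\<epsilon> = d / (exp K * (1 + x\<^sup>2 + y\<^sup>2))"
    have "0 < d" using neg by (simp add: d_def)
    have N: "0 < exp K * (1 + x\<^sup>2 + y\<^sup>2)" by (simp add: add_pos_nonneg)
    then have "0 < \<epsilon>" using \<open>0 < d\<close> by (simp add: \<epsilon>_def)
    from main[OF this, of 1 x y] have "0 < - d + \<epsilon> * (exp K * (1 + x\<^sup>2 + y\<^sup>2))"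
      by (simp add: G_def d_def mult.assoc)
    also have "\<dots> = 0"
    proof -
      have "1 + x\<^sup>2 + y\<^sup>2 \<noteq> 0" using N by (metis less_irrefl mult_zero_right)
      then show ?thesis by (simp add: \<epsilon>_def)
    qed
    finally show False by simp
  qed
qed

text \<open>The mean under the standard normal law is the heat flow at time 1 and position 0, so the
  comparison of flows applies.\<close>

theorem Ehrhard_line:
  assumes lip: "\<And>x y. \<bar>U x - U y\<bar> \<le> L * \<bar>x - y\<bar>" "\<And>x y. \<bar>V x - V y\<bar> \<le> L * \<bar>x - y\<bar>"
      "\<And>x y. \<bar>W x - W y\<bar> \<le> L * \<bar>x - y\<bar>"
    and "0 < \<alpha>" "0 < \<beta>" "\<alpha> + \<beta> = 1"
    and "\<And>x y. \<alpha> * U x + \<beta> * V y \<le> W (\<alpha> * x + \<beta> * y)"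
  shows "\<alpha> * probit (\<integral>z. \<Phi> (U z) \<partial>std_normal_distribution)
      + \<beta> * probit (\<integral>z. \<Phi> (V z) \<partial>std_normal_distribution)
      \<le> probit (\<integral>z. \<Phi> (W z) \<partial>std_normal_distribution)"
proof -
  have "\<alpha> * probit (heat (\<lambda>x. \<Phi> (U x)) 1 0) + \<beta> * probit (heat (\<lambda>x. \<Phi> (V x)) 1 0)
      \<le> probit (heat (\<lambda>x. \<Phi> (W x)) 1 (\<alpha> * 0 + \<beta> * 0))"
    by (rule probit_heat_flow_comparison[OF lip[THEN probit_heat_flow_heat] assms(4-6)])
      (simp add: assms(7))
  then show ?thesis by (simp add: heat_def)
qed

section \<open>Gaussian measures and characteristic functions\<close>

text \<open>The law of the sum of the listed vectors multiplied by independent standard normals.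
  Degenerate laws are included, and the recursion peels off one normal coordinate, as the induction
  in \<open>Ehrhard_gauss_law\<close> requires.\<close>

primrec gauss_law :: "'a::euclidean_space list \<Rightarrow> 'a measure" where
  "gauss_law [] = return borel 0"
| "gauss_law (v # vs) =
     distr (gauss_law vs \<Otimes>\<^sub>M std_normal_distribution) borel (\<lambda>(x, z). x + z *\<^sub>R v)"

lemma sets_gauss_law [simp, measurable_cong]: "sets (gauss_law vs) = sets borel"
  by (cases vs) auto

lemma space_gauss_law [simp]: "space (gauss_law vs) = UNIV"
  by (cases vs) auto

lemma prob_space_gauss_law: "prob_space (gauss_law vs)"
proof (induction vs)
  case Nil
  show ?case by (simp add: prob_space_return)
next
  case (Cons v vs)
  interpret M: prob_space "gauss_law vs" by fact
  interpret pair_prob_space "gauss_law vs" std_normal_distribution ..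
  show ?case unfolding gauss_law.simps by (rule prob_space_distr) measurable
qed

lemma integral_gauss_law_Cons:
  fixes f :: "'a::euclidean_space \<Rightarrow> 'b::{banach, second_countable_topology}"
  assumes [measurable]: "f \<in> borel_measurable borel" and B: "\<And>x. norm (f x) \<le> B"
  shows "(\<integral>x. f x \<partial>gauss_law (v # vs)) =
    (\<integral>x. \<integral>z. f (x + z *\<^sub>R v) \<partial>std_normal_distribution \<partial>gauss_law vs)"
proof -
  interpret M: prob_space "gauss_law vs" by (rule prob_space_gauss_law)
  interpret pair_prob_space "gauss_law vs" std_normal_distribution ..
  have i: "integrable (gauss_law vs \<Otimes>\<^sub>M std_normal_distribution) (\<lambda>(x, z). f (x + z *\<^sub>R v))"
    by (rule integrable_const_bound[where B=B]) (use B in auto)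
  have "(\<integral>x. f x \<partial>gauss_law (v # vs)) =
      (\<integral>p. f ((\<lambda>(x, z). x + z *\<^sub>R v) p) \<partial>(gauss_law vs \<Otimes>\<^sub>M std_normal_distribution))"
    unfolding gauss_law.simps by (rule integral_distr) measurable
  also have "\<dots> = (\<integral>p. (\<lambda>(x, z). f (x + z *\<^sub>R v)) p \<partial>(gauss_law vs \<Otimes>\<^sub>M std_normal_distribution))"
    by (simp add: case_prod_beta')
  also have "\<dots> = (\<integral>x. \<integral>z. f (x + z *\<^sub>R v) \<partial>std_normal_distribution \<partial>gauss_law vs)"
    by (subst integral_fst'[OF i, symmetric]) simp
  finally show ?thesis .
qed

lemma distr_gauss_law_linear:
  assumes "linear f"
  shows "distr (gauss_law vs) borel f = gauss_law (map f vs)"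
proof -
  have [measurable]: "f \<in> borel_measurable borel"
    by (intro borel_measurable_continuous_onI linear_continuous_on linear_conv_bounded_linear[THEN iffD1] assms)
  show ?thesis
  proof (induction vs)
    case Nil
    have "distr (return borel 0) borel f = return borel (f 0)"
      by (rule distr_return) auto
    then show ?case using linear_0[OF assms] by simp
  next
    case (Cons v vs)
    interpret M: prob_space "gauss_law vs" by (rule prob_space_gauss_law)
    interpret M': prob_space "gauss_law (map f vs)" by (rule prob_space_gauss_law)
    have "gauss_law (map f (v # vs)) = distr (distr (gauss_law vs) borel f \<Otimes>\<^sub>M distr std_normal_distribution std_normal_distribution (\<lambda>z. z))
        borel (\<lambda>(x, z). x + z *\<^sub>R f v)"
      by (simp add: Cons.IH distr_id2)
    also have "distr (gauss_law vs) borel f \<Otimes>\<^sub>M distr std_normal_distribution std_normal_distribution (\<lambda>z. z) =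
        distr (gauss_law vs \<Otimes>\<^sub>M std_normal_distribution) (borel \<Otimes>\<^sub>M std_normal_distribution) (\<lambda>(x, z). (f x, z))"
      by (rule pair_measure_distr) (auto simp: distr_id2 intro: std_normal.sigma_finite_measure)
    also have "distr \<dots> borel (\<lambda>(x, z). x + z *\<^sub>R f v) =
       distr (gauss_law vs \<Otimes>\<^sub>M std_normal_distribution) borel (\<lambda>(x, z). f x + z *\<^sub>R f v)"
      by (subst distr_distr) (auto simp: comp_def case_prod_beta')
    also have "\<dots> = distr (gauss_law (v # vs)) borel f"
      unfolding gauss_law.simps
      by (subst distr_distr)
        (auto simp: comp_def case_prod_beta' linear_add[OF assms] linear_scale[OF assms])
    finally show ?case by simp
  qed
qed

lemma gauss_law_char:
  "(\<integral>x. iexp (t \<bullet> x) \<partial>gauss_law vs) = complex_of_real (exp (- (\<Sum>v\<leftarrow>vs. (t \<bullet> v)\<^sup>2) / 2))"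
proof (induction vs)
  case Nil
  show ?case by (simp add: integral_return)
next
  case (Cons v vs)
  have "(\<integral>x. iexp (t \<bullet> x) \<partial>gauss_law (v # vs)) =
      (\<integral>x. \<integral>z. iexp (t \<bullet> (x + z *\<^sub>R v)) \<partial>std_normal_distribution \<partial>gauss_law vs)"
    by (rule integral_gauss_law_Cons[where B=1]) auto
  also have "\<dots> = (\<integral>x. iexp (t \<bullet> x) * char std_normal_distribution (t \<bullet> v) \<partial>gauss_law vs)"
    unfolding char_def
    by (intro Bochner_Integration.integral_cong refl)
      (simp add: inner_add_right exp_add[symmetric] distrib_left mult.commute
        flip: integral_mult_right_zero)
  also have "\<dots> = complex_of_real (exp (- (\<Sum>v\<leftarrow>vs. (t \<bullet> v)\<^sup>2) / 2)) * exp (- (t \<bullet> v)\<^sup>2 / 2)"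
    by (simp add: Cons.IH char_std_normal_distribution)
  also have "\<dots> = complex_of_real (exp (- (\<Sum>v\<leftarrow>v # vs. (t \<bullet> v)\<^sup>2) / 2))"
    by (simp flip: of_real_mult exp_add add: add_divide_distrib add.commute)
  finally show ?case .
qed

section \<open>Uniqueness of characteristic functions in Euclidean space\<close>

lemma basis_list_exists:
  "\<exists>bs :: 'a::euclidean_space list. distinct bs \<and> set bs = Basis"
  using finite_distinct_list[OF finite_Basis] by metis

definition basis_list :: "'a::euclidean_space list" where
  "basis_list = (SOME bs. distinct bs \<and> set bs = Basis)"

lemma basis_list: "distinct basis_list" "set basis_list = Basis"
  using someI_ex[OF basis_list_exists] unfolding basis_list_def by auto

lemma sum_list_basis_list: "(\<Sum>b\<leftarrow>basis_list. f b) = (\<Sum>b\<in>Basis. f b)"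
  by (simp add: sum_list_distinct_conv_sum_set basis_list)

lemma sum_Basis_inner_square: "(\<Sum>b\<in>Basis. (t \<bullet> b)\<^sup>2) = (norm t)\<^sup>2"
  by (simp add: norm_eq_sqrt_inner sum_nonneg euclidean_inner[of t t] power2_eq_square)

lemma integrable_exp_norm_square: "integrable lborel (\<lambda>u::'a::euclidean_space. exp (- (norm u)\<^sup>2 / 2))"
proof (rule integrableI_nonneg)
  have one: "(\<integral>\<^sup>+x. ennreal (exp (- x\<^sup>2 / 2)) \<partial>lborel) < \<infinity>"
  proof -
    have "integrable lborel (\<lambda>x::real. exp (- x\<^sup>2 / 2))"
      using integrable_mult_right[OF integrable_normal_density[OF zero_less_one, of 0], of "sqrt (2 * pi)"]
      by (simp add: std_normal_density_def[abs_def])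
    then show ?thesis by (simp add: integrable_iff_bounded)
  qed
  have "(\<integral>\<^sup>+u. ennreal (exp (- (norm (u::'a))\<^sup>2 / 2)) \<partial>lborel)
      = (\<integral>\<^sup>+u. (\<Prod>b\<in>Basis. ennreal (exp (- ((u::'a) \<bullet> b)\<^sup>2 / 2))) \<partial>lborel)"
    by (intro nn_integral_cong)
      (simp add: prod_ennreal exp_sum[symmetric] sum_Basis_inner_square[symmetric] sum_negf sum_divide_distrib)
  also have "\<dots> = (\<Prod>b\<in>(Basis::'a set). (\<integral>\<^sup>+x. ennreal (exp (- x\<^sup>2 / 2)) \<partial>lborel))"
    by (rule nn_integral_lborel_prod) auto
  also have "\<dots> < \<infinity>"
    using one by (simp add: power_less_top_ennreal)
  finally show "(\<integral>\<^sup>+u. ennreal (exp (- (norm (u::'a))\<^sup>2 / 2)) \<partial>lborel) < \<infinity>" .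
qed auto

lemma lborel_integrable_affine:
  fixes f :: "'a::euclidean_space \<Rightarrow> real"
  assumes f: "integrable lborel f" and "c \<noteq> 0"
  shows "integrable lborel (\<lambda>y. f (t + c *\<^sub>R y))"
proof -
  have [measurable]: "f \<in> borel_measurable borel"
    using f borel_measurable_integrable by (simp add: measurable_lborel1)
  have "integrable (density (distr lborel borel (\<lambda>y. t + c *\<^sub>R y)) (\<lambda>_. \<bar>c\<bar> ^ DIM('a))) f"
    using f lborel_affine[OF \<open>c \<noteq> 0\<close>, of t] by simp
  then have "integrable lborel (\<lambda>y. \<bar>c\<bar> ^ DIM('a) *\<^sub>R f (t + c *\<^sub>R y))"
    by (subst (asm) integrable_density) (auto simp: integrable_distr_eq)
  then show ?thesis using \<open>c \<noteq> 0\<close> by simp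
qed

lemma lborel_integral_affine:
  fixes f :: "'a::euclidean_space \<Rightarrow> real"
  assumes [measurable]: "f \<in> borel_measurable borel" and "0 < c"
  shows "(\<integral>u. f (x + (1 / c) *\<^sub>R u) \<partial>lborel) = c ^ DIM('a) * (\<integral>y. f y \<partial>lborel)"
proof -
  have "(\<integral>y. f y \<partial>lborel) = (\<integral>y. f y \<partial>density (distr lborel borel (\<lambda>u. x + (1 / c) *\<^sub>R u)) (\<lambda>_. \<bar>1 / c\<bar> ^ DIM('a)))"
    using lborel_affine[of "1 / c" x] \<open>0 < c\<close> by simp
  also have "\<dots> = (1 / c) ^ DIM('a) * (\<integral>u. f (x + (1 / c) *\<^sub>R u) \<partial>lborel)"
    using \<open>0 < c\<close> by (subst integral_density) (auto simp: integral_distr)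
  finally show ?thesis using \<open>0 < c\<close> by (simp add: power_divide)
qed

text \<open>The Gaussian kernel is an average of characters over
  \<open>gauss_law basis_list\<close>; after Fubini, \<open>M\<close> enters only through its
  characteristic function.\<close>

lemma integral_heat_kernel_char:
  fixes M :: "'a::euclidean_space measure"
  assumes "prob_space M" and [measurable_cong]: "sets M = sets borel"
  shows "complex_of_real (\<integral>x. exp (- (norm (c *\<^sub>R (y - x)))\<^sup>2 / 2) \<partial>M) =
    (\<integral>w. iexp (c *\<^sub>R w \<bullet> y) * (\<integral>x. iexp ((- c) *\<^sub>R w \<bullet> x) \<partial>M) \<partial>gauss_law basis_list)"
proof -
  interpret M: prob_space M by fact
  interpret N: prob_space "gauss_law (basis_list :: 'a list)" by (rule prob_space_gauss_law)
  interpret pair_prob_space M "gauss_law (basis_list :: 'a list)" ..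
  have k: "complex_of_real (exp (- (norm (c *\<^sub>R (y - x)))\<^sup>2 / 2)) =
      (\<integral>w. iexp (c *\<^sub>R (y - x) \<bullet> w) \<partial>gauss_law basis_list)" for x
    unfolding gauss_law_char sum_list_basis_list sum_Basis_inner_square by (rule refl)
  have "complex_of_real (\<integral>x. exp (- (norm (c *\<^sub>R (y - x)))\<^sup>2 / 2) \<partial>M) =
      (\<integral>x. complex_of_real (exp (- (norm (c *\<^sub>R (y - x)))\<^sup>2 / 2)) \<partial>M)"
    by (rule integral_complex_of_real[symmetric])
  also have "\<dots> = (\<integral>x. \<integral>w. iexp (c *\<^sub>R (y - x) \<bullet> w) \<partial>gauss_law basis_list \<partial>M)"
    by (simp only: k)
  also have "\<dots> = (\<integral>w. \<integral>x. iexp (c *\<^sub>R (y - x) \<bullet> w) \<partial>M \<partial>gauss_law basis_list)"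
    by (rule Fubini_integral[symmetric], rule integrable_const_bound[where B=1]) auto
  also have "\<dots> = (\<integral>w. iexp (c *\<^sub>R w \<bullet> y) * (\<integral>x. iexp ((- c) *\<^sub>R w \<bullet> x) \<partial>M) \<partial>gauss_law basis_list)"
    by (intro Bochner_Integration.integral_cong refl)
      (simp add: exp_add[symmetric] inner_diff_right inner_diff_left inner_commute algebra_simps
        flip: integral_mult_right_zero)
  finally show ?thesis .
qed

text \<open>\<open>J M c\<close> is, up to the constant \<open>\<kappa>\<close>, the mean of
  \<open>g\<close> smoothed at scale 1 / c. The substitution y = x + u / c moves the smoothing onto
  the measure, where \<open>integral_heat_kernel_char\<close> shows that only the characteristic
  function matters. Letting c grow recovers \<open>\<kappa>\<close> times the integral of
  \<open>g\<close>.\<close>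

lemma euclidean_char_unique_integral:
  fixes M N :: "'a::euclidean_space measure" and g :: "'a \<Rightarrow> real"
  assumes M: "prob_space M" "sets M = sets borel" and N: "prob_space N" "sets N = sets borel"
    and char: "\<And>t. (\<integral>x. iexp (t \<bullet> x) \<partial>M) = (\<integral>x. iexp (t \<bullet> x) \<partial>N)"
    and g: "continuous_on UNIV g" "\<And>x. \<bar>g x\<bar> \<le> 1"
  shows "(\<integral>x. g x \<partial>M) = (\<integral>x. g x \<partial>N)"
proof -
  have [measurable]: "g \<in> borel_measurable borel"
    using g(1) by (rule borel_measurable_continuous_onI)
  let ?E = "\<lambda>u::'a. exp (- (norm u)\<^sup>2 / 2)"
  define \<kappa> where "\<kappa> = (\<integral>u. ?E u \<partial>lborel)"
  define J where "J = (\<lambda>M c. \<integral>x. \<integral>u. g (x + (1 / c) *\<^sub>R u) * ?E u \<partial>lborel \<partial>M)"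
  have bd: "\<bar>g y * ?E u\<bar> \<le> ?E u" for y u
    using mult_right_mono[OF g(2)[of y], of "?E u"] by (simp add: abs_mult)
  have int_u: "integrable lborel (\<lambda>u. g (x + a *\<^sub>R u) * ?E u)" for x a
    by (rule Bochner_Integration.integrable_bound[OF integrable_exp_norm_square]) (use bd in auto)
  have \<kappa>: "\<bar>\<integral>u. g (x + a *\<^sub>R u) * ?E u \<partial>lborel\<bar> \<le> \<kappa>" for x a
    unfolding \<kappa>_def real_norm_def[symmetric]
    by (rule order_trans[OF integral_norm_bound], rule integral_mono)
      (use int_u integrable_exp_norm_square bd in auto)
  have limit: "(\<lambda>n. J M (real (Suc n))) \<longlonglongrightarrow> \<kappa> * (\<integral>x. g x \<partial>M)"
    if "prob_space M" and [measurable_cong]: "sets M = sets borel" for M :: "'a measure"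
  proof -
    interpret M: prob_space M by fact
    have "(\<lambda>n. J M (real (Suc n))) \<longlonglongrightarrow> (\<integral>x. g x * \<kappa> \<partial>M)"
      unfolding J_def
    proof (rule integral_dominated_convergence[where w="\<lambda>_. \<kappa>"])
      show "AE x in M. (\<lambda>n. \<integral>u. g (x + (1 / real (Suc n)) *\<^sub>R u) * ?E u \<partial>lborel) \<longlonglongrightarrow> g x * \<kappa>"
      proof (rule AE_I2)
        fix x
        have "(\<lambda>n. \<integral>u. g (x + (1 / real (Suc n)) *\<^sub>R u) * ?E u \<partial>lborel) \<longlonglongrightarrow> (\<integral>u. g x * ?E u \<partial>lborel)"
        proof (rule integral_dominated_convergence[OF _ _ integrable_exp_norm_square])
          show "AE u in lborel. (\<lambda>n. g (x + (1 / real (Suc n)) *\<^sub>R u) * ?E u) \<longlonglongrightarrow> g x * ?E u"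
          proof (intro AE_I2 tendsto_mult tendsto_const)
            fix u :: 'a
            have "(\<lambda>n. x + (1 / real (Suc n)) *\<^sub>R u) \<longlonglongrightarrow> x + 0 *\<^sub>R u"
              using LIMSEQ_inverse_real_of_nat by (intro tendsto_intros) (simp add: inverse_eq_divide)
            then show "(\<lambda>n. g (x + (1 / real (Suc n)) *\<^sub>R u)) \<longlonglongrightarrow> g x"
              by (intro continuous_on_tendsto_compose[OF g(1)]) auto
          qed
        qed (use bd in auto)
        then show "(\<lambda>n. \<integral>u. g (x + (1 / real (Suc n)) *\<^sub>R u) * ?E u \<partial>lborel) \<longlonglongrightarrow> g x * \<kappa>"
          by (simp add: \<kappa>_def)
      qed
    qed (use \<kappa> in auto)
    then show ?thesis by (simp add: mult.commute)
  qed
  have swap: "J M c = c ^ DIM('a) * (\<integral>y. g y * (\<integral>x. ?E (c *\<^sub>R (y - x)) \<partial>M) \<partial>lborel)"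
    if "prob_space M" and [measurable_cong]: "sets M = sets borel" and "0 < c" for M :: "'a measure" and c
  proof -
    interpret M: prob_space M by fact
    interpret pair_sigma_finite M "lborel :: 'a measure" ..
    have inner: "(\<integral>u. h (x + (1 / c) *\<^sub>R u) * ?E u \<partial>lborel) = c ^ DIM('a) * (\<integral>y. h y * ?E (c *\<^sub>R (y - x)) \<partial>lborel)"
      if [measurable]: "h \<in> borel_measurable borel" for x and h :: "'a \<Rightarrow> real"
      using lborel_integral_affine[of "\<lambda>y. h y * ?E (c *\<^sub>R (y - x))" c x] \<open>0 < c\<close> by simp
    have iE: "integrable lborel (\<lambda>y. ?E (c *\<^sub>R (y - x)))" for x
    proof -
      have "integrable lborel (\<lambda>y. ?E (- (c *\<^sub>R x) + c *\<^sub>R y))"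
        by (rule lborel_integrable_affine[OF integrable_exp_norm_square]) (use \<open>0 < c\<close> in simp)
      then show ?thesis by (simp add: algebra_simps)
    qed
    have "J M c = (\<integral>x. c ^ DIM('a) * (\<integral>y. g y * ?E (c *\<^sub>R (y - x)) \<partial>lborel) \<partial>M)"
      unfolding J_def by (simp only: inner[OF \<open>g \<in> borel_measurable borel\<close>])
    also have "\<dots> = c ^ DIM('a) * (\<integral>x. \<integral>y. g y * ?E (c *\<^sub>R (y - x)) \<partial>lborel \<partial>M)"
      by simp
    also have "(\<integral>x. \<integral>y. g y * ?E (c *\<^sub>R (y - x)) \<partial>lborel \<partial>M) =
        (\<integral>y. \<integral>x. g y * ?E (c *\<^sub>R (y - x)) \<partial>M \<partial>lborel)"
    proof (rule Fubini_integral[symmetric], rule Fubini_integrable)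
      show "AE x in M. integrable lborel (\<lambda>y. (case (x, y) of (x, y) \<Rightarrow> g y * ?E (c *\<^sub>R (y - x))))"
      proof (rule AE_I2)
        fix x
        have "integrable lborel (\<lambda>y. g y * ?E (c *\<^sub>R (y - x)))"
        proof (rule Bochner_Integration.integrable_bound[OF iE[of x]])
          show "AE y in lborel. norm (g y * ?E (c *\<^sub>R (y - x))) \<le> norm (?E (c *\<^sub>R (y - x)))"
            unfolding real_norm_def abs_exp_cancel by (intro AE_I2 bd)
        qed measurable
        then show "integrable lborel (\<lambda>y. (case (x, y) of (x, y) \<Rightarrow> g y * ?E (c *\<^sub>R (y - x))))"
          by simp
      qed
      show "integrable M (\<lambda>x. \<integral>y. norm (case (x, y) of (x, y) \<Rightarrow> g y * ?E (c *\<^sub>R (y - x))) \<partial>lborel)"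
      proof (rule M.integrable_const_bound[where B="\<kappa> / c ^ DIM('a)"])
        have "(\<integral>y. \<bar>g y\<bar> * ?E (c *\<^sub>R (y - x)) \<partial>lborel) \<le> (\<integral>y. 1 * ?E (c *\<^sub>R (y - x)) \<partial>lborel)" for x
        proof (rule integral_mono)
          show "integrable lborel (\<lambda>y. \<bar>g y\<bar> * ?E (c *\<^sub>R (y - x)))"
            using bd by (intro Bochner_Integration.integrable_bound[OF iE[of x]]) (auto simp: abs_mult)
        qed (use iE g(2) in \<open>auto intro!: mult_right_mono\<close>)
        also have "(\<integral>y. 1 * ?E (c *\<^sub>R (y - x)) \<partial>lborel) = \<kappa> / c ^ DIM('a)" for x
          using inner[of "\<lambda>_. 1" x] \<open>0 < c\<close> by (simp add: \<kappa>_def field_simps)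
        finally show "AE x in M. norm (\<integral>y. norm (case (x, y) of (x, y) \<Rightarrow> g y * ?E (c *\<^sub>R (y - x))) \<partial>lborel) \<le> \<kappa> / c ^ DIM('a)"
          by (auto simp: abs_mult)
      qed measurable
    qed measurable
    finally show ?thesis by simp
  qed
  have "(\<integral>x. ?E (c *\<^sub>R (y - x)) \<partial>M) = (\<integral>x. ?E (c *\<^sub>R (y - x)) \<partial>N)" for c y
    unfolding of_real_eq_iff[where 'a=complex, symmetric]
    unfolding integral_heat_kernel_char[OF M] integral_heat_kernel_char[OF N] char by (rule refl)
  then have "J M c = J N c" if "0 < c" for c
    using swap[OF M that] swap[OF N that] by simp
  then have "(\<lambda>n. J M (real (Suc n))) \<longlonglongrightarrow> \<kappa> * (\<integral>x. g x \<partial>N)"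
    using limit[OF N] by simp
  with limit[OF M] have "\<kappa> * (\<integral>x. g x \<partial>M) = \<kappa> * (\<integral>x. g x \<partial>N)"
    by (rule LIMSEQ_unique)
  moreover have "\<kappa> \<noteq> 0"
  proof
    assume "\<kappa> = 0"
    then have "AE u::'a in lborel. ?E u = 0"
      unfolding \<kappa>_def by (subst (asm) integral_nonneg_eq_0_iff_AE[OF integrable_exp_norm_square]) auto
    then have "AE u::'a in lborel. False" by simp
    then show False by (subst (asm) AE_iff_measurable[OF _ refl]) (auto simp: emeasure_lborel_UNIV)
  qed
  ultimately show ?thesis by simp
qed

text \<open>Closed sets form an intersection-stable generator of the Borel sets, and the indicator
  of a nonempty one is the limit of the continuous functions
  \<open>max 0 (1 - real n * infdist x A)\<close>.\<close>

theorem euclidean_char_unique: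
  fixes M N :: "'a::euclidean_space measure"
  assumes M: "prob_space M" "sets M = sets borel" and N: "prob_space N" "sets N = sets borel"
    and char: "\<And>t. (\<integral>x. iexp (t \<bullet> x) \<partial>M) = (\<integral>x. iexp (t \<bullet> x) \<partial>N)"
  shows "M = N"
proof -
  interpret M: prob_space M by (rule M)
  interpret N: prob_space N by (rule N)
  have [measurable_cong]: "sets M = sets borel" "sets N = sets borel" by (rule M N)+
  have meas: "measure M A = measure N A" if "closed A" for A
  proof (cases "A = {}")
    case False
    define g where "g = (\<lambda>n x. max 0 (1 - real n * infdist x A))"
    have gc: "continuous_on UNIV (g n)" for n
      unfolding g_def by (intro continuous_intros)
    then have [measurable]: "g n \<in> borel_measurable borel" for n
      by (rule borel_measurable_continuous_onI)
    have gb: "\<bar>g n x\<bar> \<le> 1" for n x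
      using infdist_nonneg[of x A] by (auto simp: g_def max_def)
    have lim: "(\<lambda>n. g n x) \<longlonglongrightarrow> indicator A x" for x
    proof (cases "x \<in> A")
      case True
      then show ?thesis by (simp add: g_def)
    next
      case False
      then have "0 < infdist x A"
        using \<open>closed A\<close> \<open>A \<noteq> {}\<close> by (simp add: infdist_pos_not_in_closed)
      then obtain k where k: "1 \<le> real k * infdist x A"
        using ex_less_of_nat_mult less_imp_le by blast
      have "\<forall>\<^sub>F n in sequentially. g n x = 0"
        using eventually_ge_at_top[of k]
      proof eventually_elim
        case (elim n)
        then have "real k * infdist x A \<le> real n * infdist x A"
          by (intro mult_right_mono) (auto simp: infdist_nonneg)
        with k show ?case by (simp add: g_def)
      qed
      then show ?thesis using False by (simp add: tendsto_eventually)
    qed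
    have "A \<in> sets borel" using that by simp
    have int: "(\<lambda>n. \<integral>x. g n x \<partial>Q) \<longlonglongrightarrow> measure Q A" if "prob_space Q" and [measurable_cong]: "sets Q = sets borel" for Q
    proof -
      interpret Q: prob_space Q by fact
      have [simp]: "space Q = UNIV" using sets_eq_imp_space_eq[OF that(2)] by simp
      have "(\<lambda>n. \<integral>x. g n x \<partial>Q) \<longlonglongrightarrow> (\<integral>x. indicator A x \<partial>Q)"
      proof (rule integral_dominated_convergence[where w="\<lambda>_. 1"])
        show "AE x in Q. (\<lambda>n. g n x) \<longlonglongrightarrow> indicator A x" by (intro AE_I2 lim)
        show "AE x in Q. norm (g n x) \<le> 1" for n by (simp add: gb)
        show "indicator A \<in> borel_measurable Q"
          using \<open>A \<in> sets borel\<close> by (intro borel_measurable_indicator) (simp add: that)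
        show "g n \<in> borel_measurable Q" for n by measurable
      qed simp
      then show ?thesis by simp
    qed
    have "(\<integral>x. g n x \<partial>M) = (\<integral>x. g n x \<partial>N)" for n
      by (rule euclidean_char_unique_integral[OF M N char gc gb])
    with int[OF M] int[OF N] show ?thesis
      using LIMSEQ_unique by simp
  qed simp
  show ?thesis
  proof (rule measure_eqI_generator_eq[where E="Collect closed" and \<Omega>=UNIV and A="\<lambda>_. UNIV"])
    show "Int_stable (Collect closed :: 'a set set)" by (auto simp: Int_stable_def)
    show "sets M = sigma_sets UNIV (Collect closed)" "sets N = sigma_sets UNIV (Collect closed)"
      unfolding M(2) N(2) by (subst borel_eq_closed, simp add: sets_measure_of)+
  qed (use meas in \<open>auto simp: M.emeasure_eq_measure N.emeasure_eq_measure\<close>)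
qed

text \<open>The law depends on the list only through its quadratic form. This takes the place of
  changes of variables, such as the rotation behind
  \<open>std_gauss_orthogonal_split\<close>.\<close>

corollary gauss_law_eqI:
  assumes "\<And>t. (\<Sum>v\<leftarrow>vs. (t \<bullet> v)\<^sup>2) = (\<Sum>w\<leftarrow>ws. (t \<bullet> w)\<^sup>2)"
  shows "gauss_law vs = gauss_law ws"
  by (rule euclidean_char_unique)
    (auto simp: prob_space_gauss_law gauss_law_char assms)

section \<open>Ehrhard's inequality for sublevel sets\<close>

text \<open>Translates \<open>W (x + y)\<close> are averaged so that the result is again a function
  on the whole space. Averaging over one coordinate gives \<open>T\<close>, which keeps the
  Lipschitz constant of \<open>W\<close> and, by \<open>Ehrhard_line\<close>, its concavity; so the
  induction hypothesis applies to \<open>T\<close>.\<close>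

lemma Ehrhard_gauss_law:
  fixes W :: "'a::euclidean_space \<Rightarrow> real"
  assumes "\<And>x y. \<bar>W x - W y\<bar> \<le> L * norm (x - y)" and "concave_on UNIV W"
  shows "\<exists>W'. concave_on UNIV W' \<and> (\<forall>x. \<Phi> (W' x) = (\<integral>y. \<Phi> (W (x + y)) \<partial>gauss_law vs))"
  using assms
proof (induction vs arbitrary: W)
  case Nil
  have "continuous_on UNIV W" by (rule lipschitz_abs_imp_continuous) (rule Nil)
  then have [measurable]: "W \<in> borel_measurable borel" by (rule borel_measurable_continuous_onI)
  have "(\<integral>y. \<Phi> (W (x + y)) \<partial>gauss_law []) = \<Phi> (W x)" for x
    by (simp add: integral_return)
  then show ?case using Nil(2) by auto
next
  case (Cons v vs)
  have "continuous_on UNIV W" by (rule lipschitz_abs_imp_continuous) (rule Cons)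
  then have [measurable]: "W \<in> borel_measurable borel" by (rule borel_measurable_continuous_onI)
  define T where "T = (\<lambda>x. probit (\<integral>z. \<Phi> (W (x + z *\<^sub>R v)) \<partial>std_normal_distribution))"
  have Phi_T: "\<Phi> (T x) = (\<integral>z. \<Phi> (W (x + z *\<^sub>R v)) \<partial>std_normal_distribution)" for x
    unfolding T_def by (rule Phi_probit; rule std_normal.expectation_Phi_bounds; measurable)
  have T_lip: "\<bar>T x - T y\<bar> \<le> L * norm (x - y)" for x y
    unfolding T_def
  proof (rule probit_expectation_Phi_lipschitz)
    show "prob_space std_normal_distribution" by (rule std_normal.prob_space_axioms)
    show "\<bar>W (x + z *\<^sub>R v) - W (y + z *\<^sub>R v)\<bar> \<le> L * norm (x - y)" for z
      using Cons.prems(1)[of "x + z *\<^sub>R v" "y + z *\<^sub>R v"] by simp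
  qed measurable
  have T_concave: "concave_on UNIV T"
    unfolding concave_on_iff
  proof (intro conjI ballI allI impI)
    fix x y :: 'a and \<alpha> \<beta> :: real
    assume ab: "0 \<le> \<alpha>" "0 \<le> \<beta>" "\<alpha> + \<beta> = 1"
    show "\<alpha> * T x + \<beta> * T y \<le> T (\<alpha> *\<^sub>R x + \<beta> *\<^sub>R y)"
    proof (cases "\<alpha> = 0 \<or> \<beta> = 0")
      case True
      then show ?thesis using ab by auto
    next
      case False
      have line_lip: "\<bar>W (x + r *\<^sub>R v) - W (x + s *\<^sub>R v)\<bar> \<le> (L * norm v) * \<bar>r - s\<bar>" for x r s
        using Cons.prems(1)[of "x + r *\<^sub>R v" "x + s *\<^sub>R v"]
        by (simp add: scaleR_diff_left[symmetric] mult_ac)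
      \<comment> \<open>The three functions are the restrictions of \<open>W\<close> to the parallel
        lines in direction \<open>v\<close> through x, y and their convex combination.\<close>
      show ?thesis unfolding T_def
      proof (rule Ehrhard_line)
        fix r s
        have "\<alpha> * W (x + r *\<^sub>R v) + \<beta> * W (y + s *\<^sub>R v)
            \<le> W (\<alpha> *\<^sub>R (x + r *\<^sub>R v) + \<beta> *\<^sub>R (y + s *\<^sub>R v))"
          using Cons.prems(2) ab unfolding concave_on_iff by blast
        then show "\<alpha> * W (x + r *\<^sub>R v) + \<beta> * W (y + s *\<^sub>R v)
            \<le> W (\<alpha> *\<^sub>R x + \<beta> *\<^sub>R y + (\<alpha> * r + \<beta> * s) *\<^sub>R v)"
          by (simp add: algebra_simps)
      qed (use line_lip ab False in auto)
    qed
  qed simp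
  obtain W' where W': "concave_on UNIV W'" "\<And>x. \<Phi> (W' x) = (\<integral>y. \<Phi> (T (x + y)) \<partial>gauss_law vs)"
    using Cons.IH[OF T_lip T_concave] by blast
  have "\<Phi> (W' x) = (\<integral>y. \<Phi> (W (x + y)) \<partial>gauss_law (v # vs))" for x
    using integral_gauss_law_Cons[of "\<lambda>y. \<Phi> (W (x + y))" 1 v vs] W'(2)[of x]
    by (simp add: Phi_T less_imp_le add.assoc)
  with W'(1) show ?case by blast
qed

text \<open>The functions \<Phi> (n * (t - h x)) approximate the indicator of the sublevel set and
  have the shape \<Phi> of a concave Lipschitz function. By \<open>shift\<close>, the level t
  amounts to a translation by - t e, so concavity in space restricts to concavity in t and survives
  the limit.\<close>

theorem Ehrhard_sublevel_sets:
  fixes h :: "'a::euclidean_space \<Rightarrow> real" and vs :: "'a list"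
  defines "F \<equiv> \<lambda>t. measure (gauss_law vs) {x. h x \<le> t}"
  assumes lip: "\<And>x y. \<bar>h x - h y\<bar> \<le> L * norm (x - y)" and convex: "convex_on UNIV h"
    and shift: "\<And>x t. h (x - t *\<^sub>R e) = h x - t"
    and I: "convex I" "\<And>t. t \<in> I \<Longrightarrow> 0 < F t" "\<And>t. t \<in> I \<Longrightarrow> F t < 1"
      "\<And>t. t \<in> I \<Longrightarrow> measure (gauss_law vs) {x. h x = t} = 0"
  shows "concave_on I (\<lambda>t. probit (F t))"
proof -
  interpret G: prob_space "gauss_law vs" by (rule prob_space_gauss_law)
  have hc: "continuous_on UNIV h" by (rule lipschitz_abs_imp_continuous) (rule lip)
  then have [measurable]: "h \<in> borel_measurable borel" by (rule borel_measurable_continuous_onI)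
  define S where "S = (\<lambda>n t. \<integral>x. \<Phi> (real n * (t - h x)) \<partial>gauss_law vs)"
  have S_concave: "concave_on UNIV (\<lambda>t. probit (S n t))" for n
  proof -
    have "concave_on UNIV (\<lambda>x. - (real n * h x))"
      unfolding concave_on_def using convex_on_cmul[OF _ convex, of "real n"] by simp
    moreover have "\<bar>- (real n * h x) - - (real n * h y)\<bar> \<le> (real n * L) * norm (x - y)" for x y
    proof -
      have "\<bar>- (real n * h x) - - (real n * h y)\<bar> = real n * \<bar>h x - h y\<bar>"
        by (simp add: right_diff_distrib[symmetric] abs_mult abs_minus_commute)
      also have "\<dots> \<le> real n * (L * norm (x - y))"
        by (intro mult_left_mono lip) auto
      finally show ?thesis by (simp add: mult.assoc)
    qed
    ultimately obtain W' where W': "concave_on UNIV W'"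
      "\<And>x. \<Phi> (W' x) = (\<integral>y. \<Phi> (- (real n * h (x + y))) \<partial>gauss_law vs)"
      using Ehrhard_gauss_law[of "\<lambda>x. - (real n * h x)" "real n * L" vs] by blast
    have "\<Phi> (W' (- (t *\<^sub>R e))) = S n t" for t
    proof -
      have "- (real n * h (- (t *\<^sub>R e) + y)) = real n * (t - h y)" for y
        using shift[of y t] by (simp add: right_diff_distrib)
      then show ?thesis unfolding W'(2) S_def by simp
    qed
    then have eq: "probit (S n t) = W' (t *\<^sub>R (- e))" for t
      by (metis probit_Phi scaleR_minus_right)
    show ?thesis unfolding concave_on_iff eq
    proof (intro conjI ballI allI impI)
      fix s t u v :: real assume "0 \<le> u" "0 \<le> v" "u + v = 1"
      then have "u * W' (s *\<^sub>R (- e)) + v * W' (t *\<^sub>R (- e)) \<le> W' (u *\<^sub>R (s *\<^sub>R (- e)) + v *\<^sub>R (t *\<^sub>R (- e)))"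
        using W'(1) unfolding concave_on_iff by blast
      then show "u * W' (s *\<^sub>R (- e)) + v * W' (t *\<^sub>R (- e)) \<le> W' ((u *\<^sub>R s + v *\<^sub>R t) *\<^sub>R (- e))"
        by (simp add: algebra_simps)
    qed simp
  qed
  have S_lim: "(\<lambda>n. S n t) \<longlonglongrightarrow> F t" if "t \<in> I" for t
  proof -
    have "(\<lambda>n. S n t) \<longlonglongrightarrow> (\<integral>x. indicator {x. h x \<le> t} x \<partial>gauss_law vs)"
      unfolding S_def
    proof (rule integral_dominated_convergence[where w="\<lambda>_. 1"])
      \<comment> \<open>Where h x = t the approximants stay at \<Phi> 0 = 1/2, so convergence to the
        indicator requires this level set to be null.\<close>
      have "emeasure (gauss_law vs) {x. h x = t} = 0"
        using I(4)[OF that] by (simp add: G.emeasure_eq_measure)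
      then have "AE x in gauss_law vs. h x \<noteq> t"
        by (subst AE_iff_measurable[OF _ refl]) auto
      then show "AE x in gauss_law vs. (\<lambda>n. \<Phi> (real n * (t - h x))) \<longlonglongrightarrow> indicator {x. h x \<le> t} x"
      proof eventually_elim
        case (elim x)
        show ?case
        proof (cases "h x < t")
          case True
          then have "0 < t - h x" by simp
          then have "filterlim (\<lambda>n. (t - h x) * real n) at_top sequentially"
            by (rule filterlim_tendsto_pos_mult_at_top[OF tendsto_const _ filterlim_real_sequentially])
          then have "filterlim (\<lambda>n. real n * (t - h x)) at_top sequentially"
            by (simp only: mult.commute)
          from filterlim_compose[OF Phi_at_top this] show ?thesis using True by simp
        next
          case False
          with elim have "t - h x < 0" by simp
          then have "filterlim (\<lambda>n. (t - h x) * real n) at_bot sequentially"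
            by (rule filterlim_tendsto_neg_mult_at_bot[OF tendsto_const _ filterlim_real_sequentially])
          then have "filterlim (\<lambda>n. real n * (t - h x)) at_bot sequentially"
            by (simp only: mult.commute)
          from filterlim_compose[OF Phi_at_bot this] show ?thesis using False elim by simp
        qed
      qed
    qed (auto simp: less_imp_le)
    then show ?thesis by (simp add: F_def)
  qed
  have lim: "(\<lambda>n. probit (S n t)) \<longlonglongrightarrow> probit (F t)" if "t \<in> I" for t
    by (rule isCont_tendsto_compose[OF isCont_probit S_lim]) (use I that in auto)
  show ?thesis unfolding concave_on_iff
  proof (intro conjI ballI allI impI)
    fix s t u v :: real assume st: "s \<in> I" "t \<in> I" and uv: "0 \<le> u" "0 \<le> v" "u + v = 1"
    have "u *\<^sub>R s + v *\<^sub>R t \<in> I" using I(1) st uv by (rule convexD)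
    show "u * probit (F s) + v * probit (F t) \<le> probit (F (u *\<^sub>R s + v *\<^sub>R t))"
    proof (rule LIMSEQ_le)
      show "(\<lambda>n. u * probit (S n s) + v * probit (S n t)) \<longlonglongrightarrow> u * probit (F s) + v * probit (F t)"
        by (intro tendsto_intros lim st)
      show "(\<lambda>n. probit (S n (u *\<^sub>R s + v *\<^sub>R t))) \<longlonglongrightarrow> probit (F (u *\<^sub>R s + v *\<^sub>R t))"
        by (rule lim) fact
      show "\<exists>N. \<forall>n\<ge>N. u * probit (S n s) + v * probit (S n t) \<le> probit (S n (u *\<^sub>R s + v *\<^sub>R t))"
        using S_concave uv unfolding concave_on_iff by blast
    qed
  qed (rule I(1))
qed

section \<open>Gaussian vectors with a prescribed covariance matrix\<close>

lemma psd_kernel: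
  assumes T: "linear T" and sym: "\<And>s t. s \<bullet> T t = T s \<bullet> t" and psd: "\<And>t. 0 \<le> t \<bullet> T t"
    and "e \<bullet> T e = 0"
  shows "T e = 0"
proof (rule ccontr)
  assume "T e \<noteq> 0"
  define w q where "w = T e \<bullet> T e" and "q = T e \<bullet> T (T e)"
  have "0 < w" using \<open>T e \<noteq> 0\<close> by (simp add: w_def)
  have "0 \<le> q" using psd by (simp add: q_def)
  \<comment> \<open>Small enough that, in the quadratic form at e - r T e, the first-order loss 2 r
    w outweighs the second-order term r^2 q; the form would then be negative.\<close>
  define r where "r = w / (q + 1)"
  have "0 < r" using \<open>0 < w\<close> \<open>0 \<le> q\<close> by (simp add: r_def)
  have "0 \<le> (e - r *\<^sub>R T e) \<bullet> T (e - r *\<^sub>R T e)" by (rule psd)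
  also have "\<dots> = e \<bullet> T e - 2 * r * w + r * r * q"
  proof -
    have "e \<bullet> T (T e) = w" using sym[of e "T e"] by (simp add: w_def)
    then show ?thesis
      unfolding linear_diff[OF T] linear_scale[OF T] inner_diff_left inner_diff_right
        inner_scaleR_left inner_scaleR_right w_def[symmetric] q_def[symmetric] by (simp add: algebra_simps)
  qed
  also have "\<dots> = r * (r * q - 2 * w)" using assms(4) by (simp add: algebra_simps)
  finally have "0 \<le> r * q - 2 * w" using \<open>0 < r\<close> by (simp add: zero_le_mult_iff)
  moreover have "r * q \<le> w"
    using \<open>0 < w\<close> \<open>0 \<le> q\<close> by (simp add: r_def field_simps)
  ultimately show False using \<open>0 < w\<close> by simp
qed

text \<open>Symmetric elimination, as in the Cholesky decomposition: for each basis vector e one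
  square, of the product with U e / sqrt (e \<bullet> U e), is split off. The remainder stays
  positive semidefinite and annihilates e as well as all vectors treated before, so it is zero at
  the end. When e \<bullet> U e = 0, \<open>psd_kernel\<close> shows that e is annihilated
  already.\<close>

lemma psd_sum_of_squares:
  fixes T :: "'a::euclidean_space \<Rightarrow> 'a"
  assumes T: "linear T" and sym: "\<And>s t. s \<bullet> T t = T s \<bullet> t" and psd: "\<And>t. 0 \<le> t \<bullet> T t"
  obtains v :: "'a \<Rightarrow> 'a" where "\<And>t. t \<bullet> T t = (\<Sum>b\<in>Basis. (t \<bullet> v b)\<^sup>2)"
proof -
  have "\<exists>v U. linear U \<and> (\<forall>s t. s \<bullet> U t = U s \<bullet> t) \<and> (\<forall>t. 0 \<le> t \<bullet> U t) \<and> (\<forall>b\<in>S. U b = 0) \<and>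
      (\<forall>t. t \<bullet> T t = t \<bullet> U t + (\<Sum>b\<in>S. (t \<bullet> v b)\<^sup>2))" if "finite S" "S \<subseteq> Basis" for S :: "'a set"
    using that
  proof (induction S)
    case empty
    then show ?case using assms by auto
  next
    case (insert e S)
    then obtain v U where U: "linear U" "\<And>s t. s \<bullet> U t = U s \<bullet> t" "\<And>t. 0 \<le> t \<bullet> U t"
      "\<And>b. b \<in> S \<Longrightarrow> U b = 0" and eq: "\<And>t. t \<bullet> T t = t \<bullet> U t + (\<Sum>b\<in>S. (t \<bullet> v b)\<^sup>2)"
      by auto
    define d where "d = e \<bullet> U e"
    define w where "w = (if d = 0 then 0 else U e /\<^sub>R sqrt d)"
    define U' where "U' = (\<lambda>t. U t - (t \<bullet> w) *\<^sub>R w)"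
    have "0 \<le> d" using U(3) by (simp add: d_def)
    have d0: "U e = 0" if "d = 0" using psd_kernel[OF U(1-3)] that by (simp add: d_def)
    have ww: "(t \<bullet> w)\<^sup>2 = (t \<bullet> U e)\<^sup>2 / d" for t
      using \<open>0 \<le> d\<close> by (simp add: w_def power_mult_distrib field_simps)
    have lin: "linear U'"
      unfolding U'_def
      by (intro linear_compose_sub U(1)) (auto intro!: linearI simp: inner_add_left scaleR_add_left)
    have sym': "s \<bullet> U' t = U' s \<bullet> t" for s t
      using U(2)[of s t] by (simp add: U'_def inner_diff_left inner_diff_right inner_commute[of w t])
    have quad: "t \<bullet> U' t = t \<bullet> U t - (t \<bullet> w)\<^sup>2" for t
      by (simp add: U'_def inner_diff_right power2_eq_square)
    have psd': "0 \<le> t \<bullet> U' t" for t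
    proof (cases "d = 0")
      case True
      then show ?thesis using U(3) by (simp add: quad w_def)
    next
      case False
      \<comment> \<open>The minimizer of the form of \<open>U\<close> along t - c e; the minimum
        value is the form of \<open>U'\<close> at t.\<close>
      let ?c = "(t \<bullet> U e) / d"
      have "0 \<le> (t - ?c *\<^sub>R e) \<bullet> U (t - ?c *\<^sub>R e)" by (rule U(3))
      also have "\<dots> = t \<bullet> U t - 2 * ?c * (t \<bullet> U e) + ?c * ?c * d"
      proof -
        have "e \<bullet> U t = t \<bullet> U e" using U(2)[of e t] by (simp add: inner_commute)
        then show ?thesis
          unfolding linear_diff[OF U(1)] linear_scale[OF U(1)] inner_diff_left inner_diff_right
            inner_scaleR_left inner_scaleR_right d_def[symmetric] by (simp add: algebra_simps)
      qed
      also have "\<dots> = t \<bullet> U t - (t \<bullet> U e)\<^sup>2 / d"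
        using False by (simp add: field_simps power2_eq_square)
      finally show ?thesis by (simp add: quad ww)
    qed
    have zero: "U' b = 0" if "b \<in> insert e S" for b
    proof (cases "b = e")
      case True
      show ?thesis
      proof (cases "d = 0")
        case False
        then have "(e \<bullet> w) *\<^sub>R w = U e"
          using \<open>0 \<le> d\<close> by (simp add: w_def d_def[symmetric] field_simps real_sqrt_mult_self)
        then show ?thesis using True by (simp add: U'_def)
      qed (use True d0 in \<open>simp add: U'_def w_def\<close>)
    next
      case False
      then have "U b = 0" using that U(4) by simp
      moreover have "b \<bullet> w = 0" using U(2)[of b e] \<open>U b = 0\<close> by (simp add: w_def)
      ultimately show ?thesis by (simp add: U'_def)
    qed
    have "t \<bullet> T t = t \<bullet> U' t + (\<Sum>b\<in>insert e S. (t \<bullet> (v(e := w)) b)\<^sup>2)" for t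
    proof -
      have "(\<Sum>b\<in>S. (t \<bullet> (v(e := w)) b)\<^sup>2) = (\<Sum>b\<in>S. (t \<bullet> v b)\<^sup>2)"
        using insert.hyps by (intro sum.cong) auto
      then show ?thesis using insert.hyps by (simp add: eq quad)
    qed
    with lin sym' psd' zero show ?case by blast
  qed
  from this[OF finite_Basis order_refl] obtain v :: "'a \<Rightarrow> 'a" and U where U: "linear U" "\<And>b. b \<in> Basis \<Longrightarrow> U b = 0"
    and eq: "\<And>t. t \<bullet> T t = t \<bullet> U t + (\<Sum>b\<in>Basis. (t \<bullet> v b)\<^sup>2)"
    by blast
  have "U t = 0" for t
    using linear_eq_stdbasis[OF U(1) linear_zero] U(2) by metis
  then show ?thesis using that eq by simp
qed

lemma normal_law_eq_distr:
  assumes "0 \<le> \<sigma>"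
  shows "normal_law 0 \<sigma> = distr std_normal_distribution borel (\<lambda>z. \<sigma> * z)"
proof (cases "\<sigma> = 0")
  case True
  have "distr std_normal_distribution borel (\<lambda>z. 0::real) = return borel 0"
  proof (rule measure_eqI)
    fix A :: "real set" assume "A \<in> sets (distr std_normal_distribution borel (\<lambda>z. 0::real))"
    then show "emeasure (distr std_normal_distribution borel (\<lambda>z. 0)) A = emeasure (return borel 0) A"
      using std_normal.emeasure_space_1
      by (subst emeasure_distr) (auto simp: indicator_def)
  qed simp
  then show ?thesis using True by (simp add: normal_law_def)
next
  case False
  have "distributed std_normal_distribution lborel (\<lambda>z. z) std_normal_density"
    unfolding distributed_def by (auto simp: distr_id2)
  then have "distributed std_normal_distribution lborel (\<lambda>z. 0 + \<sigma> * z) (normal_density (0 + \<sigma> * 0) (\<bar>\<sigma>\<bar> * 1))"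
    using False by (intro std_normal.normal_density_affine) auto
  then have "distr std_normal_distribution lborel (\<lambda>z. \<sigma> * z) = density lborel (normal_density 0 \<sigma>)"
    using assms by (simp add: distributed_distr_eq_density)
  moreover have "distr std_normal_distribution lborel (\<lambda>z. \<sigma> * z) = distr std_normal_distribution borel (\<lambda>z. \<sigma> * z)"
    by (rule distr_cong) auto
  ultimately show ?thesis using False by (simp add: normal_law_def)
qed

lemma normal_law_char:
  assumes "0 \<le> \<sigma>"
  shows "(\<integral>r. iexp r \<partial>normal_law 0 \<sigma>) = complex_of_real (exp (- \<sigma>\<^sup>2 / 2))"
proof -
  have "(\<integral>r. iexp r \<partial>normal_law 0 \<sigma>) = char std_normal_distribution \<sigma>"
    unfolding normal_law_eq_distr[OF assms] char_def by (subst integral_distr) auto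
  then show ?thesis by (simp add: char_std_normal_distribution)
qed

text \<open>The Cramer-Wold device: the characteristic function of Z at t is that of the scalar t
  \<bullet> Z at 1, which the definition prescribes. Writing the form of \<Sigma> as a sum of
  squares exhibits a \<open>gauss_law\<close> with the same characteristic function.\<close>

lemma centered_gaussian_vector_law:
  fixes Z :: "'a \<Rightarrow> real ^ 'p::finite"
  assumes "prob_space P" and Z: "centered_gaussian_vector P Z \<Sigma>"
  obtains v :: "real ^ 'p \<Rightarrow> real ^ 'p" where "distr P borel Z = gauss_law (map v basis_list)"
    and "\<And>t. t \<bullet> (\<Sigma> *v t) = (\<Sum>b\<in>Basis. (t \<bullet> v b)\<^sup>2)"
proof -
  interpret prob_space P by fact
  have [measurable]: "Z \<in> borel_measurable P" and sym: "transpose \<Sigma> = \<Sigma>"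
    and psd: "0 \<le> t \<bullet> (\<Sigma> *v t)"
    and law: "distr P borel (\<lambda>\<omega>. t \<bullet> Z \<omega>) = normal_law 0 (sqrt (t \<bullet> (\<Sigma> *v t)))" for t
    using Z unfolding centered_gaussian_vector_def by blast+
  have "s \<bullet> (\<Sigma> *v t) = (\<Sigma> *v s) \<bullet> t" for s t
    using dot_lmul_matrix[of s \<Sigma> t] sym by (metis transpose_matrix_vector)
  then obtain v :: "real ^ 'p \<Rightarrow> real ^ 'p" where v: "\<And>t. t \<bullet> (\<Sigma> *v t) = (\<Sum>b\<in>Basis. (t \<bullet> v b)\<^sup>2)"
    using psd_sum_of_squares[of "(*v) \<Sigma>"] psd by (metis matrix_vector_mul_linear)
  have "distr P borel Z = gauss_law (map v basis_list)"
  proof (rule euclidean_char_unique)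
    fix t
    have "(\<integral>x. iexp (t \<bullet> x) \<partial>distr P borel Z) = (\<integral>\<omega>. iexp (t \<bullet> Z \<omega>) \<partial>P)"
      by (rule integral_distr) auto
    also have "\<dots> = (\<integral>r. iexp r \<partial>distr P borel (\<lambda>\<omega>. t \<bullet> Z \<omega>))"
      by (rule integral_distr[symmetric]) auto
    also have "\<dots> = (\<integral>x. iexp (t \<bullet> x) \<partial>gauss_law (map v basis_list))"
      unfolding law gauss_law_char using psd[of t]
      by (subst normal_law_char) (auto simp: v comp_def sum_list_basis_list)
    finally show "(\<integral>x. iexp (t \<bullet> x) \<partial>distr P borel Z) = (\<integral>x. iexp (t \<bullet> x) \<partial>gauss_law (map v basis_list))" .
  qed (auto simp: prob_space_gauss_law intro: prob_space_distr)
  then show ?thesis using v by (rule that)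
qed

section \<open>Facets of a Gaussian polyhedron\<close>

lemma std_normal_measure_singleton [simp]: "measure std_normal_distribution {x} = 0"
proof -
  have "cdf std_normal_distribution = \<Phi>" by (simp add: fun_eq_iff cdf_def2 std_normal_cdf_def cdf_def)
  then show ?thesis using std_normal.isCont_cdf[of x] isCont_Phi by simp
qed

lemma std_normal_measure_greaterThan: "measure std_normal_distribution {a<..} = 1 - \<Phi> a"
proof -
  have "{a<..} = space std_normal_distribution - {..a}" by auto
  then show ?thesis
    unfolding std_normal_cdf_def using std_normal.prob_compl[of "{..a}"] by simp
qed

lemma std_normal_measure_Ico:
  assumes "a \<le> b" shows "measure std_normal_distribution {a..<b} = \<Phi> b - \<Phi> a"
proof -
  have "measure std_normal_distribution {..<x} = \<Phi> x" for x
  proof -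
    have "measure std_normal_distribution ({..x} - {x}) = measure std_normal_distribution {..x} - measure std_normal_distribution {x}"
      by (rule std_normal.finite_measure_Diff) auto
    moreover have "{..x} - {x} = {..<x}" by auto
    ultimately show ?thesis by (simp add: std_normal_cdf_def)
  qed
  moreover have "{a..<b} = {..<b} - {..<a}" by auto
  moreover have "measure std_normal_distribution ({..<b} - {..<a}) = measure std_normal_distribution {..<b} - measure std_normal_distribution {..<a}"
    using assms by (intro std_normal.finite_measure_Diff) auto
  ultimately show ?thesis by simp
qed

text \<open>Independence of the component along u and the orthogonal one. By Pythagoras, u followed
  by the projected basis vectors has the quadratic form of the basis itself; this list thus
  represents the standard law with u as a separate coordinate.\<close>

lemma std_gauss_orthogonal_split:
  fixes u :: "'a::euclidean_space"
  assumes "norm u = 1" and [measurable]: "B \<in> sets borel" "J \<in> sets borel"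
  shows "measure (gauss_law basis_list) {x. x - (u \<bullet> x) *\<^sub>R u \<in> B \<and> u \<bullet> x \<in> J}
    = measure (gauss_law basis_list) {x. x - (u \<bullet> x) *\<^sub>R u \<in> B} * measure std_normal_distribution J"
proof -
  interpret G: prob_space "gauss_law (basis_list :: 'a list)" by (rule prob_space_gauss_law)
  define \<pi> where "\<pi> = (\<lambda>x. x - (u \<bullet> x) *\<^sub>R u)"
  have uu: "u \<bullet> u = 1" using assms(1) by (simp add: norm_eq_1)
  have \<pi>: "linear \<pi>"
    unfolding \<pi>_def by (auto intro!: linearI simp: algebra_simps inner_add_right)
  have [measurable]: "\<pi> \<in> borel_measurable borel" unfolding \<pi>_def by measurable
  have u\<pi>: "u \<bullet> \<pi> x = 0" and \<pi>u: "\<pi> (\<pi> x + z *\<^sub>R u) = \<pi> x" for x z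
    by (simp_all add: \<pi>_def inner_diff_right inner_add_right uu)
  have law: "gauss_law basis_list = gauss_law (u # map \<pi> basis_list)"
  proof (rule gauss_law_eqI)
    fix t
    have "(\<Sum>w\<leftarrow>u # map \<pi> basis_list. (t \<bullet> w)\<^sup>2) = (t \<bullet> u)\<^sup>2 + (\<Sum>b\<in>Basis. (t \<bullet> \<pi> b)\<^sup>2)"
      by (simp add: comp_def sum_list_basis_list)
    also have "(\<Sum>b\<in>Basis. (t \<bullet> \<pi> b)\<^sup>2) = (\<Sum>b\<in>Basis. (\<pi> t \<bullet> b)\<^sup>2)"
      by (intro sum.cong refl) (simp add: \<pi>_def inner_diff_left inner_diff_right inner_commute mult.commute)
    also have "\<dots> = \<pi> t \<bullet> \<pi> t" by (simp add: sum_Basis_inner_square power2_norm_eq_inner)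
    also have "\<dots> = t \<bullet> t - (t \<bullet> u)\<^sup>2"
      by (simp add: \<pi>_def inner_diff_left inner_diff_right uu inner_commute power2_eq_square)
    finally show "(\<Sum>w\<leftarrow>basis_list. (t \<bullet> w)\<^sup>2) = (\<Sum>w\<leftarrow>u # map \<pi> basis_list. (t \<bullet> w)\<^sup>2)"
      by (simp add: sum_list_basis_list sum_Basis_inner_square power2_norm_eq_inner)
  qed
  let ?E = "{x. \<pi> x \<in> B \<and> u \<bullet> x \<in> J}"
  have [measurable]: "?E \<in> sets borel" by measurable
  have "measure (gauss_law basis_list) ?E = (\<integral>x. indicator ?E x \<partial>gauss_law (u # map \<pi> basis_list))"
    unfolding law by simp
  also have "\<dots> = (\<integral>x. \<integral>z. indicator ?E (x + z *\<^sub>R u) \<partial>std_normal_distribution \<partial>gauss_law (map \<pi> basis_list))"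
    by (rule integral_gauss_law_Cons[where B=1]) (auto simp: indicator_def)
  also have "\<dots> = (\<integral>x. \<integral>z. indicator ?E (\<pi> x + z *\<^sub>R u) \<partial>std_normal_distribution \<partial>gauss_law basis_list)"
    unfolding distr_gauss_law_linear[OF \<pi>, symmetric] by (rule integral_distr) measurable
  also have "\<dots> = (\<integral>x. \<integral>z. indicator {x. \<pi> x \<in> B} x * indicator J z \<partial>std_normal_distribution \<partial>gauss_law basis_list)"
    by (intro Bochner_Integration.integral_cong refl)
      (simp add: \<pi>u inner_add_right u\<pi> uu indicator_def)
  also have "\<dots> = measure (gauss_law basis_list) {x. \<pi> x \<in> B} * measure std_normal_distribution J"
    by simp
  finally show ?thesis by (simp add: \<pi>_def)
qed

text \<open>Half of the Gaussian exponent is given up to absorb the factor d, through d \<le> 1 +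
  d^2 / 4 \<le> exp (d^2 / 4).\<close>

lemma phi_times_arg_le:
  assumes "0 \<le> d" shows "d * \<phi> d \<le> exp (- d\<^sup>2 / 4)"
proof -
  have "d \<le> 1 + d\<^sup>2 / 4" using zero_le_power2[of "d / 2 - 1"] by (simp add: power2_eq_square field_simps)
  also have "\<dots> \<le> exp (d\<^sup>2 / 4)" by (rule exp_ge_add_one_self)
  finally have "d * exp (- d\<^sup>2 / 2) \<le> exp (d\<^sup>2 / 4) * exp (- d\<^sup>2 / 2)" by (rule mult_right_mono) simp
  also have "\<dots> = exp (- d\<^sup>2 / 4)" by (simp add: exp_add[symmetric])
  finally have 1: "d * exp (- d\<^sup>2 / 2) \<le> exp (- d\<^sup>2 / 4)" .
  have "1 \<le> sqrt (2 * pi)" using pi_gt3 by simp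
  then have "1 / sqrt (2 * pi) \<le> 1" by simp
  then have "1 / sqrt (2 * pi) * (d * exp (- d\<^sup>2 / 2)) \<le> 1 * (d * exp (- d\<^sup>2 / 2))"
    using assms by (intro mult_right_mono) auto
  with 1 show ?thesis by (simp add: std_normal_density_def mult_ac)
qed

text \<open>The facet of \<open>{x. \<forall>w\<in>S. w \<bullet> x \<le> t}\<close> normal to \<open>v\<close>, projected onto the hyperplane
  orthogonal to \<open>v\<close> and relaxed by \<open>\<eta>\<close>.\<close>

definition facet :: "'a::euclidean_space set \<Rightarrow> real \<Rightarrow> 'a \<Rightarrow> real \<Rightarrow> 'a set" where
  "facet S t v \<eta> = {y. \<forall>w\<in>S. w \<bullet> (y + (t / norm v) *\<^sub>R sgn v) \<le> t + \<eta>}"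

text \<open>The event restricts only the component orthogonal to v; for nonzero v this is the
  Gaussian probability of the projected facet in its own hyperplane, expressed in the full
  space.\<close>

definition facet_prob :: "'a::euclidean_space set \<Rightarrow> real \<Rightarrow> 'a \<Rightarrow> real \<Rightarrow> real" where
  "facet_prob S t v \<eta> = measure (gauss_law basis_list) {x. x - (sgn v \<bullet> x) *\<^sub>R sgn v \<in> facet S t v \<eta>}"

lemma facet_measurable [measurable]: "facet S t v \<eta> \<in> sets borel"
proof -
  have "facet S t v \<eta> = (\<Inter>w\<in>S. {y. w \<bullet> (y + (t / norm v) *\<^sub>R sgn v) \<le> t + \<eta>})"
    by (auto simp: facet_def)
  also have "closed \<dots>"
    by (intro closed_INT ballI closed_Collect_le continuous_intros)
  finally show ?thesis by simp
qed

lemma facet_mono: "\<eta> \<le> \<eta>' \<Longrightarrow> facet S t v \<eta> \<subseteq> facet S t v \<eta>'"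
  unfolding facet_def by (intro Collect_mono impI ballI) (meson add_left_mono order_trans)

lemma facet_prob_bounds: "0 \<le> facet_prob S t v \<eta>" "facet_prob S t v \<eta> \<le> 1"
  using prob_space.prob_le_1[OF prob_space_gauss_law] by (auto simp: facet_prob_def)

lemma facet_prob_LIMSEQ:
  assumes "0 \<le> c"
  shows "(\<lambda>n. facet_prob S t v (c / real (Suc n))) \<longlonglongrightarrow> facet_prob S t v 0"
proof -
  interpret G: prob_space "gauss_law (basis_list :: 'a list)" by (rule prob_space_gauss_law)
  let ?A = "\<lambda>\<eta>. {x :: 'a. x - (sgn v \<bullet> x) *\<^sub>R sgn v \<in> facet S t v \<eta>}"
  have [measurable]: "?A \<eta> \<in> sets borel" for \<eta> by measurable
  have "(\<lambda>n. measure (gauss_law basis_list) (?A (c / real (Suc n)))) \<longlonglongrightarrow>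
      measure (gauss_law basis_list) (\<Inter>n. ?A (c / real (Suc n)))"
  proof (rule G.finite_Lim_measure_decseq)
    show "decseq (\<lambda>n. ?A (c / real (Suc n)))"
    proof (rule decseq_SucI, rule subsetI)
      fix n x assume "x \<in> ?A (c / real (Suc (Suc n)))"
      moreover have "c / real (Suc (Suc n)) \<le> c / real (Suc n)"
        using assms by (intro divide_left_mono) auto
      ultimately show "x \<in> ?A (c / real (Suc n))"
        using facet_mono by blast
    qed
  qed auto
  also have "(\<Inter>n. ?A (c / real (Suc n))) = ?A 0"
  proof (intro equalityI subsetI)
    fix x assume x: "x \<in> (\<Inter>n. ?A (c / real (Suc n)))"
    have "w \<bullet> (x - (sgn v \<bullet> x) *\<^sub>R sgn v + (t / norm v) *\<^sub>R sgn v) \<le> t + 0" if "w \<in> S" for w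
    proof (rule tendsto_lowerbound)
      have "(\<lambda>n. c * inverse (real (Suc n))) \<longlonglongrightarrow> c * 0"
        by (intro tendsto_intros LIMSEQ_inverse_real_of_nat)
      then have "(\<lambda>n. c / real (Suc n)) \<longlonglongrightarrow> 0" by (simp add: divide_inverse)
      then show "(\<lambda>n. t + c / real (Suc n)) \<longlonglongrightarrow> t + 0" by (intro tendsto_intros)
      show "\<forall>\<^sub>F n in sequentially. w \<bullet> (x - (sgn v \<bullet> x) *\<^sub>R sgn v + (t / norm v) *\<^sub>R sgn v) \<le> t + c / real (Suc n)"
        using x that unfolding facet_def by (intro always_eventually allI) blast
    qed simp
    then show "x \<in> ?A 0" by (simp add: facet_def)
  next
    fix x assume x: "x \<in> ?A 0"
    have "0 \<le> c / real (Suc n)" for n using assms by simp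
    from facet_mono[OF this] x show "x \<in> (\<Inter>n. ?A (c / real (Suc n)))" by blast
  qed
  finally show ?thesis by (simp add: facet_prob_def)
qed

section \<open>Shells, facets and prisms of a polyhedron\<close>

context
  fixes S :: "'a::euclidean_space set" and t :: real
  assumes fin: "finite S" and t: "0 < t"
begin

text \<open>Assign x to a vector v with the largest product; t > 0 excludes v = 0. Sliding x along
  \<open>sgn v\<close> down to level t moves it by at most \<delta> / norm v, which changes w
  \<bullet> x by at most norm w * \<delta> / norm v. The sum over \<open>S\<close> makes the
  relaxation independent of w.\<close>

lemma shell_subset_facets:
  assumes "0 < \<delta>"
  shows "{x. (\<forall>w\<in>S. w \<bullet> x < t + \<delta>) \<and> (\<exists>w\<in>S. t \<le> w \<bullet> x)} \<subseteq>
    (\<Union>v\<in>S - {0}. {x. x - (sgn v \<bullet> x) *\<^sub>R sgn v \<in> facet S t v ((1 + (\<Sum>w\<in>S. norm w) / norm v) * \<delta>) \<and>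
      sgn v \<bullet> x \<in> {t / norm v..<(t + \<delta>) / norm v}})"
proof (rule subsetI)
  fix x assume "x \<in> {x. (\<forall>w\<in>S. w \<bullet> x < t + \<delta>) \<and> (\<exists>w\<in>S. t \<le> w \<bullet> x)}"
  then have lt: "\<And>w. w \<in> S \<Longrightarrow> w \<bullet> x < t + \<delta>" and ex: "\<exists>w\<in>S. t \<le> w \<bullet> x" by auto
  then have ne: "S \<noteq> {}" by auto
  obtain v where v: "v \<in> S" "Max ((\<lambda>w. w \<bullet> x) ` S) = v \<bullet> x"
  proof -
    have "Max ((\<lambda>w. w \<bullet> x) ` S) \<in> (\<lambda>w. w \<bullet> x) ` S" using fin ne by (intro Max_in) auto
    then show ?thesis using that by blast
  qed
  have max: "w \<bullet> x \<le> v \<bullet> x" if "w \<in> S" for w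
    using Max_ge[of "(\<lambda>w. w \<bullet> x) ` S" "w \<bullet> x"] fin that v(2) by simp
  have vt: "t \<le> v \<bullet> x" using ex max by force
  then have "v \<noteq> 0" using t by auto
  then have nv: "0 < norm v" by simp
  have sv: "sgn v \<bullet> x = (v \<bullet> x) / norm v" by (simp add: sgn_div_norm divide_inverse_commute)
  have slab: "sgn v \<bullet> x \<in> {t / norm v..<(t + \<delta>) / norm v}"
    using vt lt[OF v(1)] nv by (simp add: sv divide_right_mono divide_strict_right_mono)
  have "w \<bullet> (x - (sgn v \<bullet> x) *\<^sub>R sgn v + (t / norm v) *\<^sub>R sgn v) \<le> t + (1 + (\<Sum>w\<in>S. norm w) / norm v) * \<delta>"
    if "w \<in> S" for w
  proof -
    let ?r = "sgn v \<bullet> x - t / norm v"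
    have r: "0 \<le> ?r" "?r \<le> \<delta> / norm v" using slab by (auto simp: add_divide_distrib)
    have "- (?r * (w \<bullet> sgn v)) \<le> \<bar>?r * (w \<bullet> sgn v)\<bar>" by (rule abs_ge_minus_self)
    also have "\<dots> = ?r * \<bar>w \<bullet> sgn v\<bar>" using r(1) by (simp add: abs_mult)
    also have "\<dots> \<le> (\<delta> / norm v) * (\<Sum>w\<in>S. norm w)"
    proof (rule mult_mono[OF r(2)])
      have "\<bar>w \<bullet> sgn v\<bar> \<le> norm w * norm (sgn v)" by (rule Cauchy_Schwarz_ineq2)
      also have "\<dots> = norm w" using \<open>v \<noteq> 0\<close> by (simp add: norm_sgn)
      also have "\<dots> \<le> (\<Sum>w\<in>S. norm w)" using fin that by (intro member_le_sum) auto
      finally show "\<bar>w \<bullet> sgn v\<bar> \<le> (\<Sum>w\<in>S. norm w)" .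
    qed (use assms in auto)
    finally have "- (?r * (w \<bullet> sgn v)) \<le> (\<Sum>w\<in>S. norm w) / norm v * \<delta>" by (simp add: mult_ac)
    moreover have "w \<bullet> (x - (sgn v \<bullet> x) *\<^sub>R sgn v + (t / norm v) *\<^sub>R sgn v) = w \<bullet> x - ?r * (w \<bullet> sgn v)"
      by (simp add: inner_diff_right inner_add_right algebra_simps)
    moreover have "w \<bullet> x \<le> t + \<delta>" using lt[OF that] by simp
    ultimately show ?thesis by (simp add: distrib_right)
  qed
  then have "x - (sgn v \<bullet> x) *\<^sub>R sgn v \<in> facet S t v ((1 + (\<Sum>w\<in>S. norm w) / norm v) * \<delta>)"
    by (simp add: facet_def)
  with slab v(1) \<open>v \<noteq> 0\<close>
  show "x \<in> (\<Union>v\<in>S - {0}. {x. x - (sgn v \<bullet> x) *\<^sub>R sgn v \<in> facet S t v ((1 + (\<Sum>w\<in>S. norm w) / norm v) * \<delta>) \<and>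
      sgn v \<bullet> x \<in> {t / norm v..<(t + \<delta>) / norm v}})"
    by blast
qed

lemma shell_prob_le:
  assumes "0 < \<delta>"
  shows "measure (gauss_law basis_list) {x. (\<forall>w\<in>S. w \<bullet> x < t + \<delta>) \<and> (\<exists>w\<in>S. t \<le> w \<bullet> x)} \<le>
    (\<Sum>v\<in>S - {0}. facet_prob S t v ((1 + (\<Sum>w\<in>S. norm w) / norm v) * \<delta>) *
      (\<Phi> ((t + \<delta>) / norm v) - \<Phi> (t / norm v)))"
proof -
  interpret G: prob_space "gauss_law (basis_list :: 'a list)" by (rule prob_space_gauss_law)
  let ?E = "\<lambda>v. {x. x - (sgn v \<bullet> x) *\<^sub>R sgn v \<in> facet S t v ((1 + (\<Sum>w\<in>S. norm w) / norm v) * \<delta>) \<and>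
      sgn v \<bullet> x \<in> {t / norm v..<(t + \<delta>) / norm v}}"
  have [measurable]: "?E v \<in> sets borel" for v by measurable
  have "measure (gauss_law basis_list) {x. (\<forall>w\<in>S. w \<bullet> x < t + \<delta>) \<and> (\<exists>w\<in>S. t \<le> w \<bullet> x)}
      \<le> measure (gauss_law basis_list) (\<Union>v\<in>S - {0}. ?E v)"
    by (rule G.finite_measure_mono[OF shell_subset_facets[OF assms]]) (use fin in auto)
  also have "\<dots> \<le> (\<Sum>v\<in>S - {0}. measure (gauss_law basis_list) (?E v))"
    by (rule G.finite_measure_subadditive_finite) (use fin in auto)
  also have "\<dots> = (\<Sum>v\<in>S - {0}. facet_prob S t v ((1 + (\<Sum>w\<in>S. norm w) / norm v) * \<delta>) *
      (\<Phi> ((t + \<delta>) / norm v) - \<Phi> (t / norm v)))"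
  proof (rule sum.cong[OF refl])
    fix v assume "v \<in> S - {0}"
    then have "norm (sgn v) = 1" by (simp add: norm_sgn)
    from std_gauss_orthogonal_split[OF this, of "facet S t v ((1 + (\<Sum>w\<in>S. norm w) / norm v) * \<delta>)"
      "{t / norm v..<(t + \<delta>) / norm v}"]
    show "measure (gauss_law basis_list) (?E v) =
      facet_prob S t v ((1 + (\<Sum>w\<in>S. norm w) / norm v) * \<delta>) * (\<Phi> ((t + \<delta>) / norm v) - \<Phi> (t / norm v))"
      using assms by (simp add: facet_prob_def std_normal_measure_Ico divide_right_mono)
  qed
  finally show ?thesis .
qed

text \<open>Divided by \<delta>, each slab probability tends to a derivative of \<Phi>, while the
  relaxed facets shrink to the true ones. Overlaps between the slabs are harmless for an upper
  bound.\<close>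

lemma shell_density_le:
  assumes "((\<lambda>\<delta>. measure (gauss_law basis_list) {x. (\<forall>w\<in>S. w \<bullet> x < t + \<delta>) \<and> (\<exists>w\<in>S. t \<le> w \<bullet> x)} / \<delta>) \<longlongrightarrow> d) (at_right 0)"
  shows "d \<le> (\<Sum>v\<in>S - {0}. facet_prob S t v 0 * (\<phi> (t / norm v) / norm v))"
proof -
  let ?m = "\<lambda>\<delta>. measure (gauss_law basis_list) {x. (\<forall>w\<in>S. w \<bullet> x < t + \<delta>) \<and> (\<exists>w\<in>S. t \<le> w \<bullet> x)}"
  let ?c = "\<lambda>v. 1 + (\<Sum>w\<in>S. norm w) / norm v"
  have c: "0 \<le> ?c v" for v by (intro add_nonneg_nonneg divide_nonneg_nonneg sum_nonneg) auto
  define X where "X = (\<lambda>n. 1 / real (Suc n))"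
  have X0: "0 < X n" for n by (simp add: X_def)
  have Xne: "X n \<noteq> 0" for n by (simp add: X_def)
  have X: "X \<longlonglongrightarrow> 0" using LIMSEQ_inverse_real_of_nat by (simp add: X_def inverse_eq_divide)
  have "filterlim X (at_right 0) sequentially"
    using X X0 Xne by (simp add: filterlim_at)
  from filterlim_compose[OF assms this] have "(\<lambda>n. ?m (X n) / X n) \<longlonglongrightarrow> d" .
  moreover have "(\<lambda>n. \<Sum>v\<in>S - {0}. facet_prob S t v (?c v * X n) * ((\<Phi> ((t + X n) / norm v) - \<Phi> (t / norm v)) / X n))
      \<longlonglongrightarrow> (\<Sum>v\<in>S - {0}. facet_prob S t v 0 * (\<phi> (t / norm v) / norm v))"
  proof (intro tendsto_sum tendsto_mult)
    fix v assume "v \<in> S - {0}"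
    show "(\<lambda>n. facet_prob S t v (?c v * X n)) \<longlonglongrightarrow> facet_prob S t v 0"
      using facet_prob_LIMSEQ[OF c[of v], of S t v] by (simp add: X_def)
    have "((\<lambda>s. \<Phi> (s / norm v)) has_real_derivative \<phi> (t / norm v) * (1 / norm v)) (at t)"
      by (rule DERIV_chain2[OF Phi_deriv DERIV_cdivide[OF DERIV_ident]])
    then have "((\<lambda>h. (\<Phi> ((t + h) / norm v) - \<Phi> (t / norm v)) / h) \<longlongrightarrow> \<phi> (t / norm v) / norm v) (at 0)"
      by (simp add: DERIV_def)
    moreover have "filterlim X (at 0) sequentially"
      using X Xne by (simp add: filterlim_at)
    ultimately show "(\<lambda>n. (\<Phi> ((t + X n) / norm v) - \<Phi> (t / norm v)) / X n) \<longlonglongrightarrow> \<phi> (t / norm v) / norm v"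
      by (rule filterlim_compose)
  qed
  ultimately show ?thesis
  proof (rule LIMSEQ_le)
    have "?m (X n) / X n \<le>
      (\<Sum>v\<in>S - {0}. facet_prob S t v (?c v * X n) * (\<Phi> ((t + X n) / norm v) - \<Phi> (t / norm v))) / X n" for n
      by (rule divide_right_mono[OF shell_prob_le[OF X0]]) (use X0[of n] in simp)
    then show "\<exists>N. \<forall>n\<ge>N. ?m (X n) / X n \<le>
      (\<Sum>v\<in>S - {0}. facet_prob S t v (?c v * X n) * ((\<Phi> ((t + X n) / norm v) - \<Phi> (t / norm v)) / X n))"
      by (simp add: sum_divide_distrib)
  qed
qed

text \<open>The half-infinite prisms erected over the facets are pairwise disjoint: a point in the prism over
  a facet has its nearest point of the polyhedron on that facet.\<close>

lemma prisms_disjoint: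
  defines "Q \<equiv> \<lambda>v. {x. x - (sgn v \<bullet> x) *\<^sub>R sgn v \<in> facet S t v 0 \<and> sgn v \<bullet> x \<in> {t / norm v<..}}"
  shows "disjoint_family_on Q (S - {0})"
proof (unfold disjoint_family_on_def, intro ballI impI)
  fix v w assume vw: "v \<in> S - {0}" "w \<in> S - {0}" "v \<noteq> w"
  show "Q v \<inter> Q w = {}"
  proof (rule ccontr)
    assume "Q v \<inter> Q w \<noteq> {}"
    then obtain x where x: "x \<in> Q v" "x \<in> Q w" by blast
    define r where "r = (\<lambda>v. sgn v \<bullet> x - t / norm v)"
    define y where "y = (\<lambda>v. x - r v *\<^sub>R sgn v)"
    have yS: "\<And>a. a \<in> S \<Longrightarrow> a \<bullet> y b \<le> t" and r: "0 < r b" and yb: "b \<bullet> y b = t" if "b \<in> {v, w}" for b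
    proof -
      have "x \<in> Q b" and b0: "b \<noteq> 0" using x that vw by auto
      then show "a \<bullet> y b \<le> t" if "a \<in> S" for a
        using that by (simp add: Q_def facet_def y_def r_def algebra_simps inner_diff_right inner_add_right)
      show "0 < r b" using \<open>x \<in> Q b\<close> by (simp add: Q_def r_def)
      have "b \<bullet> sgn b = norm b" using b0 by (simp add: sgn_div_norm power2_norm_eq_inner[symmetric] power2_eq_square)
      moreover have "norm b * (sgn b \<bullet> x) = b \<bullet> x" using b0 by (simp add: sgn_div_norm)
      ultimately show "b \<bullet> y b = t" using b0 by (simp add: y_def r_def inner_diff_right algebra_simps)
    qed
    \<comment> \<open>The variational inequality for nearest points: \<open>y a\<close> maximizes
      the product with \<open>a\<close> over the polyhedron, and x - y a is a positive multiple of
      \<open>a\<close>.\<close>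
    have ineq: "(x - y a) \<bullet> (y b - y a) \<le> 0" if "a \<in> {v, w}" "b \<in> {v, w}" for a b
    proof -
      have aS: "a \<in> S" using that vw by auto
      have "(x - y a) \<bullet> (y b - y a) = (r a / norm a) * (a \<bullet> y b - a \<bullet> y a)"
      proof -
        have "x - y a = (r a / norm a) *\<^sub>R a" by (simp add: y_def sgn_div_norm divide_inverse)
        then show ?thesis by (simp add: inner_diff_right right_diff_distrib diff_divide_distrib)
      qed
      also have "\<dots> \<le> 0"
        using yS[OF that(2) aS] yb[OF that(1)] r[OF that(1)] by (intro mult_nonneg_nonpos) auto
      finally show ?thesis .
    qed
    \<comment> \<open>The two variational inequalities add up to the squared distance of the two
      feet.\<close>
    have "(y v - y w) \<bullet> (y v - y w) = (x - y v) \<bullet> (y w - y v) + (x - y w) \<bullet> (y v - y w)"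
      by (simp add: inner_diff_left inner_diff_right inner_commute)
    also have "\<dots> \<le> 0" using ineq[of v w] ineq[of w v] by simp
    finally have "y v = y w" by (metis inner_eq_zero_iff inner_ge_zero order_antisym right_minus_eq)
    \<comment> \<open>Equal feet give equal displacements and hence equal unit normals; as both
      hyperplanes belong to the same nonzero level t, the lengths of v and w agree too.\<close>
    then have eq: "r v *\<^sub>R sgn v = r w *\<^sub>R sgn w" by (simp add: y_def)
    then have "norm (r v *\<^sub>R sgn v) = norm (r w *\<^sub>R sgn w)" by simp
    then have "r v = r w" using vw r[of v] r[of w] by (simp add: norm_sgn)
    with eq r[of v] have sgn: "sgn v = sgn w" by auto
    have "norm v * (sgn v \<bullet> y v) = t" "norm w * (sgn w \<bullet> y w) = t"
      using yb[of v] yb[of w] vw by (simp_all add: sgn_div_norm)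
    then have "norm v * (sgn v \<bullet> y v) = norm w * (sgn v \<bullet> y v)" "sgn v \<bullet> y v \<noteq> 0"
      using sgn \<open>y v = y w\<close> t by auto
    then have "norm v = norm w" by simp
    moreover have "norm v *\<^sub>R sgn v = v" "norm w *\<^sub>R sgn w = w" using vw by (simp_all add: sgn_div_norm)
    ultimately show False using sgn vw(3) by metis
  qed
qed

text \<open>The prisms are disjoint and lie outside the polyhedron, and the orthogonal split factors
  the probability of each. At a median this is the budget of 1/2 against which the near facets are
  charged.\<close>

lemma sum_prisms_le:
  "(\<Sum>v\<in>S - {0}. facet_prob S t v 0 * (1 - \<Phi> (t / norm v))) \<le> 1 - measure (gauss_law basis_list) {x. \<forall>w\<in>S. w \<bullet> x \<le> t}"
proof -
  interpret G: prob_space "gauss_law (basis_list :: 'a list)" by (rule prob_space_gauss_law)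
  let ?Q = "\<lambda>v. {x. x - (sgn v \<bullet> x) *\<^sub>R sgn v \<in> facet S t v 0 \<and> sgn v \<bullet> x \<in> {t / norm v<..}}"
  let ?K = "{x. \<forall>w\<in>S. w \<bullet> x \<le> t}"
  have [measurable]: "?Q v \<in> sets borel" for v by measurable
  have K: "?K \<in> sets borel" using fin by measurable
  have "(\<Sum>v\<in>S - {0}. facet_prob S t v 0 * (1 - \<Phi> (t / norm v))) = (\<Sum>v\<in>S - {0}. measure (gauss_law basis_list) (?Q v))"
  proof (rule sum.cong[OF refl])
    fix v assume "v \<in> S - {0}"
    then have "norm (sgn v) = 1" by (simp add: norm_sgn)
    from std_gauss_orthogonal_split[OF this, of "facet S t v 0" "{t / norm v<..}"]
    show "facet_prob S t v 0 * (1 - \<Phi> (t / norm v)) = measure (gauss_law basis_list) (?Q v)"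
      by (simp add: facet_prob_def std_normal_measure_greaterThan)
  qed
  also have "\<dots> = measure (gauss_law basis_list) (\<Union>v\<in>S - {0}. ?Q v)"
    by (rule G.finite_measure_finite_Union[symmetric]) (use fin prisms_disjoint in auto)
  also have "\<dots> \<le> measure (gauss_law basis_list) (space (gauss_law (basis_list :: 'a list)) - ?K)"
  proof (rule G.finite_measure_mono)
    show "(\<Union>v\<in>S - {0}. ?Q v) \<subseteq> space (gauss_law basis_list) - ?K"
    proof
      fix x assume "x \<in> (\<Union>v\<in>S - {0}. ?Q v)"
      then obtain v where v: "v \<in> S" "v \<noteq> 0" "t / norm v < sgn v \<bullet> x" by auto
      then have "t < v \<bullet> x" by (simp add: sgn_div_norm field_simps)
      with v(1) show "x \<in> space (gauss_law basis_list) - ?K" by force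
    qed
  qed (use K in auto)
  also have "\<dots> = 1 - measure (gauss_law basis_list) ?K"
    using K by (subst G.prob_compl) auto
  finally show ?thesis .
qed

theorem shell_density_le_log:
  fixes p :: real
  assumes half: "1 / 2 \<le> measure (gauss_law basis_list) {x. \<forall>w\<in>S. w \<bullet> x \<le> t}"
    and d: "((\<lambda>\<delta>. measure (gauss_law basis_list) {x. (\<forall>w\<in>S. w \<bullet> x < t + \<delta>) \<and> (\<exists>w\<in>S. t \<le> w \<bullet> x)} / \<delta>) \<longlongrightarrow> d) (at_right 0)"
    and p: "real (card S) \<le> p" "3 \<le> p"
  shows "d \<le> 4 * ln p / t"
proof -
  let ?d = "\<lambda>v. t / norm v" and ?\<beta> = "\<lambda>v. facet_prob S t v 0"
  have lnp: "1 \<le> ln p"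
    using p(2) exp_le by (subst ln_ge_iff) auto
  \<comment> \<open>One bound serves both kinds of facet: near ones are charged to their prism, far
    ones to 1 / p, and the other summand is nonnegative. The left side is t times the contribution
    of the facet.\<close>
  have each: "?\<beta> v * (?d v * \<phi> (?d v)) \<le> (1 + 4 * ln p) * (?\<beta> v * (1 - \<Phi> (?d v))) + 1 / p" for v
  proof -
    have \<beta>: "0 \<le> ?\<beta> v" "?\<beta> v \<le> 1" by (rule facet_prob_bounds)+
    have dn: "0 \<le> ?d v" using t by simp
    have nn: "0 \<le> ?\<beta> v * (1 - \<Phi> (?d v))" using \<beta> by (simp add: less_imp_le)
    show ?thesis
    proof (cases "(?d v)\<^sup>2 \<le> 4 * ln p")
      case True
      have "?\<beta> v * (?d v * \<phi> (?d v)) \<le> ?\<beta> v * ((1 + (?d v)\<^sup>2) * (1 - \<Phi> (?d v)))"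
        by (intro mult_left_mono Mills_ratio_lower \<beta>)
      also have "\<dots> = (1 + (?d v)\<^sup>2) * (?\<beta> v * (1 - \<Phi> (?d v)))" by simp
      also have "\<dots> \<le> (1 + 4 * ln p) * (?\<beta> v * (1 - \<Phi> (?d v)))"
        using True by (intro mult_right_mono nn) simp
      finally show ?thesis using p(2) by (smt (verit) divide_nonneg_pos)
    next
      case False
      have "?\<beta> v * (?d v * \<phi> (?d v)) \<le> 1 * (?d v * \<phi> (?d v))"
        by (intro mult_right_mono mult_nonneg_nonneg \<beta> dn less_imp_le[OF phi_pos])
      also have "\<dots> \<le> exp (- (?d v)\<^sup>2 / 4)" using phi_times_arg_le[OF dn] by simp
      also have "\<dots> \<le> exp (- ln p)" using False by simp
      also have "\<dots> = 1 / p" using p(2) by (simp add: exp_minus inverse_eq_divide)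
      finally show ?thesis using nn lnp by (smt (verit) mult_nonneg_nonneg)
    qed
  qed
  have "t * d \<le> t * (\<Sum>v\<in>S - {0}. ?\<beta> v * (\<phi> (?d v) / norm v))"
    using shell_density_le[OF d] t by simp
  also have "\<dots> = (\<Sum>v\<in>S - {0}. ?\<beta> v * (?d v * \<phi> (?d v)))"
    by (simp add: sum_distrib_left mult_ac)
  also have "\<dots> \<le> (\<Sum>v\<in>S - {0}. (1 + 4 * ln p) * (?\<beta> v * (1 - \<Phi> (?d v))) + 1 / p)"
    by (intro sum_mono each)
  also have "\<dots> = (1 + 4 * ln p) * (\<Sum>v\<in>S - {0}. ?\<beta> v * (1 - \<Phi> (?d v))) + real (card (S - {0})) / p"
    by (simp add: sum.distrib sum_distrib_left)
  also have "\<dots> \<le> (1 + 4 * ln p) * (1 / 2) + 1"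
  proof (intro add_mono mult_left_mono)
    show "(\<Sum>v\<in>S - {0}. ?\<beta> v * (1 - \<Phi> (?d v))) \<le> 1 / 2" using sum_prisms_le half by linarith
    have "real (card (S - {0})) \<le> p" using p(1) card_Diff1_le[of S 0] by linarith
    then show "real (card (S - {0})) / p \<le> 1" using p(2) by simp
  qed (use lnp in simp)
  \<comment> \<open>The inequality (1 + 4 ln p) / 2 + 1 \<le> 4 ln p amounts to ln p \<ge> 3/4; here
    p \<ge> 3 > e gives ln p \<ge> 1.\<close>
  also have "\<dots> \<le> 4 * ln p" using lnp by (simp add: field_simps)
  finally show ?thesis using t by (simp add: field_simps)
qed

end

section \<open>Maximum of a Gaussian vector\<close>

lemma concave_on_slopes:
  fixes \<psi> :: "real \<Rightarrow> real"
  assumes "concave_on I \<psi>" "x \<in> I" "z \<in> I" "x < y" "y < z"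
  shows "(\<psi> z - \<psi> y) / (z - y) \<le> (\<psi> z - \<psi> x) / (z - x)"
    and "(\<psi> z - \<psi> x) / (z - x) \<le> (\<psi> y - \<psi> x) / (y - x)"
proof -
  define u v where "u = (z - y) / (z - x)" and "v = (y - x) / (z - x)"
  have "0 \<le> u" "0 \<le> v" "u + v = 1"
    using assms by (auto simp: u_def v_def add_divide_distrib[symmetric])
  moreover have "u *\<^sub>R x + v *\<^sub>R z = y"
  proof -
    have "u * x + v * z = ((z - y) * x + (y - x) * z) / (z - x)"
      by (simp add: u_def v_def add_divide_distrib)
    also have "(z - y) * x + (y - x) * z = y * (z - x)" by (simp add: algebra_simps)
    finally show ?thesis using assms by simp
  qed
  ultimately have "u * \<psi> x + v * \<psi> z \<le> \<psi> y"
    using assms(1-3) unfolding concave_on_iff by metis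
  then have "(z - x) * (u * \<psi> x + v * \<psi> z) \<le> (z - x) * \<psi> y"
    using assms by (intro mult_left_mono) auto
  moreover have "(z - x) * (u * \<psi> x + v * \<psi> z) = (z - y) * \<psi> x + (y - x) * \<psi> z"
    using assms by (simp add: u_def v_def distrib_left)
  ultimately have "(z - y) * \<psi> x + (y - x) * \<psi> z \<le> (z - x) * \<psi> y" by simp
  then have "(\<psi> z - \<psi> y) * (z - x) \<le> (\<psi> z - \<psi> x) * (z - y)"
    and "(\<psi> z - \<psi> x) * (y - x) \<le> (\<psi> y - \<psi> x) * (z - x)"
    by (simp_all add: algebra_simps)
  then show "(\<psi> z - \<psi> y) / (z - y) \<le> (\<psi> z - \<psi> x) / (z - x)"
    and "(\<psi> z - \<psi> x) / (z - x) \<le> (\<psi> y - \<psi> x) / (y - x)"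
    using assms by (simp_all add: pos_divide_le_eq pos_le_divide_eq)
qed

text \<open>Secant slopes to the right of t grow as y decreases to t and stay below the secant slope
  from a, which is available because a < t. The right derivative is therefore their
  supremum.\<close>

lemma concave_on_right_slope:
  fixes \<psi> :: "real \<Rightarrow> real"
  assumes \<psi>: "concave_on {a..} \<psi>" and "a < t"
  obtains D where "((\<lambda>y. (\<psi> y - \<psi> t) / (y - t)) \<longlongrightarrow> D) (at_right t)"
    and "\<And>y. t < y \<Longrightarrow> (\<psi> y - \<psi> t) / (y - t) \<le> D"
    and "\<And>x. a \<le> x \<Longrightarrow> x < t \<Longrightarrow> D \<le> (\<psi> t - \<psi> x) / (t - x)"
proof -
  define q where "q = (\<lambda>y. (\<psi> y - \<psi> t) / (y - t))"
  define D where "D = (SUP y\<in>{t<..}. q y)"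
  have le: "q y \<le> (\<psi> t - \<psi> x) / (t - x)" if "a \<le> x" "x < t" "t < y" for x y
    using concave_on_slopes[OF \<psi>, of x y t] that by (simp add: q_def)
  have anti: "q z \<le> q y" if "t < y" "y < z" for y z
    using concave_on_slopes(2)[OF \<psi>, of t z y] that \<open>a < t\<close> by (simp add: q_def)
  have bdd: "bdd_above (q ` {t<..})"
    using le[of a] \<open>a < t\<close> by (intro bdd_aboveI2) auto
  have upper: "q y \<le> D" if "t < y" for y
    unfolding D_def using that by (intro cSUP_upper bdd) auto
  have "(q \<longlongrightarrow> D) (at_right t)"
  proof (rule order_tendstoI)
    fix c assume "c < D"
    then obtain y where y: "t < y" "c < q y"
      unfolding D_def using less_cSUP_iff[OF _ bdd] by auto
    show "\<forall>\<^sub>F z in at_right t. c < q z"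
      using eventually_at_right_real[OF y(1)]
    proof eventually_elim
      case (elim z)
      then show ?case using anti[of z y] y(2) by auto
    qed
  next
    fix c assume "D < c"
    show "\<forall>\<^sub>F z in at_right t. q z < c"
      using eventually_at_right_less[of t]
      by eventually_elim (use upper \<open>D < c\<close> in \<open>auto intro: le_less_trans\<close>)
  qed
  moreover have "D \<le> (\<psi> t - \<psi> x) / (t - x)" if "a \<le> x" "x < t" for x
    unfolding D_def by (rule cSUP_least) (use le that in auto)
  ultimately show ?thesis using upper that unfolding q_def by blast
qed

text \<open>The mass of the unit interval next to |u| suffices, by the mean value theorem. The shift
  by 1 is affordable in \<open>gaussian_tail_slope_bound\<close>, where only the linear rate of the
  argument matters.\<close>

lemma Phi_upper_tail_ge: "\<phi> (\<bar>u\<bar> + 1) \<le> 1 - \<Phi> u"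
proof -
  obtain z where z: "\<bar>u\<bar> < z" "z < \<bar>u\<bar> + 1" "\<Phi> (\<bar>u\<bar> + 1) - \<Phi> \<bar>u\<bar> = (\<bar>u\<bar> + 1 - \<bar>u\<bar>) * \<phi> z"
    using MVT2[of "\<bar>u\<bar>" "\<bar>u\<bar> + 1" \<Phi> \<phi>] Phi_deriv by auto
  have "\<phi> (\<bar>u\<bar> + 1) \<le> \<phi> z" using z by (intro phi_abs_mono) auto
  also have "\<dots> = \<Phi> (\<bar>u\<bar> + 1) - \<Phi> \<bar>u\<bar>" using z(3) by simp
  also have "\<dots> \<le> 1 - \<Phi> u"
  proof -
    have "\<Phi> u \<le> \<Phi> \<bar>u\<bar>" by simp
    then show ?thesis using Phi_lt_1[of "\<bar>u\<bar> + 1"] by linarith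
  qed
  finally show ?thesis .
qed

text \<open>For k below 1 / \<sigma> the left side decays too slowly. At the point where t /
  \<sigma> exceeds the argument C + k t by exactly X, comparison of the exponentials gives exp (X^2
  / 2) \<le> p, which fails for large X.\<close>

lemma gaussian_tail_slope_bound:
  assumes "0 < \<sigma>" "0 \<le> k" and p: "0 \<le> p"
    and tail: "\<And>t. t0 \<le> t \<Longrightarrow> 1 - \<Phi> (c + k * t) \<le> p * \<phi> (t / \<sigma>)"
  shows "1 / \<sigma> \<le> k"
proof (rule ccontr)
  assume "\<not> 1 / \<sigma> \<le> k"
  then have d: "0 < 1 / \<sigma> - k" by simp
  \<comment> \<open>C absorbs the unit shift of \<open>Phi_upper_tail_ge\<close>. In X, the part 2 p
    + 1 makes 1 + X^2 / 2 exceed p, and the last summand places t beyond t0.\<close>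
  define C where "C = \<bar>c\<bar> + 1"
  define X where "X = 2 * p + 1 + \<bar>t0\<bar> / \<sigma>"
  define t where "t = (X + C) / (1 / \<sigma> - k)"
  have X: "2 * p + 1 \<le> X" using assms by (simp add: X_def)
  then have "0 < X" using p by linarith
  have "0 < C" by (simp add: C_def)
  have t0: "\<bar>t0\<bar> \<le> t"
  proof -
    have "\<bar>t0\<bar> * (1 / \<sigma> - k) \<le> \<bar>t0\<bar> * (1 / \<sigma>)" using \<open>0 \<le> k\<close> by (intro mult_left_mono) auto
    also have "\<dots> \<le> X + C" using \<open>0 < C\<close> p by (simp add: X_def)
    finally show ?thesis using d by (simp add: t_def le_divide_eq)
  qed
  then have "0 \<le> t" by linarith
  have diff: "t / \<sigma> - (C + k * t) = X"
  proof -
    have "t * (1 / \<sigma> - k) = X + C" using d by (simp add: t_def)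
    then show ?thesis by (simp add: algebra_simps)
  qed
  have "0 \<le> C + k * t" using \<open>0 < C\<close> \<open>0 \<le> k\<close> \<open>0 \<le> t\<close> by simp
  have "X\<^sup>2 \<le> X * (t / \<sigma> + (C + k * t))"
    unfolding power2_eq_square using diff \<open>0 \<le> C + k * t\<close> \<open>0 < X\<close> by (intro mult_left_mono) auto
  also have "\<dots> = (t / \<sigma>)\<^sup>2 - (C + k * t)\<^sup>2"
    by (simp add: diff[symmetric] power2_eq_square algebra_simps)
  finally have sq: "X\<^sup>2 \<le> (t / \<sigma>)\<^sup>2 - (C + k * t)\<^sup>2" .
  have "\<phi> (C + k * t) \<le> \<phi> (\<bar>c + k * t\<bar> + 1)"
  proof (rule phi_abs_mono)
    have "\<bar>c + k * t\<bar> \<le> \<bar>c\<bar> + k * t" using \<open>0 \<le> k\<close> \<open>0 \<le> t\<close> by (simp add: abs_if)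
    then show "\<bar>\<bar>c + k * t\<bar> + 1\<bar> \<le> \<bar>C + k * t\<bar>" by (simp add: C_def)
  qed
  also have "\<dots> \<le> 1 - \<Phi> (c + k * t)" by (rule Phi_upper_tail_ge)
  also have "\<dots> \<le> p * \<phi> (t / \<sigma>)" using tail t0 by simp
  finally have "exp (- (C + k * t)\<^sup>2 / 2) \<le> p * exp (- (t / \<sigma>)\<^sup>2 / 2)"
    by (simp add: std_normal_density_def divide_right_mono field_simps)
  then have "exp (- (C + k * t)\<^sup>2 / 2) * exp ((t / \<sigma>)\<^sup>2 / 2) \<le> p * exp (- (t / \<sigma>)\<^sup>2 / 2) * exp ((t / \<sigma>)\<^sup>2 / 2)"
    by (rule mult_right_mono) simp
  then have "exp (((t / \<sigma>)\<^sup>2 - (C + k * t)\<^sup>2) / 2) \<le> p"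
    by (simp add: mult.assoc exp_add[symmetric] diff_divide_distrib)
  moreover have "exp (X\<^sup>2 / 2) \<le> exp (((t / \<sigma>)\<^sup>2 - (C + k * t)\<^sup>2) / 2)" using sq by simp
  moreover have "1 + X\<^sup>2 / 2 \<le> exp (X\<^sup>2 / 2)" by (rule exp_ge_add_one_self)
  moreover have "X \<le> X\<^sup>2"
    using X p by (simp add: power2_eq_square mult_le_cancel_right1)
  ultimately show False using X by linarith
qed

text \<open>The hypothesis on \<open>f\<close> is conditional because a density defined by
  \<open>Lim\<close> has a known value only once convergence is established; convergence is proved
  here, from concavity. The third conclusion exports it at the median for the facet
  estimate.\<close>

lemma probit_concave_density:
  fixes F f :: "real \<Rightarrow> real"
  assumes conc: "concave_on {a..} (\<lambda>t. probit (F t))" and "a < m" "0 < \<sigma>" "0 \<le> p"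
    and F01: "\<And>t. a \<le> t \<Longrightarrow> 0 < F t" "\<And>t. a \<le> t \<Longrightarrow> F t < 1"
    and mono: "\<And>s t. s \<le> t \<Longrightarrow> F s \<le> F t"
    and tail: "\<And>t. \<sigma> \<le> t \<Longrightarrow> 1 - F t \<le> p * \<phi> (t / \<sigma>)"
    and median: "F m = 1 / 2"
    and f: "\<And>t d. m \<le> t \<Longrightarrow> ((\<lambda>\<delta>. (F (t + \<delta>) - F t) / \<delta>) \<longlongrightarrow> d) (at_right 0) \<Longrightarrow> f t = d"
  shows "antimono_on {m..} f"
    and "\<And>h. 0 \<le> h \<Longrightarrow> f (m + h * \<sigma>) \<le> f m * exp (- h\<^sup>2 / 2)"
    and "((\<lambda>\<delta>. (F (m + \<delta>) - F m) / \<delta>) \<longlongrightarrow> f m) (at_right 0)"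
proof -
  define \<psi> where "\<psi> = (\<lambda>t. probit (F t))"
  have F: "\<Phi> (\<psi> t) = F t" if "a \<le> t" for t
    using F01 that by (simp add: \<psi>_def Phi_probit)
  have \<psi>: "concave_on {a..} \<psi>" using conc by (simp add: \<psi>_def)
  have \<psi>_mono: "\<psi> s \<le> \<psi> t" if "a \<le> s" "s \<le> t" for s t
    using mono[OF that(2)] F[of s] F[of t] that by (metis Phi_le_iff order_trans)
  have \<psi>_m: "\<psi> m = 0" unfolding \<psi>_def median by (rule probit_eqI) simp
  define is_slope where "is_slope = (\<lambda>t D. ((\<lambda>y. (\<psi> y - \<psi> t) / (y - t)) \<longlongrightarrow> D) (at_right t) \<and>
    (\<forall>y>t. (\<psi> y - \<psi> t) / (y - t) \<le> D) \<and> (\<forall>x. a \<le> x \<and> x < t \<longrightarrow> D \<le> (\<psi> t - \<psi> x) / (t - x)))"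
  have "\<forall>t. a < t \<longrightarrow> (\<exists>D. is_slope t D)"
    using concave_on_right_slope[OF \<psi>] unfolding is_slope_def by (metis (no_types, lifting))
  then obtain D where D: "\<And>t. a < t \<Longrightarrow> is_slope t (D t)" by metis
  have D_lim: "((\<lambda>y. (\<psi> y - \<psi> t) / (y - t)) \<longlongrightarrow> D t) (at_right t)" if "a < t" for t
    using D[OF that] by (simp add: is_slope_def)
  have D_right: "(\<psi> y - \<psi> t) / (y - t) \<le> D t" if "a < t" "t < y" for t y
    using D[OF that(1)] that(2) by (simp add: is_slope_def)
  have D_left: "D t \<le> (\<psi> t - \<psi> x) / (t - x)" if "a \<le> x" "x < t" for t x
    using D[of t] that unfolding is_slope_def by force
  have D_nonneg: "0 \<le> D t" if "a < t" for t
  proof -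
    have "0 \<le> (\<psi> (t + 1) - \<psi> t) / (t + 1 - t)" using \<psi>_mono[of t "t + 1"] that by simp
    then show ?thesis using D_right[OF that, of "t + 1"] by simp
  qed
  have D_anti: "D t \<le> D s" if "a < s" "s \<le> t" for s t
  proof (cases "s = t")
    case False
    then show ?thesis using D_left[of s t] D_right[of s t] that by (auto intro: order_trans)
  qed simp
  have density: "((\<lambda>\<delta>. (F (t + \<delta>) - F t) / \<delta>) \<longlongrightarrow> \<phi> (\<psi> t) * D t) (at_right 0)" if "a < t" for t
  proof -
    \<comment> \<open>A concave \<psi> may have corners, so the chain rule is applied within the
      half-line to the right of t.\<close>
    have "(\<psi> has_real_derivative D t) (at t within {t<..})"
      using D_lim[OF that] by (simp add: has_field_derivative_iff)
    then have "((\<lambda>y. \<Phi> (\<psi> y)) has_real_derivative \<phi> (\<psi> t) * D t) (at t within {t<..})"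
      by (rule DERIV_chain2[OF Phi_deriv])
    then have "((\<lambda>y. (\<Phi> (\<psi> y) - \<Phi> (\<psi> t)) / (y - t)) \<longlongrightarrow> \<phi> (\<psi> t) * D t) (at_right t)"
      by (simp add: has_field_derivative_iff)
    then have "((\<lambda>\<delta>. (\<Phi> (\<psi> (\<delta> + t)) - \<Phi> (\<psi> t)) / (\<delta> + t - t)) \<longlongrightarrow> \<phi> (\<psi> t) * D t) (at_right 0)"
      by (subst (asm) filterlim_at_right_to_0)
    moreover have "\<forall>\<^sub>F \<delta> in at_right 0. (\<Phi> (\<psi> (\<delta> + t)) - \<Phi> (\<psi> t)) / (\<delta> + t - t) = (F (t + \<delta>) - F t) / \<delta>"
      using eventually_at_right_less[of 0]
      by eventually_elim (use that F in \<open>simp add: add.commute\<close>)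
    ultimately show ?thesis by (rule Lim_transform_eventually)
  qed
  have f_eq: "f t = \<phi> (\<psi> t) * D t" if "m \<le> t" for t
    using f[OF that density] that \<open>a < m\<close> by simp
  show "((\<lambda>\<delta>. (F (m + \<delta>) - F m) / \<delta>) \<longlongrightarrow> f m) (at_right 0)"
    using density[OF \<open>a < m\<close>] f_eq by simp
  show "antimono_on {m..} f"
  proof (rule monotone_onI)
    fix s t assume st: "s \<in> {m..}" "t \<in> {m..}" "s \<le> t"
    have "0 \<le> \<psi> s" "\<psi> s \<le> \<psi> t" using \<psi>_mono[of m s] \<psi>_mono[of s t] \<psi>_m \<open>a < m\<close> st by auto
    then have "\<phi> (\<psi> t) \<le> \<phi> (\<psi> s)" by (intro phi_abs_mono) simp
    then have "\<phi> (\<psi> t) * D t \<le> \<phi> (\<psi> s) * D s"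
      using st \<open>a < m\<close> by (intro mult_mono D_anti D_nonneg less_imp_le[OF phi_pos]) auto
    then show "f t \<le> f s" using f_eq st by simp
  qed
  \<comment> \<open>The line through (t, \<psi> t) of slope \<open>D t\<close> lies above \<psi> to
    the right of t. Hence the tail of \<Phi> along this line is at most the tail of F, which bounds
    the slope from below.\<close>
  have D_ge: "1 / \<sigma> \<le> D t" if "a < t" for t
  proof (rule gaussian_tail_slope_bound[OF \<open>0 < \<sigma>\<close> D_nonneg[OF that] \<open>0 \<le> p\<close>])
    fix y assume y: "max (t + 1) \<sigma> \<le> y"
    then have "t < y" "\<sigma> \<le> y" by auto
    have "\<psi> y \<le> \<psi> t + D t * (y - t)"
      using D_right[OF that \<open>t < y\<close>] \<open>t < y\<close> by (simp add: divide_le_eq)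
    then have "F y \<le> \<Phi> ((\<psi> t - D t * t) + D t * y)"
      using F[of y] that \<open>t < y\<close> Phi_le_iff[of "\<psi> y"] by (simp add: algebra_simps)
    then show "1 - \<Phi> ((\<psi> t - D t * t) + D t * y) \<le> p * \<phi> (y / \<sigma>)"
      using tail[OF \<open>\<sigma> \<le> y\<close>] by linarith
  qed
  show "f (m + h * \<sigma>) \<le> f m * exp (- h\<^sup>2 / 2)" if "0 \<le> h" for h
  proof -
    let ?t = "m + h * \<sigma>"
    have "0 \<le> h * \<sigma>" using that \<open>0 < \<sigma>\<close> by simp
    have at: "a < ?t" "m \<le> ?t" using \<open>a < m\<close> \<open>0 \<le> h * \<sigma>\<close> by auto
    \<comment> \<open>By concavity the secant slope from m dominates the right slope at the
      endpoint, which is at least 1 / \<sigma>; and \<psi> m = 0.\<close>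
    have "h \<le> \<psi> ?t"
    proof (cases "h = 0")
      case False
      then have "0 < h * \<sigma>" using that \<open>0 < \<sigma>\<close> by simp
      then have "1 / \<sigma> \<le> (\<psi> ?t - \<psi> m) / (?t - m)"
        using D_ge[OF at(1)] D_left[of m ?t] \<open>a < m\<close> by simp
      moreover have "0 < h" using False that by simp
      ultimately show ?thesis using \<psi>_m \<open>0 < \<sigma>\<close> by (simp add: field_simps)
    qed (use \<psi>_m in simp)
    then have "\<phi> (\<psi> ?t) \<le> \<phi> h" using that by (intro phi_abs_mono) simp
    then have "\<phi> (\<psi> ?t) * D ?t \<le> \<phi> h * D m"
      using at \<open>a < m\<close> by (intro mult_mono D_anti D_nonneg less_imp_le[OF phi_pos]) auto
    also have "\<phi> h = \<phi> (\<psi> m) * exp (- h\<^sup>2 / 2)" by (simp add: \<psi>_m std_normal_density_def)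
    finally show ?thesis using f_eq[OF at(2)] f_eq[of m] by (simp add: mult_ac)
  qed
qed

section \<open>Normal marginals and the coordinate maximum\<close>

lemma measure_normal_law:
  assumes "0 \<le> \<sigma>" "A \<in> sets borel"
  shows "measure (normal_law 0 \<sigma>) A = measure std_normal_distribution {z. \<sigma> * z \<in> A}"
  unfolding normal_law_eq_distr[OF assms(1)] using assms(2)
  by (subst measure_distr) (auto simp: vimage_def)

lemma normal_law_second_moment:
  assumes "0 \<le> \<sigma>" shows "(\<integral>x. x\<^sup>2 \<partial>normal_law 0 \<sigma>) = \<sigma>\<^sup>2"
proof -
  have "(\<integral>x. x\<^sup>2 \<partial>normal_law 0 \<sigma>) = (\<integral>z. \<sigma>\<^sup>2 * z\<^sup>2 \<partial>std_normal_distribution)"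
    unfolding normal_law_eq_distr[OF assms] by (subst integral_distr) (auto simp: power_mult_distrib)
  also have "(\<integral>z. z\<^sup>2 \<partial>std_normal_distribution) = 1"
    using std_normal_distribution_even_moments(1)[of 1] by (simp add: fact_numeral)
  then have "(\<integral>z. \<sigma>\<^sup>2 * z\<^sup>2 \<partial>std_normal_distribution) = \<sigma>\<^sup>2" by simp
  finally show ?thesis .
qed

text \<open>Enlarging the standard deviation to s, later the maximal one, only enlarges the tail,
  and t \<ge> s brings t / s into the range of \<open>Phi_upper_tail_le\<close>.\<close>

lemma normal_law_upper_tail:
  assumes "0 \<le> \<sigma>" "\<sigma> \<le> s" "s \<le> t" "0 < s"
  shows "measure (normal_law 0 \<sigma>) {t<..} \<le> \<phi> (t / s)"
proof (cases "\<sigma> = 0")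
  case True
  have "measure (normal_law 0 \<sigma>) {t<..} = 0"
    using assms True by (subst measure_normal_law) auto
  then show ?thesis using phi_pos[of "t / s"] by simp
next
  case False
  then have "0 < \<sigma>" using assms by simp
  have "{z. \<sigma> * z \<in> {t<..}} = {t / \<sigma><..}" using \<open>0 < \<sigma>\<close> by (auto simp: field_simps)
  then have "measure (normal_law 0 \<sigma>) {t<..} = 1 - \<Phi> (t / \<sigma>)"
    using assms by (subst measure_normal_law) (auto simp: std_normal_measure_greaterThan)
  also have "\<dots> \<le> 1 - \<Phi> (t / s)"
    using assms \<open>0 < \<sigma>\<close> by (simp add: frac_le)
  also have "\<dots> \<le> \<phi> (t / s)"
    by (rule Phi_upper_tail_le) (use assms in simp)
  finally show ?thesis .
qed

lemma normal_law_singleton: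
  assumes "0 \<le> \<sigma>" "0 < t" shows "measure (normal_law 0 \<sigma>) {t} = 0"
proof (cases "\<sigma> = 0")
  case False
  then have "{z. \<sigma> * z \<in> {t}} = {t / \<sigma>}" by (auto simp: field_simps)
  then show ?thesis using assms by (subst measure_normal_law) auto
qed (use assms in \<open>simp add: measure_normal_law\<close>)

lemma coordinate_max_le_iff: "(MAX i. x $ i) \<le> t \<longleftrightarrow> (\<forall>i. x $ i \<le> t)" for x :: "real ^ 'p::finite"
  by (subst Max_le_iff) auto

lemma coordinate_max_less_iff: "(MAX i. x $ i) < t \<longleftrightarrow> (\<forall>i. x $ i < t)" for x :: "real ^ 'p::finite"
  by (subst Max_less_iff) auto

lemma coordinate_max_ge_iff: "t \<le> (MAX i. x $ i) \<longleftrightarrow> (\<exists>i. t \<le> x $ i)" for x :: "real ^ 'p::finite"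
  by (subst Max_ge_iff) auto

lemma coordinate_max_lipschitz:
  fixes x y :: "real ^ 'p::finite"
  shows "\<bar>(MAX i. x $ i) - (MAX i. y $ i)\<bar> \<le> norm (x - y)"
proof -
  have "(MAX i. x $ i) \<le> (MAX i. y $ i) + norm (x - y)" for x y :: "real ^ 'p"
    unfolding coordinate_max_le_iff
  proof
    fix i
    have "x $ i - y $ i \<le> norm (x - y)" using component_le_norm_cart[of "x - y" i] by simp
    moreover have "y $ i \<le> (MAX i. y $ i)" by simp
    ultimately show "x $ i \<le> (MAX i. y $ i) + norm (x - y)" by linarith
  qed
  from this[of x y] this[of y x] show ?thesis
    unfolding norm_minus_commute[of y x] by linarith
qed

lemma coordinate_max_convex: "convex_on UNIV (\<lambda>x :: real ^ 'p::finite. MAX i. x $ i)"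
  unfolding convex_on_def
proof (intro conjI ballI allI impI)
  fix x y :: "real ^ 'p" and u v :: real assume uv: "0 \<le> u" "0 \<le> v" "u + v = 1"
  show "(MAX i. (u *\<^sub>R x + v *\<^sub>R y) $ i) \<le> u * (MAX i. x $ i) + v * (MAX i. y $ i)"
    unfolding coordinate_max_le_iff using uv by (auto intro!: add_mono mult_left_mono)
qed simp

text \<open>Provides the \<open>shift\<close> hypothesis of \<open>Ehrhard_sublevel_sets\<close>,
  with the all-ones vector as direction.\<close>

lemma coordinate_max_shift: "(MAX i. (x - t *\<^sub>R (\<chi> i. 1)) $ i) = (MAX i. x $ i) - t" for x :: "real ^ 'p::finite"
proof (rule antisym)
  show "(MAX i. (x - t *\<^sub>R (\<chi> i. 1)) $ i) \<le> (MAX i. x $ i) - t"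
    unfolding coordinate_max_le_iff by simp
  have "(MAX i. x $ i) \<le> (MAX i. (x - t *\<^sub>R (\<chi> i. 1)) $ i) + t"
    unfolding coordinate_max_le_iff
  proof
    fix i
    have "x $ i - t = (x - t *\<^sub>R (\<chi> i. 1)) $ i" by simp
    also have "\<dots> \<le> (MAX i. (x - t *\<^sub>R (\<chi> i. 1)) $ i)" by (rule Max_ge) auto
    finally show "x $ i \<le> (MAX i. (x - t *\<^sub>R (\<chi> i. 1)) $ i) + t" by linarith
  qed
  then show "(MAX i. x $ i) - t \<le> (MAX i. (x - t *\<^sub>R (\<chi> i. 1)) $ i)" by linarith
qed

lemma centered_gaussian_vector_coordinate:
  fixes Z :: "'a \<Rightarrow> real ^ 'p::finite"
  assumes "centered_gaussian_vector P Z \<Sigma>"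
  shows "distr P borel (\<lambda>\<omega>. Z \<omega> $ i) = normal_law 0 (sqrt (\<Sigma> $ i $ i))" and "0 \<le> \<Sigma> $ i $ i"
proof -
  have e: "axis i 1 \<bullet> (\<Sigma> *v axis i 1) = \<Sigma> $ i $ i"
    by (simp add: inner_axis' matrix_vector_mult_basis column_def)
  have t: "distr P borel (\<lambda>\<omega>. t \<bullet> Z \<omega>) = normal_law 0 (sqrt (t \<bullet> (\<Sigma> *v t)))" "0 \<le> t \<bullet> (\<Sigma> *v t)" for t
    using assms unfolding centered_gaussian_vector_def by blast+
  show "distr P borel (\<lambda>\<omega>. Z \<omega> $ i) = normal_law 0 (sqrt (\<Sigma> $ i $ i))" "0 \<le> \<Sigma> $ i $ i"
    using t[of "axis i 1"] unfolding e by (simp_all add: inner_axis')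
qed

text \<open>The vectors \<open>r i\<close> are the rows of a matrix that maps a standard Gaussian
  vector to the law of Z. Sublevel sets of the maximum thus become polyhedra with normals
  \<open>r i\<close>, some of which may vanish or coincide.\<close>

lemma centered_gaussian_vector_std:
  fixes Z :: "'a \<Rightarrow> real ^ 'p::finite"
  assumes P: "prob_space P" and Z: "centered_gaussian_vector P Z \<Sigma>"
  obtains r :: "'p \<Rightarrow> real ^ 'p" where "\<And>B. B \<in> sets borel \<Longrightarrow>
    measure P {\<omega> \<in> space P. Z \<omega> \<in> B} = measure (gauss_law basis_list) {x. (\<chi> i. r i \<bullet> x) \<in> B}"
proof -
  have [measurable]: "Z \<in> borel_measurable P" using Z by (simp add: centered_gaussian_vector_def)
  obtain v :: "real ^ 'p \<Rightarrow> real ^ 'p" where law: "distr P borel Z = gauss_law (map v basis_list)"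
    using centered_gaussian_vector_law[OF P Z] by blast
  define A where "A = (\<lambda>x. \<Sum>b\<in>Basis. (x \<bullet> b) *\<^sub>R v b)"
  define r where "r = (\<lambda>i. \<Sum>b\<in>Basis. (v b $ i) *\<^sub>R b)"
  have A: "linear A"
    unfolding A_def
    by (auto intro!: linearI simp: inner_add_left scaleR_add_left sum.distrib scaleR_sum_right)
  have [measurable]: "A \<in> borel_measurable borel"
    by (intro borel_measurable_continuous_onI linear_continuous_on linear_conv_bounded_linear[THEN iffD1] A)
  have "A b = v b" if "b \<in> Basis" for b
  proof -
    have "A b = (\<Sum>c\<in>Basis. if c = b then v c else 0)"
      unfolding A_def using that by (intro sum.cong refl) (auto simp: inner_Basis)
    then show ?thesis using that by simp
  qed
  then have map_eq: "map A basis_list = map v basis_list" by (simp add: basis_list)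
  have law': "distr P borel Z = distr (gauss_law basis_list) borel A"
    by (simp only: law distr_gauss_law_linear[OF A] map_eq)
  have A_eq: "A x = (\<chi> i. r i \<bullet> x)" for x
    by (simp add: A_def r_def vec_eq_iff inner_sum_left inner_commute[of x] mult.commute)
  have "measure P {\<omega> \<in> space P. Z \<omega> \<in> B} = measure (gauss_law basis_list) {x. (\<chi> i. r i \<bullet> x) \<in> B}"
    if "B \<in> sets borel" for B
  proof -
    have "measure P {\<omega> \<in> space P. Z \<omega> \<in> B} = measure (distr P borel Z) B"
      using that by (subst measure_distr) (auto simp: vimage_def Int_def conj_commute)
    also have "\<dots> = measure (gauss_law basis_list) {x. A x \<in> B}"
      unfolding law' using that by (subst measure_distr) (auto simp: vimage_def)
    finally show ?thesis by (simp add: A_eq)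
  qed
  then show ?thesis by (rule that)
qed

theorem lemma2p2:
  fixes P :: "'a measure"
    and Z :: "'a \<Rightarrow> real ^ 'p::finite"
    and \<Sigma> :: "real ^ 'p ^ 'p"
    and M :: "'a \<Rightarrow> real"
    and f :: "real \<Rightarrow> real"
    and \<sigma>max m :: real
  assumes "prob_space P"
    and "centered_gaussian_vector P Z \<Sigma>"
    and "M = (\<lambda>\<omega>. MAX i. Z \<omega> $ i)"
    and "\<And>t. t > 0 \<Longrightarrow> f t = right_density P M t"
    and "\<sigma>max \<ge> 0"
    and "\<sigma>max\<^sup>2 = (MAX i. prob_space.expectation P (\<lambda>\<omega>. (Z \<omega> $ i)\<^sup>2))"
    and "is_median P M m"
    and "m > 0"
  shows "antimono_on {m..} f \<and>
    (\<forall>h\<ge>0. f (m + h * \<sigma>max) \<le> sqrt (2 * pi) * f m * std_normal_density h \<and>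
            sqrt (2 * pi) * f m * std_normal_density h = f m * exp (- h\<^sup>2 / 2)) \<and>
    (CARD('p) \<ge> 3 \<longrightarrow>
      (\<forall>h\<ge>0. f (m + h * \<sigma>max) \<le> 4 * ln (real CARD('p)) / m * exp (- h\<^sup>2 / 2)))"
proof -
  interpret prob_space P by fact
  have [measurable]: "Z \<in> borel_measurable P"
    using assms(2) by (simp add: centered_gaussian_vector_def)
  have M_le: "M \<omega> \<le> t \<longleftrightarrow> (\<forall>i. Z \<omega> $ i \<le> t)" and M_less: "M \<omega> < t \<longleftrightarrow> (\<forall>i. Z \<omega> $ i < t)"
    and M_ge: "t \<le> M \<omega> \<longleftrightarrow> (\<exists>i. t \<le> Z \<omega> $ i)" for \<omega> t
    by (simp_all only: assms(3) coordinate_max_le_iff coordinate_max_less_iff coordinate_max_ge_iff)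
  have max_cont: "continuous_on UNIV (\<lambda>x :: real ^ 'p. MAX i. x $ i)"
    by (rule lipschitz_abs_imp_continuous[where L=1]) (simp add: coordinate_max_lipschitz)
  have [measurable]: "(\<lambda>x :: real ^ 'p. MAX i. x $ i) \<in> borel_measurable borel"
    by (rule borel_measurable_continuous_onI[OF max_cont])
  have M_meas [measurable]: "M \<in> borel_measurable P"
    unfolding assms(3) by measurable
  have Zi [measurable]: "(\<lambda>\<omega>. Z \<omega> $ i) \<in> borel_measurable P" for i
    by (rule measurable_compose[OF \<open>Z \<in> borel_measurable P\<close>]) (intro borel_measurable_continuous_onI continuous_intros)
  define s where "s = (\<lambda>i. sqrt (\<Sigma> $ i $ i))"
  have s0: "0 \<le> s i" for i
    using centered_gaussian_vector_coordinate(2)[OF assms(2)] by (simp add: s_def)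
  have Z_prob: "prob {\<omega> \<in> space P. Z \<omega> $ i \<in> A} = measure (normal_law 0 (s i)) A" if "A \<in> sets borel" for i A
  proof -
    have "prob {\<omega> \<in> space P. Z \<omega> $ i \<in> A} = measure (distr P borel (\<lambda>\<omega>. Z \<omega> $ i)) A"
      using that by (subst measure_distr) (auto simp: vimage_def Int_def conj_commute)
    then show ?thesis by (simp add: centered_gaussian_vector_coordinate(1)[OF assms(2)] s_def)
  qed
  have s_le: "s i \<le> \<sigma>max" for i
  proof -
    have "expectation (\<lambda>\<omega>. (Z \<omega> $ i)\<^sup>2) = (\<integral>x. x\<^sup>2 \<partial>distr P borel (\<lambda>\<omega>. Z \<omega> $ i))"
      by (rule integral_distr[symmetric]) auto
    also have "\<dots> = (s i)\<^sup>2"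
      using normal_law_second_moment[OF s0] by (simp add: centered_gaussian_vector_coordinate(1)[OF assms(2)] s_def)
    finally have "(s i)\<^sup>2 = expectation (\<lambda>\<omega>. (Z \<omega> $ i)\<^sup>2)" by simp
    also have "\<dots> \<le> \<sigma>max\<^sup>2" unfolding assms(6) by (rule Max_ge) auto
    finally show ?thesis using assms(5) by (rule power2_le_imp_le)
  qed
  define F where "F = (\<lambda>t. prob {\<omega> \<in> space P. M \<omega> \<le> t})"
  have union_bound: "prob {\<omega> \<in> space P. \<exists>i. Z \<omega> $ i \<in> A} \<le> (\<Sum>i\<in>UNIV. measure (normal_law 0 (s i)) A)"
    if [measurable]: "A \<in> sets borel" for A
  proof -
    have "{\<omega> \<in> space P. \<exists>i. Z \<omega> $ i \<in> A} = (\<Union>i. {\<omega> \<in> space P. Z \<omega> $ i \<in> A})" by auto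
    also have "prob \<dots> \<le> (\<Sum>i\<in>UNIV. prob {\<omega> \<in> space P. Z \<omega> $ i \<in> A})"
      by (rule finite_measure_subadditive_finite) auto
    finally show ?thesis by (simp add: Z_prob)
  qed
  \<comment> \<open>Restricted to t > 0, since a coordinate of variance zero can put an atom of M at
    0.\<close>
  have no_atom: "prob {\<omega> \<in> space P. M \<omega> = t} = 0" if "0 < t" for t
  proof -
    have "prob {\<omega> \<in> space P. M \<omega> = t} \<le> prob {\<omega> \<in> space P. \<exists>i. Z \<omega> $ i \<in> {t}}"
    proof (rule finite_measure_mono)
      show "{\<omega> \<in> space P. M \<omega> = t} \<subseteq> {\<omega> \<in> space P. \<exists>i. Z \<omega> $ i \<in> {t}}"
      proof safe
        fix \<omega> assume "t = M \<omega>"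
        then obtain i where "t \<le> Z \<omega> $ i" using M_ge[of t \<omega>] by auto
        moreover have "Z \<omega> $ i \<le> t" using M_le[of \<omega> t] \<open>t = M \<omega>\<close> by auto
        ultimately show "\<exists>i. Z \<omega> $ i \<in> {M \<omega>}" using \<open>t = M \<omega>\<close> by (intro exI[of _ i]) auto
      qed
    qed measurable
    also have "\<dots> \<le> (\<Sum>i\<in>UNIV. measure (normal_law 0 (s i)) {t})" by (rule union_bound) simp
    also have "\<dots> = 0" using normal_law_singleton[OF s0 that] by simp
    finally show ?thesis by (simp add: measure_le_0_iff)
  qed
  have less_eq: "prob {\<omega> \<in> space P. M \<omega> < t} = F t" if "0 < t" for t
  proof -
    have "F t = prob ({\<omega> \<in> space P. M \<omega> < t} \<union> {\<omega> \<in> space P. M \<omega> = t})"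
      unfolding F_def by (intro arg_cong[where f=prob]) auto
    also have "\<dots> = prob {\<omega> \<in> space P. M \<omega> < t} + prob {\<omega> \<in> space P. M \<omega> = t}"
      by (rule finite_measure_Union) auto
    finally show ?thesis using no_atom[OF that] by simp
  qed
  have compl: "prob {\<omega> \<in> space P. t \<le> M \<omega>} = 1 - F t" if "0 < t" for t
  proof -
    have "{\<omega> \<in> space P. t \<le> M \<omega>} = space P - {\<omega> \<in> space P. M \<omega> < t}" by auto
    then show ?thesis using prob_compl[of "{\<omega> \<in> space P. M \<omega> < t}"] less_eq[OF that] by simp
  qed
  have F_mono: "F x \<le> F y" if "x \<le> y" for x y
    unfolding F_def using that by (intro finite_measure_mono) auto
  \<comment> \<open>In the absence of an atom at m, the two median inequalities read F m \<ge> 1/2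
    and 1 - F m \<ge> 1/2.\<close>
  have F_m: "F m = 1 / 2"
  proof -
    have "1 / 2 \<le> F m" "1 / 2 \<le> prob {\<omega> \<in> space P. m \<le> M \<omega>}"
      using assms(7) by (simp_all add: is_median_def F_def)
    then show ?thesis using compl[OF assms(8)] by simp
  qed
  \<comment> \<open>If all variances vanished, M would be 0 almost surely, against the probability
    1/2 of M \<ge> m > 0.\<close>
  obtain i0 where i0: "0 < s i0"
  proof (rule ccontr)
    assume "\<not> thesis"
    then have "s i = 0" for i using that s0[of i] by (metis order_le_less)
    then have "measure (normal_law 0 (s i)) {m..} = 0" for i
      using assms(8) by (subst measure_normal_law) auto
    then have "prob {\<omega> \<in> space P. \<exists>i. Z \<omega> $ i \<in> {m..}} \<le> 0"
      using union_bound[of "{m..}"] by simp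
    then show False using compl[OF assms(8)] F_m by (simp add: M_ge)
  qed
  then have \<sigma>pos: "0 < \<sigma>max" using s_le[of i0] by simp
  have F_lt_1: "F t < 1" for t
  proof -
    have "F t \<le> prob {\<omega> \<in> space P. Z \<omega> $ i0 \<in> {..t}}"
      unfolding F_def by (intro finite_measure_mono) (auto simp: M_le)
    also have "\<dots> = measure std_normal_distribution {z. s i0 * z \<in> {..t}}"
      by (subst Z_prob, simp, rule measure_normal_law[OF s0]) simp
    also have "{z. s i0 * z \<in> {..t}} = {..t / s i0}" using i0 by (auto simp: field_simps)
    also have "measure std_normal_distribution {..t / s i0} = \<Phi> (t / s i0)"
      by (simp add: std_normal_cdf_def)
    also have "\<dots> < 1" by simp
    finally show ?thesis .
  qed
  \<comment> \<open>Concavity needs room to the left of m to control the slopes at m. Continuity of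
    F at m, where it equals 1/2, keeps F positive slightly before m.\<close>
  obtain a where a: "0 < a" "a < m" "0 < F a"
  proof -
    interpret D: real_distribution "distr P borel M" by (rule real_distribution_distr) measurable
    have cdf: "cdf (distr P borel M) = F"
      unfolding cdf_def2 F_def fun_eq_iff by (subst measure_distr) (auto intro!: arg_cong[where f=prob])
    have "measure (distr P borel M) {m} = 0"
      using no_atom[OF assms(8)] by (subst measure_distr) (auto simp: vimage_def Int_def conj_commute)
    then have "isCont F m" using D.isCont_cdf[of m] by (simp add: cdf)
    then have "(F \<longlongrightarrow> F m) (at_left m)" by (simp add: isCont_def filterlim_at_split)
    then have "\<forall>\<^sub>F x in at_left m. 0 < F x" by (rule order_tendstoD) (simp add: F_m)
    moreover have "\<forall>\<^sub>F x in at_left m. x \<in> {0<..<m}" by (rule eventually_at_left_real[OF assms(8)])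
    ultimately have "\<forall>\<^sub>F x in at_left m. 0 < F x \<and> x \<in> {0<..<m}" by (rule eventually_conj)
    from eventually_happens'[OF trivial_limit_at_left_real this]
    obtain x where "0 < F x" "x \<in> {0<..<m}" by blast
    then show ?thesis using that by auto
  qed
  have F_pos: "0 < F t" if "a \<le> t" for t
    using a(3) F_mono[OF that] by linarith
  have tail: "1 - F t \<le> real CARD('p) * \<phi> (t / \<sigma>max)" if "\<sigma>max \<le> t" for t
  proof -
    have "1 - F t = prob (space P - {\<omega> \<in> space P. M \<omega> \<le> t})" unfolding F_def by (simp add: prob_compl)
    also have "space P - {\<omega> \<in> space P. M \<omega> \<le> t} = {\<omega> \<in> space P. \<exists>i. Z \<omega> $ i \<in> {t<..}}"
      unfolding M_le greaterThan_iff not_le[symmetric] by blast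
    also have "prob \<dots> \<le> (\<Sum>i\<in>UNIV. measure (normal_law 0 (s i)) {t<..})" by (rule union_bound) simp
    also have "\<dots> \<le> (\<Sum>i\<in>(UNIV :: 'p set). \<phi> (t / \<sigma>max))"
      by (intro sum_mono normal_law_upper_tail s0 s_le that \<sigma>pos)
    finally show ?thesis by simp
  qed
  have concave: "concave_on {a..} (\<lambda>t. probit (F t))"
  proof -
    obtain v :: "real ^ 'p \<Rightarrow> real ^ 'p" where law: "distr P borel Z = gauss_law (map v basis_list)"
      using centered_gaussian_vector_law[OF assms(1,2)] by blast
    have F_eq: "measure (gauss_law (map v basis_list)) {x. (MAX i. x $ i) \<le> t} = F t"
      and at_eq: "measure (gauss_law (map v basis_list)) {x. (MAX i. x $ i) = t} = prob {\<omega> \<in> space P. M \<omega> = t}" for t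
      unfolding law[symmetric] F_def assms(3)
      by (subst measure_distr; auto intro!: arg_cong[where f=prob])+
    show ?thesis
      unfolding F_eq[symmetric]
    proof (rule Ehrhard_sublevel_sets[where L=1 and e="\<chi> i. 1"])
      show "0 < measure (gauss_law (map v basis_list)) {x. (MAX i. x $ i) \<le> t}" if "t \<in> {a..}" for t
        unfolding F_eq using F_pos that by simp
      show "measure (gauss_law (map v basis_list)) {x. (MAX i. x $ i) \<le> t} < 1" for t
        unfolding F_eq by (rule F_lt_1)
      show "measure (gauss_law (map v basis_list)) {x. (MAX i. x $ i) = t} = 0" if "t \<in> {a..}" for t
        unfolding at_eq using no_atom that a(1) by simp
    qed (use coordinate_max_lipschitz coordinate_max_convex coordinate_max_shift in auto)
  qed
  have shell: "prob {\<omega> \<in> space P. t \<le> M \<omega> \<and> M \<omega> < t + \<delta>} = F (t + \<delta>) - F t" if "0 < t" "0 < \<delta>" for t \<delta>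
  proof -
    have "{\<omega> \<in> space P. t \<le> M \<omega> \<and> M \<omega> < t + \<delta>} = {\<omega> \<in> space P. M \<omega> < t + \<delta>} - {\<omega> \<in> space P. M \<omega> < t}"
      by auto
    also have "prob \<dots> = prob {\<omega> \<in> space P. M \<omega> < t + \<delta>} - prob {\<omega> \<in> space P. M \<omega> < t}"
      using that by (intro finite_measure_Diff) auto
    finally show ?thesis using less_eq that by simp
  qed
  have shell_quot: "\<forall>\<^sub>F \<delta> in at_right 0. (F (t + \<delta>) - F t) / \<delta> =
      prob {\<omega> \<in> space P. t \<le> M \<omega> \<and> M \<omega> < t + \<delta>} / \<delta>" if "0 < t" for t
    using eventually_at_right_less[of 0] by eventually_elim (use shell that in auto)
  \<comment> \<open>\<open>right_density\<close> is a \<open>Lim\<close>, so a proved limit of the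
    quotients of F is what pins down its value.\<close>
  have f_eq: "f t = d" if "m \<le> t" "((\<lambda>\<delta>. (F (t + \<delta>) - F t) / \<delta>) \<longlongrightarrow> d) (at_right 0)" for t d
  proof -
    have "0 < t" using that(1) assms(8) by simp
    have "((\<lambda>\<delta>. prob {\<omega> \<in> space P. t \<le> M \<omega> \<and> M \<omega> < t + \<delta>} / \<delta>) \<longlongrightarrow> d) (at_right 0)"
      using that(2) shell_quot[OF \<open>0 < t\<close>] by (rule Lim_transform_eventually)
    then show ?thesis
      unfolding assms(4)[OF \<open>0 < t\<close>] right_density_def by (intro tendsto_Lim) auto
  qed
  note density = probit_concave_density[OF concave a(2) \<sigma>pos _ F_pos F_lt_1 F_mono tail F_m f_eq]
  have anti: "antimono_on {m..} f" by (rule density(1)) auto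
  have decay: "f (m + h * \<sigma>max) \<le> f m * exp (- h\<^sup>2 / 2)" if "0 \<le> h" for h
    by (rule density(2)) (use that in auto)
  have f_m: "((\<lambda>\<delta>. (F (m + \<delta>) - F m) / \<delta>) \<longlongrightarrow> f m) (at_right 0)"
    by (rule density(3)) auto
  have log_bound: "f m \<le> 4 * ln (real CARD('p)) / m" if "3 \<le> CARD('p)"
  proof -
    obtain r :: "'p \<Rightarrow> real ^ 'p" where r: "\<And>B. B \<in> sets borel \<Longrightarrow>
      prob {\<omega> \<in> space P. Z \<omega> \<in> B} = measure (gauss_law basis_list) {x. (\<chi> i. r i \<bullet> x) \<in> B}"
      using centered_gaussian_vector_std[OF assms(1,2)] by blast
    have 1: "F t = measure (gauss_law basis_list) {x. \<forall>w\<in>range r. w \<bullet> x \<le> t}" for t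
      using r[of "{x. (MAX i. x $ i) \<le> t}"] by (simp add: F_def M_le coordinate_max_le_iff)
    have 2: "prob {\<omega> \<in> space P. t \<le> M \<omega> \<and> M \<omega> < t + \<delta>} =
        measure (gauss_law basis_list) {x. (\<forall>w\<in>range r. w \<bullet> x < t + \<delta>) \<and> (\<exists>w\<in>range r. t \<le> w \<bullet> x)}" for t \<delta>
      using r[of "{x. t \<le> (MAX i. x $ i) \<and> (MAX i. x $ i) < t + \<delta>}"]
      by (simp add: M_less M_ge coordinate_max_less_iff coordinate_max_ge_iff conj_commute)
    show ?thesis
    proof (rule shell_density_le_log)
      show "finite (range r)" by simp
      show "1 / 2 \<le> measure (gauss_law basis_list) {x. \<forall>w\<in>range r. w \<bullet> x \<le> m}"
        using F_m by (simp only: 1[symmetric])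
      have "((\<lambda>\<delta>. prob {\<omega> \<in> space P. m \<le> M \<omega> \<and> M \<omega> < m + \<delta>} / \<delta>) \<longlongrightarrow> f m) (at_right 0)"
        using f_m shell_quot[OF assms(8)] by (rule Lim_transform_eventually)
      then show "((\<lambda>\<delta>. measure (gauss_law basis_list) {x. (\<forall>w\<in>range r. w \<bullet> x < m + \<delta>) \<and> (\<exists>w\<in>range r. m \<le> w \<bullet> x)} / \<delta>)
          \<longlongrightarrow> f m) (at_right 0)"
        by (simp only: 2)
      \<comment> \<open>Coinciding rows describe the same facet, so the number of facets can be
        smaller than the dimension.\<close>
      show "real (card (range r)) \<le> real CARD('p)" by (simp add: card_image_le)
    qed (use that assms(8) in auto)
  qed
  have normal: "sqrt (2 * pi) * f m * std_normal_density h = f m * exp (- h\<^sup>2 / 2)" for h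
    by (simp add: std_normal_density_def)
  have "f (m + h * \<sigma>max) \<le> 4 * ln (real CARD('p)) / m * exp (- h\<^sup>2 / 2)"
    if "3 \<le> CARD('p)" "0 \<le> h" for h
    using decay[OF that(2)] mult_right_mono[OF log_bound[OF that(1)], of "exp (- h\<^sup>2 / 2)"] by simp
  then show ?thesis using anti decay unfolding normal by blast
qed

end
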